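(* Let $M$ be an $n$-dimensional Poisson manifold with Poisson bivector field $P$, written in local coordinates $x_1,\dots,x_n$ on a chart $U$ as $P=\sum_{i<j}P^{ij}(x)\,\partial_{x_i}\wedge\partial_{x_j}$, where the $P^{ij}$ are analytic functions on $U$, $P^{ij}=-P^{ji}$, and $$\sum_{l=1}^{n}\Big(P^{lj}\frac{\partial P^{ik}}{\partial x_l}+P^{li}\frac{\partial P^{kj}}{\partial x_l}+P^{lk}\frac{\partial P^{ji}}{\partial x_l}\Big)=0\qquad\text{for all } i,j,k.$$ Let $V$ be the $bc$–$\beta\gamma$ vertex superalgebra on $n$ generators over $U$ and let $$d_{qL}=\Big\{\oint\Big(P^{ij}(\gamma)\,(c_i\beta_j-\beta_ic_j)+\partial_kP^{ij}(\gamma)\,c_ic_j\,b^k\Big)dz,\;-\Big\}$$ be the quantum Lichnerowicz differential on $V$ (repeated indices summed over $1,\dots,n$). Then $d_{qL}^2=0$.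
   Context: **The $bc$–$\beta\gamma$ system.** Let $\hbar$ be a constant. The $bc$–$\beta\gamma$ system on $n$ generators has even fields $\gamma^i,\beta_i$ and odd fields $b^i,c_i$ ($1\le i\le n$), whose only non-zero operator product expansions between generators are $$b^i(z)c_j(w)\sim\frac{\hbar\,\delta_{ij}}{z-w},\quad c_j(z)b^i(w)\sim\frac{\hbar\,\delta_{ij}}{z-w},\quad \beta_j(z)\gamma^i(w)\sim\frac{-\hbar\,\delta_{ij}}{z-w},\quad \gamma^i(z)\beta_j(w)\sim\frac{\hbar\,\delta_{ij}}{z-w}.$$ It is completed, as in the chiral de Rham complex of Malikov–Schechtman–Vaintrob, so as to allow analytic functions $f(\gamma)=f(\gamma^1,\dots,\gamma^n)$ with $f$ analytic on $U$ and $\gamma^i$ playing the role of the coordinate $x_i$. Explicitly, as a vector space, $V$ is the free supercommutative algebra over the algebra $\mathcal{O}(U)$ of analytic functions on $U$ generated by even variables $\gamma^i_{-m}$ ($m\ge2$), $\beta_{i,-m}$ ($m\ge1$) and odd variables $b^i_{-m},c_{i,-m}$ ($m\ge1$), with $\gamma^i_{-1}$ identified with the coordinate function $x_i\in\mathcal{O}(U)$. The vacuum is $1$. Each generating field is $a(z)=\sum_{m\in\mathbb{Z}}a_{(m)}z^{-m-1}$, where for $m<0$ the mode $a_{(m)}$ is multiplication by $a_m$, and for $m\ge0$ $$\beta_{i,(m)}=-\hbar\frac{\partial}{\partial\gamma^i_{-m-1}},\quad \gamma^i_{(m)}=\hbar\frac{\partial}{\partial\beta_{i,-m-1}},\quad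 b^i_{(m)}=\hbar\frac{\partial}{\partial c_{i,-m-1}},\quad c_{i,(m)}=\hbar\frac{\partial}{\partial b^i_{-m-1}}$$ (left derivatives for odd variables). For $f$ analytic on $U$, the field $f(\gamma)(z)$ is defined by Taylor expansion of $f(\gamma^1(z),\dots,\gamma^n(z))$ about $(\gamma^1_{-1},\dots,\gamma^n_{-1})=(x_1,\dots,x_n)$. Thus $f(\gamma)(z)\beta_i(w)\sim\hbar\,(\partial_if)(\gamma)(w)/(z-w)$. **Normal ordering and $d_{qL}$.** Products of generating fields and functions of $\gamma$ at the same point are free-field normally ordered products: all modes $a_{(m)}$ with $m\ge 0$ are placed to the right of modes with $m<0$, with the usual signs for odd fields. The field $P^{ij}(\gamma)(c_i\beta_j-\beta_ic_j)+\partial_kP^{ij}(\gamma)c_ic_jb^k$ is understood in this sense. Here $\partial_kP^{ij}=\partial P^{ij}/\partial x_k$. For a field $q(z)=\sum_m q_{(m)}z^{-m-1}$, the symbol $\oint q\,dz$ denotes its residue $q_{(0)}$, and $\{\oint q\,dz,-\}$ denotes the operator given by supercommutator with $q_{(0)}$ on fields; equivalently, it is the operator $q_{(0)}$ acting on $V$. The field defining $d_{qL}$ is the $dz$-component of $P^{ij}(\alpha)\theta_i\theta_j$, where $\alpha^i=\gamma^i+b^i\,dz$ and $\theta_i=c_i+\beta_i\,dz$. *)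

theory Defs
  imports "HOL-Analysis.Analysis" "HOL-Library.Multiset" "HOL-Library.Function_Algebras"
begin

section \<open>Analytic functions\<close>

text \<open>
  The base field \<open>'k\<close> ranges over the complete real normed fields, i.e. the real and the complex
  numbers, so that real-analytic and holomorphic functions are treated simultaneously.
  Sums over multi-indices converge unconditionally.
\<close>

definition analytic_fun_on ::
  "('k::{real_normed_field,banach} ^ 'n) set \<Rightarrow> ('k ^ 'n \<Rightarrow> 'k) \<Rightarrow> bool"
  where "analytic_fun_on U f \<longleftrightarrow>
    (\<forall>p\<in>U. \<exists>r>0. \<exists>a :: ('n \<Rightarrow> nat) \<Rightarrow> 'k. \<forall>x. (\<forall>i. norm (x $ i - p $ i) < r) \<longrightarrow>
       ((\<lambda>\<alpha>. a \<alpha> * (\<Prod>i\<in>UNIV. (x $ i - p $ i) ^ \<alpha> i)) has_sum f x) UNIV)"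

text \<open>
  Functions on \<open>U\<close> are represented by functions on the whole space that vanish outside \<open>U\<close>;
  partial derivatives are extended by 0 accordingly.
\<close>

definition partial_deriv ::
  "('k::real_normed_field ^ 'n) set \<Rightarrow> 'n \<Rightarrow> ('k ^ 'n \<Rightarrow> 'k) \<Rightarrow> 'k ^ 'n \<Rightarrow> 'k"
  where "partial_deriv U i f x = (if x \<in> U then deriv (\<lambda>t. f (x + axis i t)) 0 else 0)"

definition analytic_functions ::
  "('k::{real_normed_field,banach} ^ 'n) set \<Rightarrow> ('k ^ 'n \<Rightarrow> 'k) set"
  where "analytic_functions U = {f. analytic_fun_on U f \<and> (\<forall>x. x \<notin> U \<longrightarrow> f x = 0)}"


section \<open>The underlying space\<close>

text \<open>
  The natural number \<open>m\<close> in \<open>GammaV i m\<close> etc. stands for the lower index \<open>-m\<close>.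
\<close>

datatype 'n even_var = GammaV 'n nat | BetaV 'n nat
datatype 'n odd_var = BV 'n nat | CV 'n nat

definition even_vars :: "'n even_var set"
  where "even_vars = {GammaV i m | i m. m \<ge> 2} \<union> {BetaV i m | i m. m \<ge> 1}"

definition odd_vars :: "'n odd_var set"
  where "odd_vars = {BV i m | i m. m \<ge> 1} \<union> {CV i m | i m. m \<ge> 1}"

text \<open>
  The free supercommutative algebra has an \<open>\<O>(U)\<close>-basis of monomials \<open>(M, S)\<close>: \<open>M\<close> is a
  finite multiset of even variables, and \<open>S\<close> a finite set of odd variables, standing for their
  product in increasing order with respect to the total order \<open>odd_before\<close>. A vector is the
  function assigning to each basis monomial its coefficient in \<open>\<O>(U)\<close>.
\<close>

fun odd_before :: "'n::linorder odd_var \<Rightarrow> 'n odd_var \<Rightarrow> bool"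
  where
    "odd_before (BV i m) (BV j l) \<longleftrightarrow> i < j \<or> i = j \<and> m < l"
  | "odd_before (CV i m) (CV j l) \<longleftrightarrow> i < j \<or> i = j \<and> m < l"
  | "odd_before (BV i m) (CV j l) \<longleftrightarrow> True"
  | "odd_before (CV i m) (BV j l) \<longleftrightarrow> False"

type_synonym 'n monomial = "'n even_var multiset \<times> 'n odd_var set"
type_synonym ('k, 'n) vec_fun = "'n monomial \<Rightarrow> 'k ^ 'n \<Rightarrow> 'k"

definition bcbg_space ::
  "('k::{real_normed_field,banach} ^ 'n) set \<Rightarrow> ('k, 'n) vec_fun set"
  where "bcbg_space U = {v.
     finite {mn. v mn \<noteq> 0} \<and>
     (\<forall>mn. v mn \<in> analytic_functions U) \<and>
     (\<forall>M S. v (M, S) \<noteq> 0 \<longrightarrow> set_mset M \<subseteq> even_vars \<and> finite S \<and> S \<subseteq> odd_vars)}"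

definition scale :: "'k::real_normed_field \<Rightarrow> ('k, 'n) vec_fun \<Rightarrow> ('k, 'n) vec_fun"
  where "scale c v = (\<lambda>mn x. c * v mn x)"

definition fun_mult ::
  "('k::real_normed_field ^ 'n \<Rightarrow> 'k) \<Rightarrow> ('k, 'n) vec_fun \<Rightarrow> ('k, 'n) vec_fun"
  where "fun_mult f v = (\<lambda>mn x. f x * v mn x)"

definition even_mult :: "'n even_var \<Rightarrow> ('k::real_normed_field, 'n) vec_fun \<Rightarrow> ('k, 'n) vec_fun"
  where "even_mult g v = (\<lambda>(M, S). if g \<in># M then v (M - {#g#}, S) else 0)"

text \<open>
  The coefficient of \<open>\<partial>v/\<partial>g\<close> at a monomial \<open>M\<close> comes from that of \<open>v\<close> at \<open>g M\<close>.
\<close>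

definition even_deriv :: "'n even_var \<Rightarrow> ('k::real_normed_field, 'n) vec_fun \<Rightarrow> ('k, 'n) vec_fun"
  where "even_deriv g v =
    (\<lambda>(M, S) x. of_nat (count M g + 1) * v (add_mset g M, S) x)"

text \<open>
  \<open>odd_sign s S\<close> is the sign of moving \<open>s\<close> from the far left to its place in the ordered
  product of \<open>S \<union> {s}\<close>.
\<close>

definition odd_sign :: "'n::linorder odd_var \<Rightarrow> 'n odd_var set \<Rightarrow> 'k::real_normed_field"
  where "odd_sign s S = (- 1) ^ card {t \<in> S. odd_before t s}"

definition odd_mult ::
  "'n::linorder odd_var \<Rightarrow> ('k::real_normed_field, 'n) vec_fun \<Rightarrow> ('k, 'n) vec_fun"
  where "odd_mult s v =
    (\<lambda>(M, S) x. if s \<in> S then odd_sign s (S - {s}) * v (M, S - {s}) x else 0)"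

definition odd_deriv ::
  "'n::linorder odd_var \<Rightarrow> ('k::real_normed_field, 'n) vec_fun \<Rightarrow> ('k, 'n) vec_fun"
  where "odd_deriv s v =
    (\<lambda>(M, S) x. if s \<notin> S then odd_sign s S * v (M, insert s S) x else 0)"

text \<open>
  The variable \<open>\<gamma>\<^sup>i\<close> with lower index \<open>-1\<close> is the coordinate function \<open>x\<^sub>i\<close>.
\<close>

definition gamma_mult :: "'n::finite \<Rightarrow> nat \<Rightarrow> ('k::real_normed_field, 'n) vec_fun \<Rightarrow> ('k, 'n) vec_fun"
  where "gamma_mult i m v = (if m = 1 then fun_mult (\<lambda>x. x $ i) v else even_mult (GammaV i m) v)"

definition gamma_deriv ::
  "('k::real_normed_field ^ 'n::finite) set \<Rightarrow> 'n \<Rightarrow> nat \<Rightarrow> ('k, 'n) vec_fun \<Rightarrow> ('k, 'n) vec_fun"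
  where "gamma_deriv U i m v =
    (if m = 1 then (\<lambda>mn. partial_deriv U i (v mn)) else even_deriv (GammaV i m) v)"


section \<open>Fields and free-field normal ordering\<close>

datatype 'n gen = Gamma 'n | Beta 'n | BF 'n | CF 'n

fun odd_gen :: "'n gen \<Rightarrow> bool"
  where
    "odd_gen (Gamma i) \<longleftrightarrow> False"
  | "odd_gen (Beta i) \<longleftrightarrow> False"
  | "odd_gen (BF i) \<longleftrightarrow> True"
  | "odd_gen (CF i) \<longleftrightarrow> True"

text \<open>
  \<open>gen_mode U hbar a m\<close> is the mode \<open>a\<close>\<open>(m)\<close>, the coefficient of \<open>z\<close> to the power \<open>-m-1\<close>
  in \<open>a(z)\<close>.
\<close>

fun gen_mode ::
  "('k::real_normed_field ^ 'n::{finite,linorder}) set \<Rightarrow> 'k \<Rightarrow> 'n gen \<Rightarrow> int \<Rightarrow>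
   ('k, 'n) vec_fun \<Rightarrow> ('k, 'n) vec_fun"
  where
    "gen_mode U hbar (Gamma i) m v =
       (if m < 0 then gamma_mult i (nat (- m)) v
        else scale hbar (even_deriv (BetaV i (nat (m + 1))) v))"
  | "gen_mode U hbar (Beta i) m v =
       (if m < 0 then even_mult (BetaV i (nat (- m))) v
        else scale (- hbar) (gamma_deriv U i (nat (m + 1)) v))"
  | "gen_mode U hbar (BF i) m v =
       (if m < 0 then odd_mult (BV i (nat (- m))) v
        else scale hbar (odd_deriv (CV i (nat (m + 1))) v))"
  | "gen_mode U hbar (CF i) m v =
       (if m < 0 then odd_mult (CV i (nat (- m))) v
        else scale hbar (odd_deriv (BV i (nat (m + 1))) v))"

text \<open>
  Normally ordered product of a word of modes: modes with \<open>m \<ge> 0\<close> are moved to the right, with a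
  sign for each transposition of odd modes.
\<close>

fun nop ::
  "('k::real_normed_field ^ 'n::{finite,linorder}) set \<Rightarrow> 'k \<Rightarrow> ('n gen \<times> int) list \<Rightarrow>
   ('k, 'n) vec_fun \<Rightarrow> ('k, 'n) vec_fun"
  where
    "nop U hbar [] v = v"
  | "nop U hbar ((a, m) # w) v =
       (if m < 0 then gen_mode U hbar a m (nop U hbar w v)
        else scale (if odd_gen a \<and> odd (length (filter (odd_gen \<circ> fst) w)) then - 1 else 1)
               (nop U hbar w (gen_mode U hbar a m v)))"

text \<open>
  Since \<open>\<gamma>\<^sup>i(z) - x\<^sub>i\<close> is the sum of all terms of \<open>\<gamma>\<^sup>i(z)\<close> with \<open>m \<noteq> -1\<close>, Taylor expansion reads
  \<open>f(\<gamma>)(z) = \<Sum>\<^sub>r 1/r! \<Sum> (\<partial>\<dots>\<partial>f)(x) (\<gamma>(z) - x) \<dots> (\<gamma>(z) - x)\<close>, the inner sum being over all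
  sequences of \<open>r\<close> coordinate indices. Hence the terms contributing to mode \<open>N\<close> of
  the normally ordered product \<open>f(\<gamma>) a\<^sub>1 \<dots> a\<^sub>s\<close> of \<open>f(\<gamma>)\<close> with generating fields are indexed by
  a list of pairs \<open>(i, m)\<close> with \<open>m \<noteq> -1\<close> (the factors \<open>\<gamma>\<^sup>i - x\<^sub>i\<close>)
  and a list of modes for \<open>a\<^sub>1, \<dots>, a\<^sub>s\<close> such that the powers of \<open>z\<close> add up to \<open>-N-1\<close>.
\<close>

definition mode_words :: "nat \<Rightarrow> int \<Rightarrow> (('n \<times> int) list \<times> int list) set"
  where "mode_words s N = {(u, ms).
     (\<forall>(i, m)\<in>set u. m \<noteq> - 1) \<and> length ms = s \<and>
     (\<Sum>m\<leftarrow>map snd u @ ms. - m - 1) = - N - 1}"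

definition field_term ::
  "('k::real_normed_field ^ 'n::{finite,linorder}) set \<Rightarrow> 'k \<Rightarrow> (('k, 'n) vec \<Rightarrow> 'k) \<Rightarrow> 'n gen list \<Rightarrow>
   ('k, 'n) vec_fun \<Rightarrow> ('n \<times> int) list \<times> int list \<Rightarrow> ('k, 'n) vec_fun"
  where "field_term U hbar f as v = (\<lambda>(u, ms).
     scale (1 / fact (length u))
       (fun_mult (foldr (partial_deriv U) (map fst u) f)
         (nop U hbar (map (\<lambda>(i, m). (Gamma i, m)) u @ zip as ms) v)))"

text \<open>
  Only finitely many terms are non-zero on a given vector of \<open>bcbg_space U\<close>: the modes with
  \<open>m \<ge> 0\<close> differentiate with respect to variables, and \<open>\<gamma>\<close>-modes with \<open>m \<ge> 0\<close> are limited in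
  number by the degree in the \<open>\<beta>\<close>-variables, so the powers of \<open>z\<close> occurring are bounded below,
  whereas each \<open>\<gamma>\<close>-mode with \<open>m \<le> -2\<close> contributes a positive power.
\<close>

definition normal_field ::
  "('k::real_normed_field ^ 'n::{finite,linorder}) set \<Rightarrow> 'k \<Rightarrow> (('k, 'n) vec \<Rightarrow> 'k) \<Rightarrow> 'n gen list \<Rightarrow>
   int \<Rightarrow> ('k, 'n) vec_fun \<Rightarrow> ('k, 'n) vec_fun"
  where "normal_field U hbar f as N v =
    (\<Sum>w\<in>{w \<in> mode_words (length as) N. field_term U hbar f as v w \<noteq> 0}. field_term U hbar f as v w)"


section \<open>The quantum Lichnerowicz differential\<close>

definition qL_field ::
  "('k::real_normed_field ^ 'n::{finite,linorder}) set \<Rightarrow> 'k \<Rightarrow> ('n \<Rightarrow> 'n \<Rightarrow> ('k, 'n) vec \<Rightarrow> 'k) \<Rightarrow>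
   int \<Rightarrow> ('k, 'n) vec_fun \<Rightarrow> ('k, 'n) vec_fun"
  where "qL_field U hbar P N v =
    (\<Sum>i\<in>UNIV. \<Sum>j\<in>UNIV.
       normal_field U hbar (P i j) [CF i, Beta j] N v - normal_field U hbar (P i j) [Beta i, CF j] N v) +
    (\<Sum>i\<in>UNIV. \<Sum>j\<in>UNIV. \<Sum>k\<in>UNIV.
       normal_field U hbar (partial_deriv U k (P i j)) [CF i, CF j, BF k] N v)"

definition residue_op :: "(int \<Rightarrow> 'v \<Rightarrow> 'v) \<Rightarrow> 'v \<Rightarrow> 'v"
  where "residue_op q = q 0"

definition d_qL ::
  "('k::real_normed_field ^ 'n::{finite,linorder}) set \<Rightarrow> 'k \<Rightarrow> ('n \<Rightarrow> 'n \<Rightarrow> ('k, 'n) vec \<Rightarrow> 'k) \<Rightarrow>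
   ('k, 'n) vec_fun \<Rightarrow> ('k, 'n) vec_fun"
  where "d_qL U hbar P = residue_op (qL_field U hbar P)"

end

theory Submission
  imports Defs
begin

text \<open>
  Call the fields \<open>-\<beta>\<^sub>i\<close> and \<open>b\<^sup>i\<close> the momenta and the fields \<open>\<gamma>\<^sup>i\<close> and \<open>c\<^sub>i\<close> the coordinates,
  and index both families by \<open>'n + 'n\<close>: \<open>Inl i\<close> is the even pair \<open>(-\<beta>\<^sub>i, \<gamma>\<^sup>i)\<close> and \<open>Inr i\<close> the
  odd pair \<open>(b\<^sup>i, c\<^sub>i)\<close>. Since \<open>P\<close> is antisymmetric, the two terms \<open>c \<beta>\<close> and \<open>-\<beta> c\<close> of the field
  agree after normal ordering and summation, and the whole field is the normally ordered product
  \<open>\<Sum>\<^sub>a D\<^sup>a(\<gamma>, c) p\<^sub>a\<close>, where \<open>D\<close> is the Hamiltonian vector field of \<open>P\<close> on the odd cotangent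
  bundle: the component along \<open>\<gamma>\<^sup>j\<close> is \<open>-2 \<Sum>\<^sub>i P\<^sup>i\<^sup>j c\<^sub>i\<close>, the component along \<open>c\<^sub>k\<close> is
  \<open>\<Sum>\<^sub>i\<^sub>j \<partial>\<^sub>kP\<^sup>i\<^sup>j c\<^sub>i c\<^sub>j\<close>. Classically \<open>D\<^sup>2 = 0\<close> is the Jacobi identity. The point is that the
  quantum corrections vanish.

  All coordinate fields supercommute with each other, so the fields \<open>D\<^sup>a\<close> and their derivatives
  \<open>J\<^sub>a\<^sub>b = \<partial>\<^sub>aD\<^sup>b\<close> may be multiplied like functions; only the supercommutator of a momentum mode
  with \<open>D\<^sup>b\<close> is not zero, and it is a mode of \<open>\<hbar> J\<^sub>a\<^sub>b\<close> (lemma \<open>mom_deriv_D\<close>). Writing the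
  residue \<open>Q\<close> as a sum over the modes of the momentum, with creation modes on the far left and
  annihilation modes on the far right (lemma \<open>Q_modes\<close>), one expands \<open>Q\<^sup>2\<close> into terms with two
  momentum modes, one momentum mode (single contractions) and none (double contractions).

  Terms with two momenta cancel in pairs by antisymmetry under exchange of the factors.

  The single contractions add up to \<open>\<Sum>\<^sub>a D\<^sup>a J\<^sub>a\<^sub>b\<close>, which is zero (lemma \<open>D_J_local\<close>): for even
  \<open>b\<close> this is the Jacobi identity, for odd \<open>b\<close> its derivative. As a consequence \<open>Q\<close>
  supercommutes with the modes of \<open>D\<^sup>b\<close> (lemma \<open>Q_D\<close>).

  The double contractions are mode by mode a supertrace \<open>\<Sum>\<^sub>a\<^sub>b (-1)\<^sup>|\<^sup>a\<^sup>| J\<^sub>a\<^sub>b J\<^sub>b\<^sub>a\<close>, and it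
  is zero for every pair of modes (lemma \<open>J_supertrace\<close>): the loops in the even and in the odd
  directions carry the same matrix up to transposition and opposite signs, and in a mixed loop
  the antisymmetric \<open>P\<^sup>i\<^sup>j\<close> meets the symmetric second derivatives \<open>\<partial>\<^sub>i\<partial>\<^sub>jP\<close>.

  All sums are infinite sums of modes with finitely many non-zero terms on each vector. A
  filtration by the conformal weight of the momentum variables in a monomial controls them:
  modes of coordinate fields never raise this weight, and their annihilation modes lower it.
\<close>

section \<open>Partial derivatives of power series\<close>

text \<open>
  A finite set of multi-indices lies in a cube, over which the sum of products is the product of
  the sums.
\<close>

lemma prod_summable_on_multi_indices:
  fixes h :: "'n::finite \<Rightarrow> nat \<Rightarrow> real"
  assumes nonneg: "\<And>l m. 0 \<le> h l m" and summ: "\<And>l. summable (h l)"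
  shows "(\<lambda>\<alpha>. \<Prod>l\<in>UNIV. h l (\<alpha> l)) summable_on (UNIV :: ('n \<Rightarrow> nat) set)"
proof (rule nonneg_bdd_above_summable_on)
  show "0 \<le> (\<Prod>l\<in>UNIV. h l (\<alpha> l))" for \<alpha>
    by (simp add: nonneg prod_nonneg)
  show "bdd_above (sum (\<lambda>\<alpha>. \<Prod>l\<in>UNIV. h l (\<alpha> l)) ` {F. F \<subseteq> UNIV \<and> finite F})"
  proof (rule bdd_aboveI2)
    fix F :: "('n \<Rightarrow> nat) set" assume "F \<in> {F. F \<subseteq> UNIV \<and> finite F}"
    then have fin: "finite F" by simp
    (* a cube of side N contains F *)
    define N where "N = Max (insert 0 ((\<lambda>(\<alpha>, l). \<alpha> l) ` (F \<times> UNIV)))"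
    have N: "\<alpha> l \<le> N" if "\<alpha> \<in> F" for \<alpha> l
      unfolding N_def using that fin by (intro Max_ge) (auto intro!: image_eqI[of _ _ "(\<alpha>, l)"])
    have "F \<subseteq> PiE UNIV (\<lambda>_. {..N})" using N by auto
    then have "(\<Sum>\<alpha>\<in>F. \<Prod>l\<in>UNIV. h l (\<alpha> l)) \<le> (\<Sum>\<alpha>\<in>PiE UNIV (\<lambda>_. {..N}). \<Prod>l\<in>UNIV. h l (\<alpha> l))"
      by (intro sum_mono2) (auto simp: nonneg prod_nonneg intro!: finite_PiE)
    also have "\<dots> = (\<Prod>l\<in>UNIV. \<Sum>m\<le>N. h l m)"
      by (subst prod_sum_PiE) auto
    also have "\<dots> \<le> (\<Prod>l\<in>UNIV. suminf (h l))"
      by (intro prod_mono conjI sum_nonneg nonneg sum_le_suminf summ) auto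
    finally show "(\<Sum>\<alpha>\<in>F. \<Prod>l\<in>UNIV. h l (\<alpha> l)) \<le> (\<Prod>l\<in>UNIV. suminf (h l))" .
  qed
qed

text \<open>
  Two partial sums close to the limit differ by at most one further term. This takes the role of
  "the terms of a convergent series tend to zero" for unconditional sums.
\<close>

lemma has_sum_imp_bounded_terms:
  fixes f :: "'a \<Rightarrow> 'b::real_normed_vector"
  assumes "(f has_sum S) A"
  shows "\<exists>B. \<forall>x\<in>A. norm (f x) \<le> B"
proof -
  have "\<forall>\<^sub>F F in finite_subsets_at_top A. dist (sum f F) S < 1"
    using assms unfolding has_sum_def by (rule tendstoD) simp
  then have "\<exists>X. finite X \<and> X \<subseteq> A \<and>
      (\<forall>Y. finite Y \<and> X \<subseteq> Y \<and> Y \<subseteq> A \<longrightarrow> dist (sum f Y) S < 1)"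
    by (simp add: eventually_finite_subsets_at_top)
  then obtain X where X: "finite X" "X \<subseteq> A"
    and near: "\<forall>Y. finite Y \<and> X \<subseteq> Y \<and> Y \<subseteq> A \<longrightarrow> dist (sum f Y) S < 1"
    by (elim exE conjE)
  have "norm (f x) \<le> 2 + (\<Sum>y\<in>X. norm (f y))" if "x \<in> A" for x
  proof (cases "x \<in> X")
    case True
    then show ?thesis using member_le_sum[of x X "\<lambda>y. norm (f y)"] X by simp
  next
    case False
    have "dist (sum f (insert x X)) S < 1" "dist (sum f X) S < 1"
      using near[rule_format, of "insert x X"] near[rule_format, of X] X that by auto
    then have "dist (sum f (insert x X)) (sum f X) < 2"
      using dist_triangle2[of "sum f (insert x X)" "sum f X" S] by linarith
    then have "norm (f x) < 2" using False X by (simp add: dist_norm)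
    then show ?thesis using sum_nonneg[of X "\<lambda>y. norm (f y)"] by simp
  qed
  then show ?thesis by blast
qed

definition poly_box :: "'k::real_normed_field ^ 'n \<Rightarrow> real \<Rightarrow> ('k ^ 'n) set"
  where "poly_box p r = {x. \<forall>i. norm (x $ i - p $ i) < r}"

definition multi_power :: "('k::real_normed_field ^ 'n::finite) \<Rightarrow> ('n \<Rightarrow> nat) \<Rightarrow> 'k"
  where "multi_power y \<alpha> = (\<Prod>i\<in>UNIV. (y $ i) ^ \<alpha> i)"

text \<open>
  The coefficient sequence of the formal derivative in direction \<open>i\<close>.
\<close>

definition deriv_coeff :: "'n \<Rightarrow> (('n \<Rightarrow> nat) \<Rightarrow> 'k::real_normed_field) \<Rightarrow> ('n \<Rightarrow> nat) \<Rightarrow> 'k"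
  where "deriv_coeff i a \<beta> = of_nat (Suc (\<beta> i)) * a (\<beta>(i := Suc (\<beta> i)))"

text \<open>
  Cauchy-type estimate on the coefficients, obtained by evaluating at the point all of whose
  coordinates are displaced by \<open>\<rho>\<close>.
\<close>

lemma power_series_coeff_bound:
  fixes a :: "('n::finite \<Rightarrow> nat) \<Rightarrow> 'k::{real_normed_field,banach}"
  assumes ser: "\<And>x. x \<in> poly_box p r \<Longrightarrow> ((\<lambda>\<alpha>. a \<alpha> * multi_power (x - p) \<alpha>) has_sum f x) UNIV"
    and \<rho>: "0 < \<rho>" "\<rho> < r"
  shows "\<exists>B. \<forall>\<alpha>. norm (a \<alpha>) * (\<Prod>l\<in>UNIV. \<rho> ^ \<alpha> l) \<le> B"
proof -
  define x :: "'k ^ 'n" where "x = p + (\<chi> i. of_real \<rho>)"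
  have "x \<in> poly_box p r" using \<rho> by (simp add: x_def poly_box_def)
  from has_sum_imp_bounded_terms[OF ser[OF this]]
  obtain B where "\<And>\<alpha>. norm (a \<alpha> * multi_power (x - p) \<alpha>) \<le> B" by auto
  moreover have "norm (a \<alpha> * multi_power (x - p) \<alpha>) = norm (a \<alpha>) * (\<Prod>l\<in>UNIV. \<rho> ^ \<alpha> l)" for \<alpha>
    using \<rho> by (simp add: x_def multi_power_def norm_mult norm_power prod_norm[symmetric])
  ultimately show ?thesis by auto
qed

lemma power_series_term_deriv:
  fixes y :: "'k::real_normed_field ^ 'n::finite"
  shows "((\<lambda>t. multi_power (y + axis i t) \<alpha>) has_field_derivative
     of_nat (\<alpha> i) * (y $ i + t) ^ (\<alpha> i - 1) * (\<Prod>l\<in>UNIV - {i}. y $ l ^ \<alpha> l)) (at t within S)"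
proof -
  have eq: "multi_power (y + axis i t) \<alpha> = (y $ i + t) ^ \<alpha> i * (\<Prod>l\<in>UNIV - {i}. y $ l ^ \<alpha> l)" for t
    unfolding multi_power_def
    by (subst prod.remove[of _ i]) (auto simp: axis_def intro!: prod.cong)
  show ?thesis unfolding eq
    by (auto intro!: derivative_eq_intros simp: mult_ac)
qed

text \<open>
  Near \<open>x\<close> all coordinates are displaced by at most \<open>\<rho>0 < \<rho>\<close>, so the bound on the coefficients
  at radius \<open>\<rho>\<close> dominates the termwise derivatives by a convergent geometric-type series in
  \<open>\<rho>0 / \<rho>\<close>. The Weierstrass test then permits differentiation term by term.
\<close>

lemma power_series_partial_deriv:
  fixes a :: "('n::finite \<Rightarrow> nat) \<Rightarrow> 'k::{real_normed_field,banach}"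
  assumes ser: "\<And>x. x \<in> poly_box p r \<Longrightarrow> ((\<lambda>\<alpha>. a \<alpha> * multi_power (x - p) \<alpha>) has_sum f x) UNIV"
    and x: "x \<in> poly_box p r"
  shows "\<exists>D. ((\<lambda>t. f (x + axis i t)) has_field_derivative D) (at 0) \<and>
    ((\<lambda>\<alpha>. deriv_coeff i a \<alpha> * multi_power (x - p) \<alpha>) has_sum D) UNIV"
proof -
  (* radii m < \<rho>0 < \<rho> < r: the point x has distance m from the centre, the points
     x + axis i t with norm t < \<rho>0 - m stay within \<rho>0, and the coefficients are bounded at \<rho> *)
  define m where "m = Max (range (\<lambda>l. norm (x $ l - p $ l)))"
  have m: "norm (x $ l - p $ l) \<le> m" for l unfolding m_def by (intro Max_ge) auto
  have "m < r" unfolding m_def using x by (subst Max_less_iff) (auto simp: poly_box_def)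
  then obtain \<rho>0 where \<rho>0: "m < \<rho>0" "\<rho>0 < r" using dense by blast
  then obtain \<rho> where \<rho>: "\<rho>0 < \<rho>" "\<rho> < r" using dense by blast
  have "0 \<le> m" using norm_ge_zero[of "x $ i - p $ i"] m[of i] by linarith
  then have pos: "0 < \<rho>0" "0 < \<rho>" using \<rho>0 \<rho> by auto
  obtain B where B: "\<And>\<alpha>. norm (a \<alpha>) * (\<Prod>l\<in>UNIV. \<rho> ^ \<alpha> l) \<le> B"
    using power_series_coeff_bound[OF ser pos(2) \<rho>(2)] by auto
  have "norm (a (\<lambda>_. 0)) \<le> B" using B[of "\<lambda>_. 0"] by simp
  then have B0: "0 \<le> B" by (rule order_trans[OF norm_ge_zero])
  define q where "q = \<rho>0 / \<rho>"
  have q: "0 \<le> q" "q < 1" using pos \<rho> by (auto simp: q_def)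
  define \<delta> where "\<delta> = \<rho>0 - m"
  have \<delta>: "0 < \<delta>" using \<rho>0 by (simp add: \<delta>_def)
  (* termwise differentiation concerns series indexed by the natural numbers,
     so the multi-indices are enumerated *)
  define e where "e = from_nat_into (UNIV :: ('n \<Rightarrow> nat) set)"
  have "infinite (UNIV :: ('n \<Rightarrow> nat) set)"
  proof
    assume "finite (UNIV :: ('n \<Rightarrow> nat) set)"
    then have "finite (range (\<lambda>m::nat. \<lambda>_::'n. m))" by (rule finite_subset[OF subset_UNIV])
    moreover have "inj (\<lambda>m::nat. \<lambda>_::'n. m)" by (auto simp: inj_def fun_eq_iff)
    ultimately show False using finite_imageD infinite_UNIV_nat by blast
  qed
  then have e: "bij_betw e UNIV UNIV"
    unfolding e_def by (intro bij_betw_from_nat_into) auto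
  define g where "g n t = a (e n) * multi_power ((x - p) + axis i t) (e n)" for n t
  define dt where "dt \<alpha> t = a \<alpha> * (of_nat (\<alpha> i) * ((x - p) $ i + t) ^ (\<alpha> i - 1)
      * (\<Prod>l\<in>UNIV - {i}. (x - p) $ l ^ \<alpha> l))" for \<alpha> t
  define M where "M \<alpha> = B / \<rho>0 * (\<Prod>l\<in>UNIV. (if l = i then real (\<alpha> l) * q ^ \<alpha> l else q ^ \<alpha> l))" for \<alpha>
  have "M summable_on UNIV"
  proof -
    have "summable (\<lambda>n. real (Suc n) * q ^ n)"
      using q geometric_deriv_sums[of q] by (auto simp: sums_iff)
    then have "summable (\<lambda>n. real n * q ^ n)"
      by (rule summable_comparison_test'[of _ 0]) (use q in \<open>auto intro!: mult_right_mono simp: abs_mult\<close>)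
    moreover have "summable (\<lambda>n. q ^ n)" using q by (simp add: summable_geometric)
    ultimately have "summable (\<lambda>n. if l = i then real n * q ^ n else q ^ n)" for l
      by (cases "l = i") auto
    then have "(\<lambda>\<alpha>::'n \<Rightarrow> nat. \<Prod>l\<in>UNIV. (\<lambda>l n. if l = i then real n * q ^ n else q ^ n) l (\<alpha> l)) summable_on UNIV"
      using q by (intro prod_summable_on_multi_indices) (auto split: if_splits)
    then show ?thesis unfolding M_def by (intro summable_on_cmult_right) simp
  qed
  have bound: "norm (dt \<alpha> t) \<le> M \<alpha>" if "t \<in> ball 0 \<delta>" for \<alpha> t
  proof (cases "\<alpha> i = 0")
    case True
    then show ?thesis using pos q B0
      by (auto simp: dt_def M_def intro!: divide_nonneg_nonneg mult_nonneg_nonneg prod_nonneg)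
  next
    case False
    have "norm ((x - p) $ i + t) \<le> norm (x $ i - p $ i) + norm t"
      using norm_triangle_ineq[of "x $ i - p $ i" t] by simp
    then have t: "norm ((x - p) $ i + t) \<le> \<rho>0" using m[of i] that by (simp add: \<delta>_def)
    have "norm (dt \<alpha> t) = norm (a \<alpha>) * real (\<alpha> i) * norm ((x - p) $ i + t) ^ (\<alpha> i - 1)
        * (\<Prod>l\<in>UNIV - {i}. norm ((x - p) $ l) ^ \<alpha> l)"
      by (simp add: dt_def norm_mult norm_power prod_norm[symmetric])
    also have "\<dots> \<le> norm (a \<alpha>) * real (\<alpha> i) * \<rho>0 ^ (\<alpha> i - 1) * (\<Prod>l\<in>UNIV - {i}. \<rho>0 ^ \<alpha> l)"
    proof (rule mult_mono)
      show "norm (a \<alpha>) * real (\<alpha> i) * norm ((x - p) $ i + t) ^ (\<alpha> i - 1)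
          \<le> norm (a \<alpha>) * real (\<alpha> i) * \<rho>0 ^ (\<alpha> i - 1)"
        using power_mono[OF t norm_ge_zero] by (rule mult_left_mono) simp
      show "(\<Prod>l\<in>UNIV - {i}. norm ((x - p) $ l) ^ \<alpha> l) \<le> (\<Prod>l\<in>UNIV - {i}. \<rho>0 ^ \<alpha> l)"
      proof (rule prod_mono)
        fix l
        have "norm ((x - p) $ l) \<le> \<rho>0" using m[of l] \<rho>0 by simp
        from power_mono[OF this norm_ge_zero]
        show "0 \<le> norm ((x - p) $ l) ^ \<alpha> l \<and> norm ((x - p) $ l) ^ \<alpha> l \<le> \<rho>0 ^ \<alpha> l"
          by simp
      qed
    qed (use pos in \<open>auto intro: prod_nonneg\<close>)
    also have "\<dots> = norm (a \<alpha>) * real (\<alpha> i) / \<rho>0 * (\<rho>0 ^ \<alpha> i * (\<Prod>l\<in>UNIV - {i}. \<rho>0 ^ \<alpha> l))"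
      using False pos by (cases "\<alpha> i") (auto simp: field_simps)
    also have "(\<rho>0 ^ \<alpha> i * (\<Prod>l\<in>UNIV - {i}. \<rho>0 ^ \<alpha> l)) = (\<Prod>l\<in>UNIV. \<rho>0 ^ \<alpha> l)"
      by (rule prod.remove[symmetric]) auto
    also have "\<dots> = (\<Prod>l\<in>UNIV. \<rho> ^ \<alpha> l) * (\<Prod>l\<in>UNIV. q ^ \<alpha> l)"
      using pos by (simp add: q_def prod.distrib[symmetric] power_divide)
    also have "norm (a \<alpha>) * real (\<alpha> i) / \<rho>0 * \<dots>
      = (norm (a \<alpha>) * (\<Prod>l\<in>UNIV. \<rho> ^ \<alpha> l)) * (real (\<alpha> i) / \<rho>0 * (\<Prod>l\<in>UNIV. q ^ \<alpha> l))"
      by simp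
    also have "\<dots> \<le> B * (real (\<alpha> i) / \<rho>0 * (\<Prod>l\<in>UNIV. q ^ \<alpha> l))"
      using pos q by (intro mult_right_mono B) (auto intro!: divide_nonneg_pos mult_nonneg_nonneg prod_nonneg)
    also have "\<dots> = M \<alpha>"
    proof -
      have "(\<Prod>l\<in>UNIV. (if l = i then real (\<alpha> l) * q ^ \<alpha> l else q ^ \<alpha> l))
        = real (\<alpha> i) * q ^ \<alpha> i * (\<Prod>l\<in>UNIV - {i}. q ^ \<alpha> l)"
        by (subst prod.remove[of _ i]) auto
      moreover have "(\<Prod>l\<in>UNIV. q ^ \<alpha> l) = q ^ \<alpha> i * (\<Prod>l\<in>UNIV - {i}. q ^ \<alpha> l)"
        by (subst prod.remove[of _ i]) auto
      ultimately show ?thesis by (simp add: M_def)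
    qed
    finally show ?thesis .
  qed
  have summM: "summable (\<lambda>n. M (e n))"
    using \<open>M summable_on UNIV\<close> summable_on_reindex_bij_betw[OF e, of M]
    by (auto intro: summable_on_imp_summable)
  have near: "x + axis i t \<in> poly_box p r" if "t \<in> ball 0 \<delta>" for t
  proof -
    have "norm ((x + axis i t) $ l - p $ l) < r" for l
    proof -
      have "norm ((x + axis i t) $ l - p $ l) \<le> norm (x $ l - p $ l) + norm t"
        using norm_triangle_ineq[of "x $ l - p $ l" t] by (auto simp: axis_def algebra_simps)
      then show ?thesis using m[of l] that \<rho>0 by (simp add: \<delta>_def)
    qed
    then show ?thesis by (simp add: poly_box_def)
  qed
  have fg: "(\<Sum>n. g n t) = f (x + axis i t)" "summable (\<lambda>n. g n t)" if "t \<in> ball 0 \<delta>" for t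
  proof -
    have "((\<lambda>\<alpha>. a \<alpha> * multi_power (x + axis i t - p) \<alpha>) has_sum f (x + axis i t)) UNIV"
      by (rule ser[OF near[OF that]])
    then have "((\<lambda>n. g n t) has_sum f (x + axis i t)) UNIV"
      unfolding g_def
      by (subst has_sum_reindex_bij_betw[OF e, of "\<lambda>\<alpha>. a \<alpha> * multi_power (x - p + axis i t) \<alpha>"])
        (simp add: algebra_simps)
    then have "(\<lambda>n. g n t) sums f (x + axis i t)" by (rule has_sum_imp_sums)
    then show "(\<Sum>n. g n t) = f (x + axis i t)" "summable (\<lambda>n. g n t)" by (auto simp: sums_iff)
  qed
  have D1: "((\<lambda>t. \<Sum>n. g n t) has_field_derivative (\<Sum>n. dt (e n) 0)) (at 0)"
  proof (rule has_field_derivative_series'(2))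
    show "convex (ball (0::'k) \<delta>)" by simp
    show "(g n has_field_derivative dt (e n) t) (at t within ball 0 \<delta>)" for n t
      unfolding g_def dt_def by (intro DERIV_cmult power_series_term_deriv)
    show "uniformly_convergent_on (ball 0 \<delta>) (\<lambda>n t. \<Sum>i<n. dt (e i) t)"
      by (rule Weierstrass_m_test'[OF bound summM])
    show "0 \<in> ball 0 \<delta>" "0 \<in> interior (ball 0 \<delta>)" "summable (\<lambda>n. g n 0)"
      using \<delta> fg(2) by auto
  qed
  have ev: "\<forall>\<^sub>F t in nhds 0. (\<Sum>n. g n t) = f (x + axis i t)"
    using \<delta> fg(1) by (intro eventually_nhds_in_open[of "ball 0 \<delta>", THEN eventually_mono]) auto
  have D: "((\<lambda>t. f (x + axis i t)) has_field_derivative (\<Sum>n. dt (e n) 0)) (at 0)"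
    using D1 by (rule DERIV_cong_ev[OF refl ev refl, THEN iffD1])
  have "(\<lambda>\<alpha>. norm (dt \<alpha> 0)) summable_on UNIV"
  proof (rule summable_on_comparison_test[OF \<open>M summable_on UNIV\<close>])
    show "norm (dt \<alpha> 0) \<le> M \<alpha>" for \<alpha> by (rule bound) (use \<delta> in simp)
  qed simp
  then have "(\<lambda>\<alpha>. dt \<alpha> 0) summable_on UNIV" by (rule abs_summable_summable)
  then obtain D' where D': "((\<lambda>\<alpha>. dt \<alpha> 0) has_sum D') UNIV" by (auto simp: summable_on_def)
  then have "((\<lambda>n. dt (e n) 0) has_sum D') UNIV"
    by (subst has_sum_reindex_bij_betw[OF e, of "\<lambda>\<alpha>. dt \<alpha> 0"])
  then have "(\<lambda>n. dt (e n) 0) sums D'" by (rule has_sum_imp_sums)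
  then have DD: "(\<Sum>n. dt (e n) 0) = D'" by (simp add: sums_iff)
  (* terms with exponent 0 in direction i have derivative 0; lowering this exponent by one
     matches the others with the terms of the formal derivative *)
  have "((\<lambda>\<alpha>. dt \<alpha> 0) has_sum D') {\<alpha>. \<alpha> i \<noteq> 0}"
    using D' by (rule has_sum_cong_neutral[THEN iffD1, rotated -1]) (auto simp: dt_def)
  then have "((\<lambda>\<alpha>. deriv_coeff i a \<alpha> * multi_power (x - p) \<alpha>) has_sum D') UNIV"
  proof (subst has_sum_reindex_bij_witness[where i = "\<lambda>\<alpha>. \<alpha>(i := \<alpha> i - 1)"
        and j = "\<lambda>\<beta>. \<beta>(i := Suc (\<beta> i))" and T = "{\<alpha>. \<alpha> i \<noteq> 0}" and h = "\<lambda>\<alpha>. dt \<alpha> 0"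
        and g = "\<lambda>\<alpha>. deriv_coeff i a \<alpha> * multi_power (x - p) \<alpha>"], goal_cases)
    case (5 \<beta>)
    show ?case unfolding dt_def deriv_coeff_def multi_power_def
      by (subst (2) prod.remove[of _ i]) (auto simp: mult_ac intro!: prod.cong)
  qed auto
  with D DD show ?thesis by blast
qed

lemma poly_box_subset_open:
  fixes U :: "('k::real_normed_field ^ 'n::finite) set"
  assumes "open U" "p \<in> U"
  shows "\<exists>r>0. poly_box p r \<subseteq> U"
proof -
  obtain e where e: "0 < e" "ball p e \<subseteq> U" using assms open_contains_ball by blast
  have "poly_box p (e / CARD('n)) \<subseteq> ball p e"
  proof
    fix x assume x: "x \<in> poly_box p (e / CARD('n))"
    have "norm (x - p) \<le> (\<Sum>i\<in>UNIV. norm (x $ i - p $ i))"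
      unfolding norm_vec_def using L2_set_le_sum[of UNIV "\<lambda>i. norm ((x - p) $ i)"] by simp
    also have "\<dots> < (\<Sum>i\<in>(UNIV::'n set). e / CARD('n))"
      using x by (intro sum_strict_mono) (auto simp: poly_box_def)
    finally show "x \<in> ball p e" by (simp add: dist_norm norm_minus_commute)
  qed
  then show ?thesis using e by (intro exI[of _ "e / CARD('n)"]) auto
qed

lemma analytic_fun_on_power_series:
  fixes U :: "('k::{real_normed_field,banach} ^ 'n::finite) set"
  assumes "open U" "analytic_fun_on U f" "p \<in> U"
  obtains r a where "0 < r" "poly_box p r \<subseteq> U"
    "\<forall>x\<in>poly_box p r. ((\<lambda>\<alpha>. a \<alpha> * multi_power (x - p) \<alpha>) has_sum f x) UNIV"
proof -
  obtain r1 where r1: "0 < r1" "poly_box p r1 \<subseteq> U"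
    using poly_box_subset_open[OF assms(1,3)] by auto
  from assms(2,3) have "\<exists>r>0. \<exists>a. \<forall>x. (\<forall>i. norm (x $ i - p $ i) < r) \<longrightarrow>
       ((\<lambda>\<alpha>. a \<alpha> * (\<Prod>i\<in>UNIV. (x $ i - p $ i) ^ \<alpha> i)) has_sum f x) UNIV"
    unfolding analytic_fun_on_def by simp
  then obtain r2 a where r2: "0 < r2"
    and a: "\<forall>x. (\<forall>i. norm (x $ i - p $ i) < r2) \<longrightarrow>
       ((\<lambda>\<alpha>. a \<alpha> * (\<Prod>i\<in>UNIV. (x $ i - p $ i) ^ \<alpha> i)) has_sum f x) UNIV" by (elim exE conjE)
  show ?thesis
  proof (rule that)
    show "0 < min r1 r2" using r1 r2 by simp
    show "poly_box p (min r1 r2) \<subseteq> U" using r1 by (auto simp: poly_box_def)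
    show "\<forall>x\<in>poly_box p (min r1 r2). ((\<lambda>\<alpha>. a \<alpha> * multi_power (x - p) \<alpha>) has_sum f x) UNIV"
      using a by (simp add: poly_box_def multi_power_def)
  qed
qed

lemma analytic_fun_on_partial_series:
  fixes U :: "('k::{real_normed_field,banach} ^ 'n::finite) set"
  assumes sub: "poly_box p r \<subseteq> U"
    and ser: "\<forall>x\<in>poly_box p r. ((\<lambda>\<alpha>. a \<alpha> * multi_power (x - p) \<alpha>) has_sum f x) UNIV"
    and x: "x \<in> poly_box p r"
  shows "((\<lambda>t. f (x + axis i t)) has_field_derivative partial_deriv U i f x) (at 0)"
    and "((\<lambda>\<alpha>. deriv_coeff i a \<alpha> * multi_power (x - p) \<alpha>) has_sum partial_deriv U i f x) UNIV"
proof -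
  obtain D where D: "((\<lambda>t. f (x + axis i t)) has_field_derivative D) (at 0)"
    "((\<lambda>\<alpha>. deriv_coeff i a \<alpha> * multi_power (x - p) \<alpha>) has_sum D) UNIV"
    using power_series_partial_deriv[of p r a f x i] ser x by auto
  have "partial_deriv U i f x = D"
    using D(1) sub x by (auto simp: partial_deriv_def intro: DERIV_imp_deriv)
  with D show "((\<lambda>t. f (x + axis i t)) has_field_derivative partial_deriv U i f x) (at 0)"
    "((\<lambda>\<alpha>. deriv_coeff i a \<alpha> * multi_power (x - p) \<alpha>) has_sum partial_deriv U i f x) UNIV" by simp_all
qed

lemma mem_poly_box_self [simp]: "0 < r \<Longrightarrow> p \<in> poly_box p r"
  by (simp add: poly_box_def)

lemma analytic_has_partial_deriv:
  fixes U :: "('k::{real_normed_field,banach} ^ 'n::finite) set"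
  assumes "open U" "analytic_fun_on U f" "x \<in> U"
  shows "((\<lambda>t. f (x + axis i t)) has_field_derivative partial_deriv U i f x) (at 0)"
proof -
  obtain r a where "0 < r" "poly_box x r \<subseteq> U"
    "\<forall>y\<in>poly_box x r. ((\<lambda>\<alpha>. a \<alpha> * multi_power (y - x) \<alpha>) has_sum f y) UNIV"
    using analytic_fun_on_power_series[OF assms] .
  then show ?thesis by (intro analytic_fun_on_partial_series(1)) auto
qed

lemma analytic_fun_on_partial_deriv:
  fixes U :: "('k::{real_normed_field,banach} ^ 'n::finite) set"
  assumes "open U" "analytic_fun_on U f"
  shows "analytic_fun_on U (partial_deriv U i f)"
  unfolding analytic_fun_on_def
proof
  fix p assume p: "p \<in> U"
  obtain r a where r: "0 < r" "poly_box p r \<subseteq> U"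
    and a: "\<forall>x\<in>poly_box p r. ((\<lambda>\<alpha>. a \<alpha> * multi_power (x - p) \<alpha>) has_sum f x) UNIV"
    using analytic_fun_on_power_series[OF assms p] .
  show "\<exists>r>0. \<exists>a. \<forall>x. (\<forall>i. norm (x $ i - p $ i) < r) \<longrightarrow>
       ((\<lambda>\<alpha>. a \<alpha> * (\<Prod>i\<in>UNIV. (x $ i - p $ i) ^ \<alpha> i)) has_sum partial_deriv U i f x) UNIV"
    using analytic_fun_on_partial_series(2)[OF r(2) a, of _ i] r(1)
    by (intro exI[of _ r] exI[of _ "deriv_coeff i a"] conjI)
      (auto simp: poly_box_def multi_power_def)
qed

lemma deriv_coeff_commute: "deriv_coeff i (deriv_coeff j a) = deriv_coeff j (deriv_coeff i a)"
proof (cases "i = j")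
  case False
  then show ?thesis by (auto simp: deriv_coeff_def fun_eq_iff fun_upd_twist)
qed simp

text \<open>
  At the centre of the expansion both iterated derivatives are sums of the same formal series.
\<close>

lemma analytic_partial_deriv_commute:
  fixes U :: "('k::{real_normed_field,banach} ^ 'n::finite) set"
  assumes "open U" "analytic_fun_on U f"
  shows "partial_deriv U i (partial_deriv U j f) = partial_deriv U j (partial_deriv U i f)"
proof
  fix x
  show "partial_deriv U i (partial_deriv U j f) x = partial_deriv U j (partial_deriv U i f) x"
  proof (cases "x \<in> U")
    case True
    obtain r a where r: "0 < r" "poly_box x r \<subseteq> U"
      and a: "\<forall>y\<in>poly_box x r. ((\<lambda>\<alpha>. a \<alpha> * multi_power (y - x) \<alpha>) has_sum f y) UNIV"
      using analytic_fun_on_power_series[OF assms True] .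
    have second: "((\<lambda>\<alpha>. deriv_coeff k (deriv_coeff l a) \<alpha> * multi_power (x - x) \<alpha>)
        has_sum partial_deriv U k (partial_deriv U l f) x) UNIV" for k l
      using analytic_fun_on_partial_series(2)[OF r(2) a] r
      by (intro analytic_fun_on_partial_series(2)[of x r]) auto
    show ?thesis
      using has_sum_unique[OF second[of i j]] second[of j i]
      by (simp add: deriv_coeff_commute[of i j])
  qed (simp add: partial_deriv_def)
qed

section \<open>The ring of coefficient functions\<close>

text \<open>
  The only properties of coefficient functions that matter below are that they form an algebra
  and that partial derivatives exist, satisfy the product rule, commute and stay in the algebra.
  For the algebra generated by the analytic functions all of this follows by induction from the
  case of one power series; products of power series never have to be expanded.
\<close>

inductive_set smooth_ring :: "('k::{real_normed_field,banach} ^ 'n::finite) set \<Rightarrow> ('k ^ 'n \<Rightarrow> 'k) set"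
  for U where
    analytic: "f \<in> analytic_functions U \<Longrightarrow> f \<in> smooth_ring U"
  | add: "f \<in> smooth_ring U \<Longrightarrow> g \<in> smooth_ring U \<Longrightarrow> (\<lambda>x. f x + g x) \<in> smooth_ring U"
  | mult: "f \<in> smooth_ring U \<Longrightarrow> g \<in> smooth_ring U \<Longrightarrow> (\<lambda>x. f x * g x) \<in> smooth_ring U"
  | scale: "f \<in> smooth_ring U \<Longrightarrow> (\<lambda>x. c * f x) \<in> smooth_ring U"

lemma smooth_ring_outside: "f \<in> smooth_ring U \<Longrightarrow> x \<notin> U \<Longrightarrow> f x = 0"
  by (induction rule: smooth_ring.induct) (auto simp: analytic_functions_def)

lemma smooth_ring_zero: "(\<lambda>x. 0) \<in> smooth_ring U"
proof -
  have "analytic_fun_on U (\<lambda>x. 0)"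
    unfolding analytic_fun_on_def
  proof
    fix p :: "'a ^ 'b" assume "p \<in> U"
    have "\<forall>x. (\<forall>i. norm (x $ i - p $ i) < 1) \<longrightarrow>
       ((\<lambda>\<alpha>. (\<lambda>_. 0) \<alpha> * (\<Prod>i\<in>UNIV. (x $ i - p $ i) ^ \<alpha> i)) has_sum (0::'a)) UNIV" by simp
    then show "\<exists>r>0. \<exists>a. \<forall>x. (\<forall>i. norm (x $ i - p $ i) < r) \<longrightarrow>
       ((\<lambda>\<alpha>. a \<alpha> * (\<Prod>i\<in>UNIV. (x $ i - p $ i) ^ \<alpha> i)) has_sum (0::'a)) UNIV"
      by (intro exI[of _ "1::real"] conjI exI[of _ "\<lambda>_. 0"]) simp_all
  qed
  then show ?thesis by (intro smooth_ring.analytic) (simp add: analytic_functions_def)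
qed

lemma partial_deriv_eqI:
  assumes "x \<in> U" "((\<lambda>t. f (x + axis i t)) has_field_derivative D) (at 0)"
  shows "partial_deriv U i f x = D"
  using assms by (simp add: partial_deriv_def DERIV_imp_deriv)

lemma partial_deriv_outside: "x \<notin> U \<Longrightarrow> partial_deriv U i f x = 0"
  by (simp add: partial_deriv_def)

context
  fixes U :: "('k::{real_normed_field,banach} ^ 'n::finite) set"
  assumes U: "open U"
begin

lemma smooth_has_partial_deriv:
  assumes "f \<in> smooth_ring U" "x \<in> U"
  shows "((\<lambda>t. f (x + axis i t)) has_field_derivative partial_deriv U i f x) (at 0)"
  using assms
proof (induction arbitrary: rule: smooth_ring.induct)
  case (analytic f)
  then show ?case using analytic_has_partial_deriv[OF U] by (auto simp: analytic_functions_def)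
next
  case (add f g)
  have "((\<lambda>t. f (x + axis i t) + g (x + axis i t)) has_field_derivative
      partial_deriv U i f x + partial_deriv U i g x) (at 0)"
    using add by (intro DERIV_add) auto
  with add.prems show ?case using partial_deriv_eqI by fastforce
next
  case (mult f g)
  have "((\<lambda>t. f (x + axis i t) * g (x + axis i t)) has_field_derivative
      partial_deriv U i f x * g (x + axis i 0) + partial_deriv U i g x * f (x + axis i 0)) (at 0)"
    using mult by (intro DERIV_mult) auto
  with mult.prems show ?case using partial_deriv_eqI by fastforce
next
  case (scale f c)
  have "((\<lambda>t. c * f (x + axis i t)) has_field_derivative c * partial_deriv U i f x) (at 0)"
    using scale by (intro DERIV_cmult) auto
  with scale.prems show ?case using partial_deriv_eqI by fastforce
qed

lemma partial_deriv_add: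
  assumes "f \<in> smooth_ring U" "g \<in> smooth_ring U"
  shows "partial_deriv U i (\<lambda>x. f x + g x) = (\<lambda>x. partial_deriv U i f x + partial_deriv U i g x)"
proof
  fix x show "partial_deriv U i (\<lambda>x. f x + g x) x = partial_deriv U i f x + partial_deriv U i g x"
  proof (cases "x \<in> U")
    case True
    then show ?thesis using assms
      by (intro partial_deriv_eqI DERIV_add smooth_has_partial_deriv)
  qed (simp add: partial_deriv_def)
qed

lemma partial_deriv_mult:
  assumes "f \<in> smooth_ring U" "g \<in> smooth_ring U"
  shows "partial_deriv U i (\<lambda>x. f x * g x) = (\<lambda>x. partial_deriv U i f x * g x + f x * partial_deriv U i g x)"
proof
  fix x show "partial_deriv U i (\<lambda>x. f x * g x) x = partial_deriv U i f x * g x + f x * partial_deriv U i g x"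
  proof (cases "x \<in> U")
    case True
    have "((\<lambda>t. f (x + axis i t) * g (x + axis i t)) has_field_derivative
      partial_deriv U i f x * g (x + axis i 0) + partial_deriv U i g x * f (x + axis i 0)) (at 0)"
      using assms True by (intro DERIV_mult smooth_has_partial_deriv) 
    moreover have "axis i 0 = (0 :: 'k ^ 'n)" by (simp add: axis_def vec_eq_iff)
    ultimately show ?thesis using True
      by (intro partial_deriv_eqI) (simp_all add: mult_ac)
  qed (simp add: partial_deriv_def)
qed

lemma partial_deriv_cmult:
  assumes "f \<in> smooth_ring U"
  shows "partial_deriv U i (\<lambda>x. c * f x) = (\<lambda>x. c * partial_deriv U i f x)"
proof
  fix x show "partial_deriv U i (\<lambda>x. c * f x) x = c * partial_deriv U i f x"
  proof (cases "x \<in> U")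
    case True
    then show ?thesis using assms
      by (intro partial_deriv_eqI DERIV_cmult smooth_has_partial_deriv)
  qed (simp add: partial_deriv_def)
qed

lemma smooth_partial_deriv:
  assumes "f \<in> smooth_ring U"
  shows "partial_deriv U i f \<in> smooth_ring U"
  using assms
proof (induction rule: smooth_ring.induct)
  case (analytic f)
  then show ?case using analytic_fun_on_partial_deriv[OF U]
    by (intro smooth_ring.analytic) (auto simp: analytic_functions_def partial_deriv_outside)
qed (simp_all add: partial_deriv_add partial_deriv_mult partial_deriv_cmult smooth_ring.intros)

lemma partial_deriv_commute:
  assumes "f \<in> smooth_ring U"
  shows "partial_deriv U i (partial_deriv U j f) = partial_deriv U j (partial_deriv U i f)"
  using assms
proof (induction rule: smooth_ring.induct)
  case (analytic f)
  then show ?case using analytic_partial_deriv_commute[OF U]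
    by (auto simp: analytic_functions_def)
qed (simp_all add: partial_deriv_add partial_deriv_mult partial_deriv_cmult smooth_partial_deriv
    smooth_ring.intros algebra_simps)

end

lemma norm_axis_le: "norm (axis i t :: 'k::real_normed_field ^ 'n::finite) \<le> norm t"
proof -
  have "norm (axis i t :: 'k ^ 'n) \<le> (\<Sum>l\<in>UNIV. norm ((axis i t :: 'k ^ 'n) $ l))"
    unfolding norm_vec_def by (rule L2_set_le_sum) simp
  also have "\<dots> = norm t" by (simp add: axis_def if_distrib cong: if_cong)
  finally show ?thesis .
qed

text \<open>
  A partial derivative depends only on the values near the point, hence only on those in \<open>U\<close>.
\<close>

lemma partial_deriv_cong_open:
  fixes U :: "('k::{real_normed_field,banach} ^ 'n::finite) set"
  assumes U: "open U" and eq: "\<And>x. x \<in> U \<Longrightarrow> f x = g x"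
  shows "partial_deriv U i f = partial_deriv U i g"
proof
  fix x show "partial_deriv U i f x = partial_deriv U i g x"
  proof (cases "x \<in> U")
    case True
    have "\<forall>\<^sub>F t in nhds 0. x + axis i t \<in> U"
    proof -
      obtain e where e: "0 < e" "ball x e \<subseteq> U" using U True open_contains_ball by blast
      have "x + axis i t \<in> U" if "t \<in> ball 0 e" for t
        using that e norm_axis_le[of i t]
        by (intro subsetD[OF e(2)]) (auto simp: dist_norm intro: le_less_trans)
      then show ?thesis using e(1)
        by (intro eventually_nhds_in_open[of "ball 0 e", THEN eventually_mono]) auto
    qed
    then have "\<forall>\<^sub>F t in nhds 0. f (x + axis i t) = g (x + axis i t)"
      by (rule eventually_mono) (rule eq)
    then show ?thesis using True by (simp add: partial_deriv_def deriv_cong_ev)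
  qed (simp add: partial_deriv_def)
qed

section \<open>Multiplication and differentiation operators\<close>

interpretation vec_fun: vector_space "scale :: 'k::real_normed_field \<Rightarrow> ('k, 'n) vec_fun \<Rightarrow> ('k, 'n) vec_fun"
  by unfold_locales (auto simp: scale_def fun_eq_iff algebra_simps)

lemma scale_apply [simp]: "scale c v mn x = c * v mn x"
  by (simp add: scale_def)

lemma odd_before_total: "s \<noteq> t \<Longrightarrow> odd_before s t \<longleftrightarrow> \<not> odd_before t s"
  by (cases s; cases t) auto

lemma odd_sign_insert:
  assumes "finite S" "t \<notin> S"
  shows "odd_sign s (insert t S) = (if odd_before t s then - odd_sign s S else odd_sign s S)"
proof -
  have "{u \<in> insert t S. odd_before u s} =
      (if odd_before t s then insert t {u \<in> S. odd_before u s} else {u \<in> S. odd_before u s})" by auto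
  then show ?thesis using assms by (simp add: odd_sign_def)
qed

lemma odd_sign_square [simp]: "odd_sign s S * (odd_sign s S * x) = x" "odd_sign s S * odd_sign s S = 1"
  by (simp_all add: odd_sign_def flip: power_add mult.assoc)

text \<open>
  Inserting a smaller element into \<open>S\<close> changes \<open>odd_sign s S\<close> only if \<open>S\<close> is finite, because the
  cardinality of an infinite set is 0; the anticommutation rules therefore need this condition.
\<close>

definition odd_finite :: "('k::zero, 'n) vec_fun \<Rightarrow> bool"
  where "odd_finite v \<longleftrightarrow> (\<forall>M S. infinite S \<longrightarrow> v (M, S) = 0)"

lemma odd_mult_anticommute:
  assumes v: "odd_finite v"
  shows "odd_mult s (odd_mult t v) = scale (- 1) (odd_mult t (odd_mult s v))"
proof (rule ext, clarify, rule ext)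
  fix M S x
  show "odd_mult s (odd_mult t v) (M, S) x = scale (- 1) (odd_mult t (odd_mult s v)) (M, S) x"
  proof (cases "s \<in> S \<and> t \<in> S \<and> s \<noteq> t \<and> finite S")
    case True
    define R where "R = S - {s, t}"
    have R: "S - {s} = insert t R" "S - {t} = insert s R" "s \<notin> R" "t \<notin> R" "finite R"
      using True by (auto simp: R_def)
    have "S - {s} - {t} = R" "S - {t} - {s} = R" by (auto simp: R_def)
    moreover have "R - {t} = R" "R - {s} = R" using R by auto
    ultimately show ?thesis using True R odd_before_total[of s t]
      by (auto simp: odd_mult_def odd_sign_insert)
  next
    case False
    moreover have "v (M, S - {s} - {t}) = 0" "v (M, S - {t} - {s}) = 0" if "infinite S"
      using v that by (auto simp: odd_finite_def)
    ultimately show ?thesis by (auto simp: odd_mult_def)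
  qed
qed

lemma odd_deriv_anticommute:
  assumes v: "odd_finite v"
  shows "odd_deriv s (odd_deriv t v) = scale (- 1) (odd_deriv t (odd_deriv s v))"
proof (rule ext, clarify, rule ext)
  fix M S x
  show "odd_deriv s (odd_deriv t v) (M, S) x = scale (- 1) (odd_deriv t (odd_deriv s v)) (M, S) x"
  proof (cases "s \<notin> S \<and> t \<notin> S \<and> s \<noteq> t \<and> finite S")
    case True
    then show ?thesis using odd_before_total[of s t]
      by (auto simp: odd_deriv_def odd_sign_insert insert_commute)
  next
    case False
    moreover have "v (M, insert t (insert s S)) = 0" "v (M, insert s (insert t S)) = 0" if "infinite S"
      using v that by (auto simp: odd_finite_def)
    ultimately show ?thesis by (auto simp: odd_deriv_def)
  qed
qed

text \<open>
  The Clifford relation for one pair of odd variables.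
\<close>

lemma odd_deriv_mult_anticommute:
  assumes v: "odd_finite v"
  shows "odd_deriv s (odd_mult t v) = scale (- 1) (odd_mult t (odd_deriv s v)) + (if s = t then v else 0)"
proof (rule ext, clarify, rule ext)
  fix M S x
  have inf: "v (M, T) = 0" if "infinite T" for T using v that by (auto simp: odd_finite_def)
  show "odd_deriv s (odd_mult t v) (M, S) x =
    (scale (- 1) (odd_mult t (odd_deriv s v)) + (if s = t then v else 0)) (M, S) x"
  proof (cases "s = t")
    case True
    then show ?thesis
      by (auto simp: odd_deriv_def odd_mult_def insert_absorb)
  next
    case False
    show ?thesis
    proof (cases "s \<notin> S \<and> t \<in> S \<and> finite S")
      case True
      define R where "R = S - {t}"
      have R: "S = insert t R" "s \<notin> R" "t \<notin> R" "finite R" using True by (auto simp: R_def)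
      have "insert s (insert t R) - {t} = insert s R" using R False by auto
      then show ?thesis using R False odd_before_total[of s t]
        by (auto simp: odd_deriv_def odd_mult_def odd_sign_insert)
    next
      case F: False
      have "insert s S - {t} = insert s (S - {t})" using False by auto
      then show ?thesis using F False inf by (auto simp: odd_deriv_def odd_mult_def)
    qed
  qed
qed

lemma even_mult_commute: "even_mult g (even_mult h v) = even_mult h (even_mult g v)"
proof (cases "g = h")
  case False
  then have "h \<in># M - {#g#} \<longleftrightarrow> h \<in># M" "g \<in># M - {#h#} \<longleftrightarrow> g \<in># M" for M
    by (simp_all flip: count_greater_zero_iff)
  then show ?thesis by (auto simp: even_mult_def fun_eq_iff add_mset_commute)
qed simp

lemma even_deriv_commute: "even_deriv g (even_deriv h v) = even_deriv h (even_deriv g v)"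
  by (cases "g = h") (auto simp: even_deriv_def fun_eq_iff add_mset_commute)

lemma even_deriv_mult: "even_deriv g (even_mult h v) = even_mult h (even_deriv g v) + (if g = h then v else 0)"
proof (rule ext, clarify, rule ext)
  fix M S x
  show "even_deriv g (even_mult h v) (M, S) x = (even_mult h (even_deriv g v) + (if g = h then v else 0)) (M, S) x"
  proof (cases "g = h")
    case True
    show ?thesis
    proof (cases "h \<in># M")
      case mem: True
      then have "count M h = Suc (count (M - {#h#}) h)" by (metis count_add_mset insert_DiffM)
      then show ?thesis using True mem by (simp add: even_deriv_def even_mult_def algebra_simps)
    next
      case False
      moreover from False have "count M h = 0" by (simp add: not_in_iff)
      ultimately show ?thesis using True by (simp add: even_deriv_def even_mult_def)
    qed
  next
    case False
    then have "add_mset g M - {#h#} = add_mset g (M - {#h#})" if "h \<in># M"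
      using that by (metis diff_union_swap)
    then show ?thesis using False by (auto simp: even_deriv_def even_mult_def)
  qed
qed

lemma even_odd_commute:
  "even_mult g (odd_mult s v) = odd_mult s (even_mult g v)"
  "even_mult g (odd_deriv s v) = odd_deriv s (even_mult g v)"
  "even_deriv g (odd_mult s v) = odd_mult s (even_deriv g v)"
  "even_deriv g (odd_deriv s v) = odd_deriv s (even_deriv g v)"
  by (auto simp: even_mult_def even_deriv_def odd_mult_def odd_deriv_def fun_eq_iff)

lemma fun_mult_commute:
  "fun_mult f (even_mult g v) = even_mult g (fun_mult f v)"
  "fun_mult f (even_deriv g v) = even_deriv g (fun_mult f v)"
  "fun_mult f (odd_mult s v) = odd_mult s (fun_mult f v)"
  "fun_mult f (odd_deriv s v) = odd_deriv s (fun_mult f v)"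
  "fun_mult f (scale c v) = scale c (fun_mult f v)"
  by (auto simp: even_mult_def even_deriv_def odd_mult_def odd_deriv_def fun_mult_def fun_eq_iff)

lemma scale_commute:
  "even_mult g (scale c v) = scale c (even_mult g v)"
  "even_deriv g (scale c v) = scale c (even_deriv g v)"
  "odd_mult s (scale c v) = scale c (odd_mult s v)"
  "odd_deriv s (scale c v) = scale c (odd_deriv s v)"
  by (auto simp: even_mult_def even_deriv_def odd_mult_def odd_deriv_def fun_eq_iff)

lemma elementary_add:
  "even_mult g (v + w) = even_mult g v + even_mult g w"
  "even_deriv g (v + w) = even_deriv g v + even_deriv g w"
  "odd_mult s (v + w) = odd_mult s v + odd_mult s w"
  "odd_deriv s (v + w) = odd_deriv s v + odd_deriv s w"
  "fun_mult f (v + w) = fun_mult f v + fun_mult f w"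
  by (auto simp: even_mult_def even_deriv_def odd_mult_def odd_deriv_def fun_mult_def fun_eq_iff algebra_simps)

section \<open>The filtration by momentum weight\<close>

definition partial_op :: "('k::real_normed_field ^ 'n::finite) set \<Rightarrow> 'n \<Rightarrow> ('k, 'n) vec_fun \<Rightarrow> ('k, 'n) vec_fun"
  where "partial_op U i v = (\<lambda>mn. partial_deriv U i (v mn))"

fun even_weight :: "'n even_var \<Rightarrow> nat"
  where "even_weight (GammaV i m) = 0" | "even_weight (BetaV i m) = m"

fun odd_weight :: "'n odd_var \<Rightarrow> nat"
  where "odd_weight (BV i m) = m" | "odd_weight (CV i m) = 0"

text \<open>
  Conformal weight carried by the momentum variables \<open>\<beta>\<close> and \<open>b\<close> alone.
\<close>

definition momentum_weight :: "'n monomial \<Rightarrow> nat"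
  where "momentum_weight = (\<lambda>(M, S). sum_mset (image_mset even_weight M) + sum odd_weight S)"

text \<open>
  This space contains \<open>bcbg_space U\<close>, with coefficients enlarged from analytic functions to
  \<open>smooth_ring U\<close>, so that it is visibly stable under all operators below.
\<close>

definition fock :: "('k::{real_normed_field,banach} ^ 'n::finite) set \<Rightarrow> ('k, 'n) vec_fun set"
  where "fock U = {v. finite {mn. v mn \<noteq> 0} \<and> (\<forall>mn. v mn \<in> smooth_ring U) \<and> odd_finite v}"

text \<open>
  The filtration degree is twice the momentum weight. Doubling leaves room between the two
  natural estimates for a mode of a coordinate field, see the definition of \<open>field\<close>. Negative
  degrees are allowed and give the zero space, which turns degree bounds into vanishing
  statements.
\<close>

definition fock_le :: "('k::{real_normed_field,banach} ^ 'n::finite) set \<Rightarrow> int \<Rightarrow> ('k, 'n) vec_fun set"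
  where "fock_le U j = {v \<in> fock U. \<forall>mn. v mn \<noteq> 0 \<longrightarrow> 2 * int (momentum_weight mn) \<le> j}"

lemma fock_coeff: "v \<in> fock U \<Longrightarrow> v mn \<in> smooth_ring U"
  by (cases mn) (auto simp: fock_def)

lemma fock_le_fock: "v \<in> fock_le U j \<Longrightarrow> v \<in> fock U"
  by (simp add: fock_le_def)

lemma fock_le_mono: "v \<in> fock_le U j \<Longrightarrow> j \<le> k \<Longrightarrow> v \<in> fock_le U k"
  by (force simp: fock_le_def)

lemma fock_le_negative: "v \<in> fock_le U j \<Longrightarrow> j < 0 \<Longrightarrow> v = 0"
  by (force simp: fock_le_def fun_eq_iff)

lemma fock_exhausted:
  assumes "v \<in> fock U" obtains j where "v \<in> fock_le U j" "0 \<le> j"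
proof
  let ?j = "Max (insert 0 ((\<lambda>mn. 2 * int (momentum_weight mn)) ` {mn. v mn \<noteq> 0}))"
  have "finite {mn. v mn \<noteq> 0}" using assms by (simp add: fock_def)
  then show "v \<in> fock_le U ?j" "0 \<le> ?j"
    using assms by (auto simp: fock_le_def intro!: Max_ge)
qed

lemma fock_zero: "0 \<in> fock U"
  using smooth_ring_zero[of U] by (simp add: fock_def odd_finite_def zero_fun_def)

lemma fock_le_zero [simp]: "0 \<in> fock_le U j"
  by (simp add: fock_le_def fock_zero)

lemma fock_add:
  assumes "v \<in> fock U" "w \<in> fock U" shows "v + w \<in> fock U"
proof -
  have "{mn. (v + w) mn \<noteq> 0} \<subseteq> {mn. v mn \<noteq> 0} \<union> {mn. w mn \<noteq> 0}" by auto
  moreover have "(v + w) mn \<in> smooth_ring U" for mn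
    using smooth_ring.add[OF fock_coeff[OF assms(1)] fock_coeff[OF assms(2)]] by (simp add: plus_fun_def)
  ultimately show ?thesis using assms
    by (auto simp: fock_def odd_finite_def dest: finite_subset)
qed

lemma fock_scale:
  assumes "v \<in> fock U" shows "scale c v \<in> fock U"
proof -
  have "{mn. scale c v mn \<noteq> 0} \<subseteq> {mn. v mn \<noteq> 0}" by (auto simp: fun_eq_iff)
  moreover have "scale c v mn \<in> smooth_ring U" for mn
    unfolding scale_def by (intro smooth_ring.scale fock_coeff[OF assms])
  ultimately show ?thesis using assms
    by (auto simp: fock_def odd_finite_def fun_eq_iff dest: finite_subset)
qed

lemma fock_le_add: "v \<in> fock_le U j \<Longrightarrow> w \<in> fock_le U j \<Longrightarrow> v + w \<in> fock_le U j"
  by (auto simp: fock_le_def fock_add) (metis add.right_neutral)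

lemma fock_le_scale: "v \<in> fock_le U j \<Longrightarrow> scale c v \<in> fock_le U j"
proof -
  assume v: "v \<in> fock_le U j"
  have "v mn \<noteq> 0" if "scale c v mn \<noteq> 0" for mn using that by (auto simp: fun_eq_iff)
  with v show ?thesis by (simp add: fock_le_def fock_scale del: split_paired_All)
qed

lemma fock_le_sum: "(\<And>x. x \<in> A \<Longrightarrow> g x \<in> fock_le U j) \<Longrightarrow> sum g A \<in> fock_le U j"
  by (induction A rule: infinite_finite_induct) (auto intro: fock_le_add)

lemma fock_sum: "(\<And>x. x \<in> A \<Longrightarrow> g x \<in> fock U) \<Longrightarrow> sum g A \<in> fock U"
  by (induction A rule: infinite_finite_induct) (auto intro: fock_add fock_zero)

text \<open>
  Common pattern for the elementary operators: every monomial of the image \<open>w\<close> arises from a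
  monomial of \<open>v\<close> by a map \<open>f\<close> on monomials that changes the weight in a controlled way.
\<close>

lemma fock_leI:
  assumes v: "v \<in> fock_le U j"
    and ex: "\<And>M S. w (M, S) \<noteq> 0 \<Longrightarrow> \<exists>M' S'. v (M', S') \<noteq> 0 \<and> (M, S) = f (M', S') \<and>
      (finite S' \<longrightarrow> finite S) \<and>
      (2 * int (momentum_weight (M', S')) \<le> j \<longrightarrow> finite S' \<longrightarrow> 2 * int (momentum_weight (M, S)) \<le> k)"
    and sm: "\<And>mn. w mn \<in> smooth_ring U"
  shows "w \<in> fock_le U k"
proof -
  have "{mn. w mn \<noteq> 0} \<subseteq> f ` {mn. v mn \<noteq> 0}"
  proof
    fix mn assume "mn \<in> {mn. w mn \<noteq> 0}"
    then show "mn \<in> f ` {mn. v mn \<noteq> 0}" using ex[of "fst mn" "snd mn"] by fastforce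
  qed
  moreover have vf: "finite {mn. v mn \<noteq> 0}" "odd_finite v" using v by (auto simp: fock_le_def fock_def)
  ultimately have "finite {mn. w mn \<noteq> 0}" using finite_surj by blast
  moreover have fin: "finite S" if "w (M, S) \<noteq> 0" for M S
    using ex[OF that] vf(2) by (auto simp: odd_finite_def)
  moreover have "2 * int (momentum_weight (M, S)) \<le> k" if "w (M, S) \<noteq> 0" for M S
  proof -
    obtain M' S' where *: "v (M', S') \<noteq> 0" 
      "2 * int (momentum_weight (M', S')) \<le> j \<longrightarrow> finite S' \<longrightarrow> 2 * int (momentum_weight (M, S)) \<le> k"
      using ex[OF \<open>w (M, S) \<noteq> 0\<close>] by blast
    have "finite S'" using * vf(2) by (auto simp: odd_finite_def)
    moreover have "2 * int (momentum_weight (M', S')) \<le> j" using * v by (auto simp: fock_le_def)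
    ultimately show ?thesis using * by blast
  qed
  ultimately show ?thesis using sm by (auto simp: fock_le_def fock_def odd_finite_def)
qed

lemma fock_le_coeff: "v \<in> fock_le U j \<Longrightarrow> v mn \<in> smooth_ring U"
  by (simp add: fock_coeff fock_le_fock)

lemma smooth_ring_0 [simp]: "0 \<in> smooth_ring U"
  using smooth_ring_zero[of U] by (simp add: zero_fun_def)

lemma even_mult_fock_le:
  assumes "v \<in> fock_le U j" shows "even_mult g v \<in> fock_le U (j + 2 * int (even_weight g))"
proof (rule fock_leI[OF assms, where f = "\<lambda>(M, S). (add_mset g M, S)"])
  fix M S assume "even_mult g v (M, S) \<noteq> 0"
  then have *: "g \<in># M" "v (M - {#g#}, S) \<noteq> 0" by (auto simp: even_mult_def split: if_splits)
  define M' where "M' = M - {#g#}"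
  have "M = add_mset g M'" using * by (simp add: M'_def)
  then show "\<exists>M' S'. v (M', S') \<noteq> 0 \<and> (M, S) = (case (M', S') of (M, S) \<Rightarrow> (add_mset g M, S)) \<and>
      (finite S' \<longrightarrow> finite S) \<and> (2 * int (momentum_weight (M', S')) \<le> j \<longrightarrow> finite S' \<longrightarrow>
       2 * int (momentum_weight (M, S)) \<le> j + 2 * int (even_weight g))"
    using * by (intro exI[of _ M'] exI[of _ S]) (auto simp: momentum_weight_def)
qed (auto simp: even_mult_def fock_le_coeff[OF assms] split: prod.splits)

lemma even_deriv_fock_le:
  assumes "v \<in> fock_le U j" shows "even_deriv g v \<in> fock_le U (j - 2 * int (even_weight g))"
proof (rule fock_leI[OF assms, where f = "\<lambda>(M, S). (M - {#g#}, S)"])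
  fix M S assume "even_deriv g v (M, S) \<noteq> 0"
  then have *: "v (add_mset g M, S) \<noteq> 0" by (auto simp: even_deriv_def fun_eq_iff)
  then show "\<exists>M' S'. v (M', S') \<noteq> 0 \<and> (M, S) = (case (M', S') of (M, S) \<Rightarrow> (M - {#g#}, S)) \<and>
      (finite S' \<longrightarrow> finite S) \<and> (2 * int (momentum_weight (M', S')) \<le> j \<longrightarrow> finite S' \<longrightarrow>
       2 * int (momentum_weight (M, S)) \<le> j - 2 * int (even_weight g))"
    by (intro exI[of _ "add_mset g M"] exI[of _ S]) (auto simp: momentum_weight_def)
next
  show "even_deriv g v mn \<in> smooth_ring U" for mn
    using fock_le_coeff[OF assms] by (cases mn) (auto simp: even_deriv_def intro: smooth_ring.scale)
qed

lemma odd_mult_fock_le: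
  assumes "v \<in> fock_le U j" shows "odd_mult s v \<in> fock_le U (j + 2 * int (odd_weight s))"
proof (rule fock_leI[OF assms, where f = "\<lambda>(M, S). (M, insert s S)"])
  fix M S assume "odd_mult s v (M, S) \<noteq> 0"
  then have *: "s \<in> S" "v (M, S - {s}) \<noteq> 0" by (auto simp: odd_mult_def fun_eq_iff split: if_splits)
  define S' where "S' = S - {s}"
  have "S = insert s S'" "s \<notin> S'" using * by (auto simp: S'_def)
  then show "\<exists>M' S'. v (M', S') \<noteq> 0 \<and> (M, S) = (case (M', S') of (M, S) \<Rightarrow> (M, insert s S)) \<and>
      (finite S' \<longrightarrow> finite S) \<and> (2 * int (momentum_weight (M', S')) \<le> j \<longrightarrow> finite S' \<longrightarrow>
       2 * int (momentum_weight (M, S)) \<le> j + 2 * int (odd_weight s))"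
    using * by (intro exI[of _ M] exI[of _ S']) (auto simp: momentum_weight_def)
next
  show "odd_mult s v mn \<in> smooth_ring U" for mn
    using fock_le_coeff[OF assms] smooth_ring_zero[of U]
    by (cases mn; cases "s \<in> snd mn") (auto simp: odd_mult_def intro: smooth_ring.scale)
qed

lemma odd_deriv_fock_le:
  assumes "v \<in> fock_le U j" shows "odd_deriv s v \<in> fock_le U (j - 2 * int (odd_weight s))"
proof (rule fock_leI[OF assms, where f = "\<lambda>(M, S). (M, S - {s})"])
  fix M S assume "odd_deriv s v (M, S) \<noteq> 0"
  then have *: "s \<notin> S" "v (M, insert s S) \<noteq> 0" by (auto simp: odd_deriv_def fun_eq_iff split: if_splits)
  then show "\<exists>M' S'. v (M', S') \<noteq> 0 \<and> (M, S) = (case (M', S') of (M, S) \<Rightarrow> (M, S - {s})) \<and>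
      (finite S' \<longrightarrow> finite S) \<and> (2 * int (momentum_weight (M', S')) \<le> j \<longrightarrow> finite S' \<longrightarrow>
       2 * int (momentum_weight (M, S)) \<le> j - 2 * int (odd_weight s))"
    by (intro exI[of _ M] exI[of _ "insert s S"]) (auto simp: momentum_weight_def)
next
  show "odd_deriv s v mn \<in> smooth_ring U" for mn
    using fock_le_coeff[OF assms] smooth_ring_zero[of U]
    by (cases mn; cases "s \<in> snd mn") (auto simp: odd_deriv_def intro: smooth_ring.scale)
qed

lemma fun_mult_fock_le:
  assumes "v \<in> fock_le U j" "f \<in> smooth_ring U" shows "fun_mult f v \<in> fock_le U j"
proof (rule fock_leI[OF assms(1), where f = "\<lambda>mn. mn"])
  show "fun_mult f v mn \<in> smooth_ring U" for mn
    unfolding fun_mult_def by (intro smooth_ring.mult assms fock_le_coeff[OF assms(1)])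
qed (auto simp: fun_mult_def fun_eq_iff)

lemma partial_op_fock_le:
  assumes "open U" "v \<in> fock_le U j" shows "partial_op U i v \<in> fock_le U j"
proof (rule fock_leI[OF assms(2), where f = "\<lambda>mn. mn"])
  show "partial_op U i v mn \<in> smooth_ring U" for mn
    unfolding partial_op_def by (intro smooth_partial_deriv assms(1) fock_le_coeff[OF assms(2)])
  have "partial_deriv U i 0 = 0"
    by (auto simp: partial_deriv_def fun_eq_iff)
  then show "\<And>M S. partial_op U i v (M, S) \<noteq> 0 \<Longrightarrow> \<exists>M' S'. v (M', S') \<noteq> 0 \<and> (M, S) = (M', S') \<and>
      (finite S' \<longrightarrow> finite S) \<and> (2 * int (momentum_weight (M', S')) \<le> j \<longrightarrow> finite S' \<longrightarrow>
       2 * int (momentum_weight (M, S)) \<le> j)"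
    by (auto simp: partial_op_def)
qed

lemma partial_deriv_zero: "partial_deriv U i 0 = 0" "partial_deriv U i (\<lambda>x. 0) = (\<lambda>x. 0)"
  by (auto simp: partial_deriv_def fun_eq_iff)

lemma partial_op_commute:
  assumes U: "open U" and v: "v \<in> fock U"
  shows "partial_op U i (even_mult g v) = even_mult g (partial_op U i v)"
    "partial_op U i (even_deriv g v) = even_deriv g (partial_op U i v)"
    "partial_op U i (odd_mult s v) = odd_mult s (partial_op U i v)"
    "partial_op U i (odd_deriv s v) = odd_deriv s (partial_op U i v)"
    "partial_op U i (scale c v) = scale c (partial_op U i v)"
    "partial_op U i (partial_op U k v) = partial_op U k (partial_op U i v)"
proof -
  have sm: "v mn \<in> smooth_ring U" for mn using v by (rule fock_coeff)
  note cm = partial_deriv_cmult[OF U sm]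
  show "partial_op U i (even_mult g v) = even_mult g (partial_op U i v)"
    by (auto simp: partial_op_def even_mult_def fun_eq_iff partial_deriv_zero)
  show "partial_op U i (even_deriv g v) = even_deriv g (partial_op U i v)"
    by (auto simp: partial_op_def even_deriv_def fun_eq_iff cm simp del: of_nat_add of_nat_Suc)
  show "partial_op U i (odd_mult s v) = odd_mult s (partial_op U i v)"
    by (auto simp: partial_op_def odd_mult_def fun_eq_iff cm partial_deriv_zero)
  show "partial_op U i (odd_deriv s v) = odd_deriv s (partial_op U i v)"
    by (auto simp: partial_op_def odd_deriv_def fun_eq_iff cm partial_deriv_zero)
  show "partial_op U i (scale c v) = scale c (partial_op U i v)"
    by (auto simp: partial_op_def scale_def fun_eq_iff cm partial_deriv_zero)
  show "partial_op U i (partial_op U k v) = partial_op U k (partial_op U i v)"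
    by (auto simp: partial_op_def partial_deriv_commute[OF U sm])
qed

lemma partial_op_add:
  assumes U: "open U" and v: "v \<in> fock U" "w \<in> fock U"
  shows "partial_op U i (v + w) = partial_op U i v + partial_op U i w"
  using partial_deriv_add[OF U fock_coeff[OF v(1)] fock_coeff[OF v(2)]]
  by (auto simp: partial_op_def plus_fun_def)

lemma partial_op_fun_mult:
  assumes U: "open U" and v: "v \<in> fock U" and f: "f \<in> smooth_ring U"
  shows "partial_op U i (fun_mult f v) = fun_mult f (partial_op U i v) + fun_mult (partial_deriv U i f) v"
  using partial_deriv_mult[OF U f fock_coeff[OF v]]
  by (auto simp: partial_op_def plus_fun_def fun_mult_def add.commute)

section \<open>Canonical commutation relations\<close>

text \<open>
  The index set \<open>'n + 'n\<close> lists the even directions \<open>Inl i\<close> and the odd directions \<open>Inr i\<close>.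
\<close>

definition parity :: "'n + 'n \<Rightarrow> bool"
  where "parity a \<longleftrightarrow> (case a of Inl i \<Rightarrow> False | Inr i \<Rightarrow> True)"

lemma parity_simps [simp]: "\<not> parity (Inl i)" "parity (Inr i)"
  by (simp_all add: parity_def)

text \<open>
  The Koszul sign of exchanging two homogeneous operators.
\<close>

definition swap_sign :: "bool \<Rightarrow> bool \<Rightarrow> 'k::real_normed_field"
  where "swap_sign p q = (if p \<and> q then - 1 else 1)"

lemma elementary_zero:
  "even_mult g 0 = 0" "even_deriv g 0 = 0" "odd_mult s 0 = 0" "odd_deriv s 0 = 0" "fun_mult f 0 = 0"
  by (auto simp: even_mult_def even_deriv_def odd_mult_def odd_deriv_def fun_mult_def fun_eq_iff)

lemma elementary_minus:
  "even_mult g (- v) = - even_mult g v" "even_deriv g (- v) = - even_deriv g v"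
  "odd_mult s (- v) = - odd_mult s v" "odd_deriv s (- v) = - odd_deriv s v"
  "fun_mult f (- v) = - fun_mult f v"
  by (auto simp: even_mult_def even_deriv_def odd_mult_def odd_deriv_def fun_mult_def fun_eq_iff)

lemma partial_op_minus:
  fixes U :: "('k::{real_normed_field,banach} ^ 'n::{finite,linorder}) set"
  shows "open U \<Longrightarrow> v \<in> fock U \<Longrightarrow> partial_op U i (- v) = - partial_op U i v"
  using partial_op_commute(5)[of U v i "- 1"] by simp

locale bcbg =
  fixes U :: "('k::{real_normed_field,banach} ^ 'n::{finite,linorder}) set" and hbar :: 'k
  assumes open_U: "open U"
begin

abbreviation gm :: "'n gen \<Rightarrow> int \<Rightarrow> ('k, 'n) vec_fun \<Rightarrow> ('k, 'n) vec_fun"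
  where "gm \<equiv> gen_mode U hbar"

text \<open>
  Modes of the coordinate fields \<open>\<gamma>\<^sup>i - x\<^sub>i\<close> and \<open>c\<^sub>i\<close>. The mode \<open>-1\<close> of \<open>\<gamma>\<^sup>i\<close> is multiplication
  by \<open>x\<^sub>i\<close>; it is left out because it is the base point of all Taylor expansions.
\<close>

definition coord :: "'n + 'n \<Rightarrow> int \<Rightarrow> ('k, 'n) vec_fun \<Rightarrow> ('k, 'n) vec_fun"
  where "coord a m v = (case a of Inl i \<Rightarrow> if m = - 1 then 0 else gm (Gamma i) m v | Inr i \<Rightarrow> gm (CF i) m v)"

text \<open>
  Modes of the momenta \<open>-\<beta>\<^sub>i\<close> and \<open>b\<^sup>i\<close>. With this sign both families satisfy \<open>[p, q] = \<hbar>\<close> with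
  the coordinates.
\<close>

definition mom :: "'n + 'n \<Rightarrow> int \<Rightarrow> ('k, 'n) vec_fun \<Rightarrow> ('k, 'n) vec_fun"
  where "mom a m v = (case a of Inl i \<Rightarrow> scale (- 1) (gm (Beta i) m v) | Inr i \<Rightarrow> gm (BF i) m v)"

lemma coord_simps:
  "coord (Inl i) m v = (if m = - 1 then 0 else if m < 0 then even_mult (GammaV i (nat (- m))) v
     else scale hbar (even_deriv (BetaV i (nat (m + 1))) v))"
  "coord (Inr i) m v = (if m < 0 then odd_mult (CV i (nat (- m))) v
     else scale hbar (odd_deriv (BV i (nat (m + 1))) v))"
  by (auto simp: coord_def gamma_mult_def)

lemma mom_simps:
  "mom (Inl i) m v = (if m < 0 then scale (- 1) (even_mult (BetaV i (nat (- m))) v)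
     else if m = 0 then scale hbar (partial_op U i v)
     else scale hbar (even_deriv (GammaV i (nat (m + 1))) v))"
  "mom (Inr i) m v = (if m < 0 then odd_mult (BV i (nat (- m))) v
     else scale hbar (odd_deriv (CV i (nat (m + 1))) v))"
  by (auto simp: mom_def gamma_deriv_def partial_op_def)

lemma odd_finite_fock: "v \<in> fock U \<Longrightarrow> odd_finite v"
  by (simp add: fock_def)

text \<open>
  An annihilation mode \<open>m \<ge> 0\<close> removes a momentum variable of weight \<open>m + 1\<close>, a creation mode
  adds no momentum variable. For \<open>\<gamma>\<close> the third bound is sharper by one than the mean \<open>j - m - 1\<close>
  of the first two; it holds because the mode \<open>-1\<close>, the only one where these two agree, is
  absent.
\<close>

lemma coord_filtered:
  assumes v: "v \<in> fock_le U j"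
  shows "coord a m v \<in> fock_le U j" "coord a m v \<in> fock_le U (j - 2 * m - 2)"
    "\<not> parity a \<Longrightarrow> coord a m v \<in> fock_le U (j - m - 2)"
proof -
  have *: "coord a m v \<in> fock_le U (if m < 0 then j else j - 2 * m - 2)"
  proof -
    have "even_deriv (BetaV i (nat (m + 1))) v \<in> fock_le U (j - 2 * m - 2)"
      "odd_deriv (BV i (nat (m + 1))) v \<in> fock_le U (j - 2 * m - 2)" if "0 \<le> m" for i
      using even_deriv_fock_le[OF v, of "BetaV i (nat (m + 1))"]
        odd_deriv_fock_le[OF v, of "BV i (nat (m + 1))"] that by (simp_all add: algebra_simps)
    moreover have "even_mult (GammaV i l) v \<in> fock_le U j" "odd_mult (CV i l) v \<in> fock_le U j" for i l
      using even_mult_fock_le[OF v, of "GammaV i l"] odd_mult_fock_le[OF v, of "CV i l"] by simp_all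
    ultimately show ?thesis by (cases a) (auto simp: coord_simps intro!: fock_le_scale)
  qed
  then show "coord a m v \<in> fock_le U j" "coord a m v \<in> fock_le U (j - 2 * m - 2)"
    by (auto split: if_splits elim!: fock_le_mono)
  show "coord a m v \<in> fock_le U (j - m - 2)" if "\<not> parity a"
  proof (cases "m = -1")
    case True
    then show ?thesis using that by (cases a) (auto simp: coord_simps)
  next
    case False
    then show ?thesis using * by (auto split: if_splits elim!: fock_le_mono)
  qed
qed

lemma mom_filtered:
  assumes v: "v \<in> fock_le U j"
  shows "mom a m v \<in> fock_le U (if m < 0 then j - 2 * m else j)"
proof -
  have "even_deriv (GammaV i l) v \<in> fock_le U j" "odd_deriv (CV i l) v \<in> fock_le U j" for i l
    using even_deriv_fock_le[OF v, of "GammaV i l"] odd_deriv_fock_le[OF v, of "CV i l"] by simp_all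
  moreover have "even_mult (BetaV i (nat (- m))) v \<in> fock_le U (j - 2 * m)"
    "odd_mult (BV i (nat (- m))) v \<in> fock_le U (j - 2 * m)" if "m < 0" for i
    using even_mult_fock_le[OF v, of "BetaV i (nat (- m))"]
      odd_mult_fock_le[OF v, of "BV i (nat (- m))"] that by simp_all
  ultimately show ?thesis
    using partial_op_fock_le[OF open_U v]
    by (cases a) (auto simp: mom_simps simp del: vec_fun.scale_minus_left intro!: fock_le_scale)
qed

lemma coord_fock [simp]: "v \<in> fock U \<Longrightarrow> coord a m v \<in> fock U"
  by (metis fock_exhausted coord_filtered(1) fock_le_fock)

lemma mom_fock [simp]: "v \<in> fock U \<Longrightarrow> mom a m v \<in> fock U"
  by (metis fock_exhausted mom_filtered fock_le_fock)

lemma coord_add: "coord a m (v + w) = coord a m v + coord a m w"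
  by (cases a) (auto simp: coord_simps elementary_add vec_fun.scale_right_distrib)

lemma coord_scale: "coord a m (scale c v) = scale c (coord a m v)"
  by (cases a) (auto simp: coord_simps scale_commute vec_fun.scale_left_commute)

lemma mom_add: "v \<in> fock U \<Longrightarrow> w \<in> fock U \<Longrightarrow> mom a m (v + w) = mom a m v + mom a m w"
  by (cases a) (auto simp: mom_simps elementary_add vec_fun.scale_right_distrib partial_op_add[OF open_U])

lemma mom_scale: "v \<in> fock U \<Longrightarrow> mom a m (scale c v) = scale c (mom a m v)"
  by (cases a) (auto simp: mom_simps scale_commute vec_fun.scale_left_commute partial_op_commute[OF open_U])

lemma coord_coord:
  assumes v: "v \<in> fock U"
  shows "coord a m (coord b l v) = scale (swap_sign (parity a) (parity b)) (coord b l (coord a m v))"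
proof -
  note anti = odd_mult_anticommute[OF odd_finite_fock[OF v]] odd_deriv_anticommute[OF odd_finite_fock[OF v]]
    odd_deriv_mult_anticommute[OF odd_finite_fock[OF v]]
  consider i k where "a = Inl i" "b = Inl k" | i k where "a = Inl i" "b = Inr k"
    | i k where "a = Inr i" "b = Inl k" | i k where "a = Inr i" "b = Inr k"
    by (cases a; cases b) auto
  then show ?thesis
  proof cases
    case (1 i k)
    then show ?thesis
      using even_mult_commute[of "GammaV i (nat (-m))" "GammaV k (nat (-l))" v]
        even_deriv_commute[of "BetaV i (nat (m+1))" "BetaV k (nat (l+1))" v]
      by (auto simp: coord_simps swap_sign_def scale_commute elementary_minus even_deriv_mult elementary_zero)
  next
    case 2
    then show ?thesis
      by (auto simp: coord_simps swap_sign_def scale_commute elementary_minus even_odd_commute elementary_zero vec_fun.scale_left_commute)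
  next
    case 3
    then show ?thesis
      by (auto simp: coord_simps swap_sign_def scale_commute elementary_minus even_odd_commute elementary_zero vec_fun.scale_left_commute)
  next
    case (4 i k)
    have mm: "odd_mult s (odd_mult t v) = - odd_mult t (odd_mult s v)" for s t
      using anti(1)[of s t] by simp
    have dd: "odd_deriv s (odd_deriv t v) = - odd_deriv t (odd_deriv s v)" for s t
      using anti(2)[of s t] by simp
    have dm: "odd_deriv s (odd_mult t v) = - odd_mult t (odd_deriv s v) + (if s = t then v else 0)" for s t
      using anti(3)[of s t] by simp
    show ?thesis
      using 4 mm[of "CV i (nat (-m))" "CV k (nat (-l))"] dd[of "BV i (nat (m+1))" "BV k (nat (l+1))"]
      by (auto simp: coord_simps swap_sign_def scale_commute elementary_minus dm)
  qed
qed

lemma mom_mom: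
  assumes v: "v \<in> fock U"
  shows "mom a m (mom b l v) = scale (swap_sign (parity a) (parity b)) (mom b l (mom a m v))"
proof -
  note anti = odd_mult_anticommute[OF odd_finite_fock[OF v]] odd_deriv_anticommute[OF odd_finite_fock[OF v]]
    odd_deriv_mult_anticommute[OF odd_finite_fock[OF v]]
  have cl: "even_mult g v \<in> fock U" "even_deriv g v \<in> fock U" "odd_mult s v \<in> fock U" "odd_deriv s v \<in> fock U"
    "partial_op U i v \<in> fock U" for g s i
    by (metis v fock_exhausted fock_le_fock even_mult_fock_le even_deriv_fock_le odd_mult_fock_le
        odd_deriv_fock_le partial_op_fock_le open_U)+
  note pc = partial_op_commute(1-5)[OF open_U v] partial_op_commute(5)[OF open_U] partial_op_minus[OF open_U] cl
  consider i k where "a = Inl i" "b = Inl k" | i k where "a = Inl i" "b = Inr k"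
    | i k where "a = Inr i" "b = Inl k" | i k where "a = Inr i" "b = Inr k"
    by (cases a; cases b) auto
  then show ?thesis
  proof cases
    case (1 i k)
    then show ?thesis
      using even_mult_commute[of "BetaV i (nat (-m))" "BetaV k (nat (-l))" v]
        even_deriv_commute[of "GammaV i (nat (m+1))" "GammaV k (nat (l+1))" v]
        partial_op_commute(6)[OF open_U v, of i k]
      by (auto simp: mom_simps swap_sign_def scale_commute elementary_minus even_deriv_mult pc)
  next
    case 2
    then show ?thesis
      by (auto simp: mom_simps swap_sign_def scale_commute elementary_minus even_odd_commute pc vec_fun.scale_left_commute)
  next
    case 3
    then show ?thesis
      by (auto simp: mom_simps swap_sign_def scale_commute elementary_minus even_odd_commute pc vec_fun.scale_left_commute)
  next
    case (4 i k)
    have mm: "odd_mult s (odd_mult t v) = - odd_mult t (odd_mult s v)" for s t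
      using anti(1)[of s t] by simp
    have dd: "odd_deriv s (odd_deriv t v) = - odd_deriv t (odd_deriv s v)" for s t
      using anti(2)[of s t] by simp
    have dm: "odd_deriv s (odd_mult t v) = - odd_mult t (odd_deriv s v) + (if s = t then v else 0)" for s t
      using anti(3)[of s t] by simp
    show ?thesis
      using 4 mm[of "BV i (nat (-m))" "BV k (nat (-l))"] dd[of "CV i (nat (m+1))" "CV k (nat (l+1))"]
      by (auto simp: mom_simps swap_sign_def scale_commute elementary_minus dm)
  qed
qed

text \<open>
  The zero mode of an even momentum is \<open>\<hbar> \<partial>\<^sub>i\<close> on coefficients. Its partner would be the missing
  mode \<open>-1\<close> of \<open>\<gamma>\<^sup>i\<close>, hence the exception in the contraction term; the contribution reappears in
  \<open>mom_fun_mult\<close>.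
\<close>

lemma mom_coord:
  assumes v: "v \<in> fock U"
  shows "mom a m (coord b l v) = scale (swap_sign (parity a) (parity b)) (coord b l (mom a m v))
    + (if a = b \<and> m + l = - 1 \<and> (parity a \<or> m \<noteq> 0) then scale hbar v else 0)"
proof -
  note anti = odd_mult_anticommute[OF odd_finite_fock[OF v]] odd_deriv_anticommute[OF odd_finite_fock[OF v]]
    odd_deriv_mult_anticommute[OF odd_finite_fock[OF v]]
  have cl: "even_mult g v \<in> fock U" "even_deriv g v \<in> fock U" "odd_mult s v \<in> fock U" "odd_deriv s v \<in> fock U"
    "partial_op U i v \<in> fock U" for g s i
    by (metis v fock_exhausted fock_le_fock even_mult_fock_le even_deriv_fock_le odd_mult_fock_le
        odd_deriv_fock_le partial_op_fock_le open_U)+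
  have pz: "partial_op U i 0 = 0" for i by (simp add: partial_op_def partial_deriv_zero fun_eq_iff)
  note pc = partial_op_commute(1-5)[OF open_U v] partial_op_commute(5)[OF open_U] partial_op_minus[OF open_U] cl pz elementary_zero
  consider i k where "a = Inl i" "b = Inl k" | i k where "a = Inl i" "b = Inr k"
    | i k where "a = Inr i" "b = Inl k" | i k where "a = Inr i" "b = Inr k"
    by (cases a; cases b) auto
  then show ?thesis
  proof cases
    case (1 i k)
    then show ?thesis
      using even_mult_commute[of "BetaV i (nat (-m))" "GammaV k (nat (-l))" v]
        even_deriv_commute[of "GammaV i (nat (m+1))" "BetaV k (nat (l+1))" v]
      by (auto simp: mom_simps coord_simps swap_sign_def scale_commute elementary_minus even_deriv_mult pc vec_fun.scale_left_commute
          vec_fun.scale_right_distrib vec_fun.scale_right_diff_distrib)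
  next
    case 2
    then show ?thesis
      by (auto simp: mom_simps coord_simps swap_sign_def scale_commute elementary_minus even_odd_commute pc vec_fun.scale_left_commute)
  next
    case 3
    then show ?thesis
      by (auto simp: mom_simps coord_simps swap_sign_def scale_commute elementary_minus even_odd_commute pc vec_fun.scale_left_commute)
  next
    case (4 i k)
    have mm: "odd_mult s (odd_mult t v) = - odd_mult t (odd_mult s v)" for s t
      using anti(1)[of s t] by simp
    have dd: "odd_deriv s (odd_deriv t v) = - odd_deriv t (odd_deriv s v)" for s t
      using anti(2)[of s t] by simp
    have dm: "odd_deriv s (odd_mult t v) = - odd_mult t (odd_deriv s v) + (if s = t then v else 0)" for s t
      using anti(3)[of s t] by simp
    show ?thesis
    proof (cases "m < 0"; cases "l < 0")
      assume "m < 0" "l < 0"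
      then show ?thesis
        using 4 mm[of "BV i (nat (-m))" "CV k (nat (-l))"]
        by (simp add: mom_simps coord_simps swap_sign_def)
    next
      assume "m < 0" "\<not> l < 0"
      moreover then have "nat (l + 1) = nat (- m) \<longleftrightarrow> m + l = - 1" by auto
      ultimately show ?thesis
        using 4 dm[of "BV k (nat (l+1))" "BV i (nat (-m))"]
        by (simp add: mom_simps coord_simps swap_sign_def scale_commute vec_fun.scale_right_diff_distrib)
    next
      assume "\<not> m < 0" "l < 0"
      moreover then have "nat (m + 1) = nat (- l) \<longleftrightarrow> m + l = - 1" by auto
      ultimately show ?thesis
        using 4 dm[of "CV i (nat (m+1))" "CV k (nat (-l))"]
        by (simp add: mom_simps coord_simps swap_sign_def scale_commute vec_fun.scale_right_distrib vec_fun.scale_right_diff_distrib)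
    next
      assume "\<not> m < 0" "\<not> l < 0"
      then show ?thesis
        using 4 dd[of "CV i (nat (m+1))" "BV k (nat (l+1))"]
        by (simp add: mom_simps coord_simps swap_sign_def scale_commute elementary_minus)
    qed
  qed
qed

lemma fun_mult_coord: "fun_mult f (coord a m v) = coord a m (fun_mult f v)"
  by (cases a) (auto simp: coord_simps fun_mult_commute elementary_zero)

lemma mom_fun_mult:
  assumes v: "v \<in> fock U" and f: "f \<in> smooth_ring U"
  shows "mom a m (fun_mult f v) = fun_mult f (mom a m v) +
    (case a of Inl i \<Rightarrow> if m = 0 then scale hbar (fun_mult (partial_deriv U i f) v) else 0 | Inr i \<Rightarrow> 0)"
  using partial_op_fun_mult[OF open_U v f]
  by (cases a) (auto simp: mom_simps fun_mult_commute elementary_minus elementary_add vec_fun.scale_right_distrib)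

end

section \<open>The convolution product of coordinate fields\<close>

type_synonym ('k, 'n) field_op = "int \<Rightarrow> ('k, 'n) vec_fun \<Rightarrow> ('k, 'n) vec_fun"

context bcbg
begin

text \<open>
  Fields made of coordinates only, acting by modes of the indicated filtration degrees. The
  third bound says that the field has order at least \<open>t\<close>: on vectors of degree \<open>j\<close> only the
  powers \<open>z\<^sup>e\<close> with \<open>e \<ge> t - j\<close> occur. For \<open>t = 0\<close> it is the mean of the first two bounds and
  follows from them (lemma \<open>field_0I\<close>); the order of \<open>\<gamma>\<^sup>i - x\<^sub>i\<close> is 1, and orders add in
  products. This makes Taylor expansions finite on every vector.
\<close>

definition field :: "int \<Rightarrow> ('k, 'n) field_op \<Rightarrow> bool"
  where "field t X \<longleftrightarrow>
    (\<forall>l. \<forall>v\<in>fock U. \<forall>w\<in>fock U. X l (v + w) = X l v + X l w) \<and>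
    (\<forall>l c. \<forall>v\<in>fock U. X l (scale c v) = scale c (X l v)) \<and>
    (\<forall>j l. \<forall>v\<in>fock_le U j. X l v \<in> fock_le U j \<and> X l v \<in> fock_le U (j - 2 * l - 2) \<and>
       X l v \<in> fock_le U (j - l - 1 - t))"

lemma field_add: "field t X \<Longrightarrow> v \<in> fock U \<Longrightarrow> w \<in> fock U \<Longrightarrow> X l (v + w) = X l v + X l w"
  and field_scale: "field t X \<Longrightarrow> v \<in> fock U \<Longrightarrow> X l (scale c v) = scale c (X l v)"
  and field_le: "field t X \<Longrightarrow> v \<in> fock_le U j \<Longrightarrow> X l v \<in> fock_le U j"
  and field_lower: "field t X \<Longrightarrow> v \<in> fock_le U j \<Longrightarrow> X l v \<in> fock_le U (j - 2 * l - 2)"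
  and field_order: "field t X \<Longrightarrow> v \<in> fock_le U j \<Longrightarrow> X l v \<in> fock_le U (j - l - 1 - t)"
  by (simp_all add: field_def)

lemma field_fock: "field t X \<Longrightarrow> v \<in> fock U \<Longrightarrow> X l v \<in> fock U"
  by (metis fock_exhausted field_le fock_le_fock)

lemma field_vanish: "field t X \<Longrightarrow> v \<in> fock_le U j \<Longrightarrow> j < 2 * l + 2 \<Longrightarrow> X l v = 0"
  using field_lower[of t X v j l] by (auto intro: fock_le_negative)

lemma field_zero: "field t X \<Longrightarrow> X l 0 = 0"
  using field_scale[of t X 0 l 0] by (simp add: fock_zero)

lemma field_sum:
  assumes X: "field t X" and "\<And>x. x \<in> A \<Longrightarrow> g x \<in> fock U"
  shows "X l (sum g A) = (\<Sum>x\<in>A. X l (g x))"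
  using assms(2)
  by (induction A rule: infinite_finite_induct) (simp_all add: field_zero[OF X] field_add[OF X] fock_sum)

lemma mom_zero [simp]: "mom a k 0 = 0"
  using mom_scale[of 0 a k 0] by (simp add: fock_zero)

lemma mom_sum: "(\<And>x. x \<in> A \<Longrightarrow> g x \<in> fock U) \<Longrightarrow> mom a k (sum g A) = (\<Sum>x\<in>A. mom a k (g x))"
  by (induction A rule: infinite_finite_induct) (auto simp: mom_add fock_sum)

lemma field_mono: "field t X \<Longrightarrow> t' \<le> t \<Longrightarrow> field t' X"
  unfolding field_def by (meson fock_le_mono diff_left_mono)

lemma field_0I:
  assumes "\<And>l v w. v \<in> fock U \<Longrightarrow> w \<in> fock U \<Longrightarrow> X l (v + w) = X l v + X l w"
    and "\<And>l c v. v \<in> fock U \<Longrightarrow> X l (scale c v) = scale c (X l v)"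
    and le: "\<And>j l v. v \<in> fock_le U j \<Longrightarrow> X l v \<in> fock_le U j"
    and lower: "\<And>j l v. v \<in> fock_le U j \<Longrightarrow> X l v \<in> fock_le U (j - 2 * l - 2)"
  shows "field 0 X"
proof -
  have "X l v \<in> fock_le U (j - l - 1 - 0)" if "v \<in> fock_le U j" for j l v
    using fock_le_mono[OF le[OF that, of l]] fock_le_mono[OF lower[OF that, of l]]
    by (cases "l < 0") auto
  with assms show ?thesis unfolding field_def by blast
qed

lemma field_coord: "field 0 (coord a)"
  by (rule field_0I) (auto simp: coord_add coord_scale coord_filtered)

lemma field_coord_even: "\<not> parity a \<Longrightarrow> field 1 (coord a)"
  unfolding field_def using coord_filtered
  by (auto simp: coord_add coord_scale algebra_simps)

definition fun_field :: "(('k, 'n) vec \<Rightarrow> 'k) \<Rightarrow> ('k, 'n) field_op"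
  where "fun_field f l v = (if l = - 1 then fun_mult f v else 0)"

lemma field_fun_field: "f \<in> smooth_ring U \<Longrightarrow> field 0 (fun_field f)"
  by (rule field_0I) (auto simp: fun_field_def elementary_add fun_mult_commute fun_mult_fock_le)

definition one_field :: "('k, 'n) field_op"
  where "one_field l v = (if l = - 1 then v else 0)"

lemma field_one: "field 0 one_field"
  by (rule field_0I) (auto simp: one_field_def)

lemma field_zero_field: "field t (\<lambda>l v. 0)"
  by (simp add: field_def)

lemma field_plus: "field t X \<Longrightarrow> field t Y \<Longrightarrow> field t (\<lambda>l v. X l v + Y l v)"
  unfolding field_def by (auto intro: fock_le_add simp: vec_fun.scale_right_distrib)

lemma field_scaled: "field t X \<Longrightarrow> field t (\<lambda>l v. scale c (X l v))"
  unfolding field_def by (auto intro: fock_le_scale simp: vec_fun.scale_right_distrib vec_fun.scale_left_commute)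

lemma field_sum_field: "(\<And>a. a \<in> A \<Longrightarrow> field t (X a)) \<Longrightarrow> field t (\<lambda>l v. \<Sum>a\<in>A. X a l v)"
  by (induction A rule: infinite_finite_induct) (auto intro: field_plus field_zero_field)

text \<open>
  Mode \<open>l\<close> of the pointwise product \<open>X(z) Y(z)\<close>. For coordinate fields this agrees with the
  normally ordered product, since all modes of such fields supercommute.
\<close>

definition conv :: "('k, 'n) field_op \<Rightarrow> ('k, 'n) field_op \<Rightarrow> ('k, 'n) field_op"
  where "conv X Y l v = (\<Sum>k\<in>{k. X (- k - 1) (Y (k + l) v) \<noteq> 0}. X (- k - 1) (Y (k + l) v))"

lemma conv_eqI:
  assumes "finite K" "\<And>k. k \<notin> K \<Longrightarrow> X (- k - 1) (Y (k + l) v) = 0"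
  shows "conv X Y l v = (\<Sum>k\<in>K. X (- k - 1) (Y (k + l) v))"
  unfolding conv_def by (rule sum.mono_neutral_left) (use assms in auto)

lemma conv_term_zero:
  assumes "field t X" "field u Y" "v \<in> fock_le U j" "2 * k < - j \<or> j < 2 * (k + l) + 2"
  shows "X (- k - 1) (Y (k + l) v) = 0"
  using assms(4)
proof
  assume "2 * k < - j"
  then show ?thesis
    using field_vanish[OF assms(1) field_le[OF assms(2,3)], of "- k - 1" "k + l"] by simp
next
  assume "j < 2 * (k + l) + 2"
  then show ?thesis using field_vanish[OF assms(2,3)] field_zero[OF assms(1)] by simp
qed

text \<open>
  On vectors of degree \<open>j\<close> the defining sum may be taken over any finite set containing an
  explicit interval. Identities between convolutions reduce in this way to identities between
  finite sums.
\<close>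

lemma conv_window:
  assumes "field t X" "field u Y" "v \<in> fock_le U j" "0 \<le> j" "finite K" "{- j..j - l} \<subseteq> K"
  shows "conv X Y l v = (\<Sum>k\<in>K. X (- k - 1) (Y (k + l) v))"
proof (rule conv_eqI)
  fix k assume "k \<notin> K"
  then have "k \<notin> {- j..j - l}" using assms(6) by blast
  then show "X (- k - 1) (Y (k + l) v) = 0"
    using assms(4) by (intro conv_term_zero[OF assms(1,2,3)]) auto
qed (rule assms)

lemma field_conv:
  assumes X: "field t X" and Y: "field u Y" shows "field (t + u) (conv X Y)"
  unfolding field_def
proof (intro conjI allI ballI)
  fix l v w assume v: "v \<in> fock U" and w: "w \<in> fock U"
  obtain j1 j2 where j: "v \<in> fock_le U j1" "0 \<le> j1" "w \<in> fock_le U j2" "0 \<le> j2"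
    using fock_exhausted v w by metis
  define j where "j = max j1 j2"
  have "0 \<le> j" "v \<in> fock_le U j" "w \<in> fock_le U j" using j by (auto simp: j_def elim: fock_le_mono)
  moreover from this have "v + w \<in> fock_le U j" by (simp add: fock_le_add)
  ultimately show "conv X Y l (v + w) = conv X Y l v + conv X Y l w"
    using v w by (simp add: field_fock[OF Y] conv_window[OF X Y, of _ j "{- j..j - l}"] field_add[OF X] field_add[OF Y] sum.distrib)
next
  fix l c v assume v: "v \<in> fock U"
  then obtain j where "v \<in> fock_le U j" "0 \<le> j" using fock_exhausted by metis
  then show "conv X Y l (scale c v) = scale c (conv X Y l v)"
    using v fock_le_scale[of v U j c]
    by (simp add: field_fock[OF Y] conv_window[OF X Y, of _ j "{- j..j - l}"] field_scale[OF X] field_scale[OF Y] vec_fun.scale_sum_right)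
next
  fix j l v assume v: "v \<in> fock_le U j"
  show "conv X Y l v \<in> fock_le U j"
    unfolding conv_def by (intro fock_le_sum field_le[OF X] field_le[OF Y] v)
  have "X (- k - 1) (Y (k + l) v) \<in> fock_le U (j - 2 * l - 2)" for k
    using field_lower[OF X field_lower[OF Y v], of "- k - 1" "k + l"] by (simp add: algebra_simps)
  then show "conv X Y l v \<in> fock_le U (j - 2 * l - 2)"
    unfolding conv_def by (intro fock_le_sum) auto
  have "X (- k - 1) (Y (k + l) v) \<in> fock_le U (j - l - 1 - (t + u))" for k
    using field_order[OF X field_order[OF Y v], of "- k - 1" "k + l"] by (simp add: algebra_simps)
  then show "conv X Y l v \<in> fock_le U (j - l - 1 - (t + u))"
    unfolding conv_def by (intro fock_le_sum) auto
qed

lemma field_conv_0: "field 0 X \<Longrightarrow> field 0 Y \<Longrightarrow> field 0 (conv X Y)"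
  using field_conv[of 0 X 0 Y] by simp

lemma conv_cong:
  assumes "\<And>l v. v \<in> fock U \<Longrightarrow> X l v = X' l v" "\<And>l v. v \<in> fock U \<Longrightarrow> Y l v = Y' l v"
    "field t Y'" "v \<in> fock U"
  shows "conv X Y l v = conv X' Y' l v"
proof -
  have "X (- k - 1) (Y (k + l) v) = X' (- k - 1) (Y' (k + l) v)" for k
    using assms(1)[OF field_fock[OF assms(3,4)]] assms(2)[OF assms(4)] by simp
  then show ?thesis by (simp add: conv_def)
qed

lemma conv_assoc:
  assumes X: "field t X" and Y: "field u Y" and Z: "field w Z" and v: "v \<in> fock U"
  shows "conv (conv X Y) Z l v = conv X (conv Y Z) l v"
proof -
  obtain j where j: "v \<in> fock_le U j" "0 \<le> j" using v by (rule fock_exhausted)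
  define T where "T h k = X (- h - 1) (Y (h - k - 1) (Z (k + l) v))" for h k
  have T0: "T h k = 0" if "2 * h < - j \<or> j < 2 * (h - k) \<or> j < 2 * (k + l) + 2" for h k
    using that field_vanish[OF X field_le[OF Y field_le[OF Z j(1)]], of "- h - 1" "h - k - 1" "k + l"]
      field_vanish[OF Y field_le[OF Z j(1)], of "h - k - 1" "k + l"]
      field_vanish[OF Z j(1), of "k + l"]
    by (auto simp: T_def field_zero[OF X] field_zero[OF Y])
  (* the support of T lies in A \<times> B; the index k is bounded below only through h *)
  define A B where "A = {- j..j - l}" and "B = {- 2 * j..j - l}"
  have TA: "T h k = 0" if "h \<notin> A \<or> k \<notin> B" for h k
    by (rule T0) (use that j(2) in \<open>auto simp: A_def B_def\<close>)
  have l1: "conv X Y (- k - 1) (Z (k + l) v) = (\<Sum>h\<in>A. T h k)" for k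
  proof -
    have T: "T h k = X (- h - 1) (Y (h + (- k - 1)) (Z (k + l) v))" for h
    proof -
      have "h - k - 1 = h + (- k - 1)" by simp
      then show ?thesis by (simp only: T_def)
    qed
    have "conv X Y (- k - 1) (Z (k + l) v) = (\<Sum>h\<in>A. X (- h - 1) (Y (h + (- k - 1)) (Z (k + l) v)))"
    proof (rule conv_eqI)
      show "X (- h - 1) (Y (h + (- k - 1)) (Z (k + l) v)) = 0" if "h \<notin> A" for h
        using TA[of h k] that by (simp only: T) simp
    qed (simp add: A_def)
    then show ?thesis by (simp only: T)
  qed
  have "conv (conv X Y) Z l v = (\<Sum>k\<in>B. conv X Y (- k - 1) (Z (k + l) v))"
    by (rule conv_eqI) (use TA in \<open>auto simp: l1 B_def\<close>)
  also have "\<dots> = (\<Sum>k\<in>B. \<Sum>h\<in>A. T h k)" by (simp add: l1)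
  also have "\<dots> = (\<Sum>h\<in>A. \<Sum>k\<in>B. T h k)" by (rule sum.swap)
  also have "\<dots> = (\<Sum>h\<in>A. X (- h - 1) (conv Y Z (h + l) v))"
  proof (rule sum.cong[OF refl])
    fix h assume h: "h \<in> A"
    have "conv Y Z (h + l) v = (\<Sum>k'\<in>(\<lambda>k. k - h) ` B. Y (- k' - 1) (Z (k' + (h + l)) v))"
    proof (rule conv_eqI)
      fix k' assume "k' \<notin> (\<lambda>k. k - h) ` B"
      then have "k' + h \<notin> B" by (metis add_diff_cancel_right' imageI)
      then show "Y (- k' - 1) (Z (k' + (h + l)) v) = 0"
        using h j(2) by (intro conv_term_zero[OF Y Z j(1)]) (auto simp: A_def B_def)
    qed (simp add: B_def)
    also have "\<dots> = (\<Sum>k\<in>B. Y (h - k - 1) (Z (k + l) v))"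
      by (subst sum.reindex) (auto simp: inj_on_def algebra_simps)
    finally show "(\<Sum>k\<in>B. T h k) = X (- h - 1) (conv Y Z (h + l) v)"
      using v by (simp add: T_def field_sum[OF X] field_fock[OF Y] field_fock[OF Z])
  qed
  also have "\<dots> = conv X (conv Y Z) l v"
    by (rule conv_window[OF X field_conv[OF Y Z] j, symmetric]) (auto simp: A_def)
  finally show ?thesis .
qed

definition supercommute :: "'k \<Rightarrow> ('k, 'n) field_op \<Rightarrow> ('k, 'n) field_op \<Rightarrow> bool"
  where "supercommute s X Y \<longleftrightarrow> (\<forall>k l. \<forall>v\<in>fock U. X k (Y l v) = scale s (Y l (X k v)))"

lemma supercommuteD: "supercommute s X Y \<Longrightarrow> v \<in> fock U \<Longrightarrow> X k (Y l v) = scale s (Y l (X k v))"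
  by (simp add: supercommute_def)

lemma supercommute_sym: "supercommute s X Y \<Longrightarrow> s * s = 1 \<Longrightarrow> supercommute s Y X"
  by (simp add: supercommute_def)

lemma conv_commute:
  assumes X: "field t X" and Y: "field u Y" and s: "supercommute s X Y" and v: "v \<in> fock U"
  shows "conv X Y l v = scale s (conv Y X l v)"
proof -
  obtain j where j: "v \<in> fock_le U j" "0 \<le> j" using v by (rule fock_exhausted)
  define N where "N = j + \<bar>l\<bar> + 1"
  (* this interval is symmetric under the exchange k \<mapsto> - k - l - 1 of the two modes *)
  have "conv X Y l v = (\<Sum>k\<in>{- N - l - 1..N}. X (- k - 1) (Y (k + l) v))"
    by (rule conv_window[OF X Y j]) (auto simp: N_def)
  also have "\<dots> = (\<Sum>k\<in>{- N - l - 1..N}. scale s (Y (k + l) (X (- k - 1) v)))"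
    using s v by (simp add: supercommute_def)
  also have "\<dots> = (\<Sum>k\<in>{- N - l - 1..N}. scale s (Y (- k - 1) (X (k + l) v)))"
    by (rule sum.reindex_bij_witness[of _ "\<lambda>k. - k - l - 1" "\<lambda>k. - k - l - 1"]) auto
  also have "\<dots> = scale s (conv Y X l v)"
    unfolding vec_fun.scale_sum_right[symmetric]
    by (subst conv_window[OF Y X j, of "{- N - l - 1..N}"]) (auto simp: N_def)
  finally show ?thesis .
qed

lemma supercommute_conv:
  assumes X: "field t X" and Y: "field u Y" and Z: "field w Z"
    and "supercommute s X Z" "supercommute r Y Z"
  shows "supercommute (s * r) (conv X Y) Z"
  unfolding supercommute_def
proof (intro allI ballI)
  fix k l v assume v: "v \<in> fock U"
  obtain j where j: "v \<in> fock_le U j" "0 \<le> j" using v by (rule fock_exhausted)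
  have "conv X Y k (Z l v) = (\<Sum>h\<in>{- j..j - k}. X (- h - 1) (Y (h + k) (Z l v)))"
    by (rule conv_window[OF X Y field_le[OF Z j(1)] j(2)]) auto
  also have "\<dots> = (\<Sum>h\<in>{- j..j - k}. scale (s * r) (Z l (X (- h - 1) (Y (h + k) v))))"
    using assms(4,5) v
    by (simp add: supercommute_def field_fock[OF X] field_fock[OF Y] field_fock[OF Z] field_scale[OF X] mult.commute)
  also have "\<dots> = scale (s * r) (Z l (conv X Y k v))"
    using v
    by (simp add: conv_window[OF X Y j, of "{- j..j - k}"] field_sum[OF Z] field_fock[OF X] field_fock[OF Y] vec_fun.scale_sum_right)
  finally show "conv X Y k (Z l v) = scale (s * r) (Z l (conv X Y k v))" .
qed

lemma supercommute_conv_right: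
  assumes X: "field t X" and Y: "field u Y" and Z: "field w Z"
    and s: "supercommute s Z X" "supercommute r Z Y" "s * s = 1" "r * r = 1"
  shows "supercommute (s * r) Z (conv X Y)"
  using supercommute_sym[OF supercommute_conv[OF X Y Z supercommute_sym[OF s(1,3)] supercommute_sym[OF s(2,4)]]]
    s(3,4) by (simp add: mult_ac)

lemma conv_sum_left:
  assumes "\<And>a. a \<in> A \<Longrightarrow> field t (X a)" "field u Y" "v \<in> fock U"
  shows "conv (\<lambda>l v. \<Sum>a\<in>A. X a l v) Y l v = (\<Sum>a\<in>A. conv (X a) Y l v)"
proof -
  obtain j where j: "v \<in> fock_le U j" "0 \<le> j" using assms(3) by (rule fock_exhausted)
  have "conv (\<lambda>l v. \<Sum>a\<in>A. X a l v) Y l v = (\<Sum>k\<in>{- j..j - l}. \<Sum>a\<in>A. X a (- k - 1) (Y (k + l) v))"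
    by (rule conv_window[OF field_sum_field[OF assms(1)] assms(2) j]) auto
  also have "\<dots> = (\<Sum>a\<in>A. conv (X a) Y l v)"
    by (subst sum.swap) (use assms j in \<open>simp add: conv_window[of t _ u _ _ j "{- j..j - l}"]\<close>)
  finally show ?thesis .
qed

lemma conv_sum_right:
  assumes "\<And>a. a \<in> A \<Longrightarrow> field t (Y a)" "field u X" "v \<in> fock U"
  shows "conv X (\<lambda>l v. \<Sum>a\<in>A. Y a l v) l v = (\<Sum>a\<in>A. conv X (Y a) l v)"
proof -
  obtain j where j: "v \<in> fock_le U j" "0 \<le> j" using assms(3) by (rule fock_exhausted)
  have "conv X (\<lambda>l v. \<Sum>a\<in>A. Y a l v) l v = (\<Sum>k\<in>{- j..j - l}. X (- k - 1) (\<Sum>a\<in>A. Y a (k + l) v))"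
    by (rule conv_window[OF assms(2) field_sum_field[OF assms(1)] j]) auto
  also have "\<dots> = (\<Sum>k\<in>{- j..j - l}. \<Sum>a\<in>A. X (- k - 1) (Y a (k + l) v))"
    using assms(3) by (simp add: field_sum[OF assms(2)] field_fock[OF assms(1)])
  also have "\<dots> = (\<Sum>a\<in>A. conv X (Y a) l v)"
    by (subst sum.swap) (use assms j in \<open>simp add: conv_window[of u _ t _ _ j "{- j..j - l}"]\<close>)
  finally show ?thesis .
qed

lemma conv_add_right:
  assumes "field t X" "field u Y" "field u Y'" "v \<in> fock U"
  shows "conv X (\<lambda>l v. Y l v + Y' l v) l v = conv X Y l v + conv X Y' l v"
  using conv_sum_right[of UNIV u "\<lambda>b. if b then Y else Y'" t X v l] assms by (simp add: UNIV_bool add.commute)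

lemma conv_scale_left: "conv (\<lambda>l v. scale c (X l v)) Y l v = scale c (conv X Y l v)"
proof (cases "c = 0")
  case True
  then show ?thesis by (simp add: conv_def)
qed (simp add: conv_def vec_fun.scale_sum_right)

lemma conv_scale_right:
  assumes "field t X" "field u Y" "v \<in> fock U"
  shows "conv X (\<lambda>l v. scale c (Y l v)) l v = scale c (conv X Y l v)"
proof (cases "c = 0")
  case True
  then show ?thesis by (simp add: conv_def field_zero[OF assms(1)])
qed (use assms(3) in \<open>simp add: conv_def vec_fun.scale_sum_right field_scale[OF assms(1)] field_fock[OF assms(2)]\<close>)

lemma conv_one_left:
  assumes "field t X" "v \<in> fock U" shows "conv one_field X l v = X l v"
proof -
  have "conv one_field X l v = (\<Sum>k\<in>{0}. one_field (- k - 1) (X (k + l) v))"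
    by (rule conv_eqI) (auto simp: one_field_def)
  then show ?thesis by (simp add: one_field_def)
qed

lemma conv_fun_left:
  assumes "field t X" "v \<in> fock U" shows "conv (fun_field f) X l v = fun_mult f (X l v)"
proof -
  have "conv (fun_field f) X l v = (\<Sum>k\<in>{0}. fun_field f (- k - 1) (X (k + l) v))"
    by (rule conv_eqI) (auto simp: fun_field_def)
  then show ?thesis by (simp add: fun_field_def)
qed

text \<open>
  The commutator of the momentum mode \<open>k\<close> with \<open>X\<close> is, mode by mode, the field \<open>X'\<close> shifted by
  \<open>k\<close>: in terms of operator products, \<open>p(z) X(w)\<close> has the simple pole \<open>X'(w)/(z - w)\<close> and no
  other.
\<close>

definition mom_deriv :: "'n + 'n \<Rightarrow> int \<Rightarrow> 'k \<Rightarrow> ('k, 'n) field_op \<Rightarrow> ('k, 'n) field_op \<Rightarrow> bool"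
  where "mom_deriv a k s X X' \<longleftrightarrow>
    (\<forall>l. \<forall>v\<in>fock U. mom a k (X l v) = scale s (X l (mom a k v)) + X' (k + l) v)"

text \<open>
  The Leibniz rule. Both shifts by \<open>k\<close> are absorbed by moving the summation index of the
  convolution.
\<close>

lemma mom_deriv_conv:
  assumes X: "field t X" and Y: "field u Y" and X': "field t' X'" and Y': "field u' Y'"
    and dX: "mom_deriv a k s X X'" and dY: "mom_deriv a k r Y Y'"
  shows "mom_deriv a k (s * r) (conv X Y) (\<lambda>l v. conv X' Y l v + scale s (conv X Y' l v))"
  unfolding mom_deriv_def
proof (intro allI ballI)
  fix l v assume v: "v \<in> fock U"
  obtain j1 where j1: "v \<in> fock_le U j1" "0 \<le> j1" using v by (rule fock_exhausted)
  obtain j2 where j2: "mom a k v \<in> fock_le U j2" "0 \<le> j2" using mom_fock[OF v] by (rule fock_exhausted)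
  define j where "j = max j1 j2"
  have j: "v \<in> fock_le U j" "mom a k v \<in> fock_le U j" "0 \<le> j"
    using j1 j2 by (auto simp: j_def elim!: fock_le_mono)
  define N where "N = j + \<bar>l\<bar> + 2 * \<bar>k\<bar>"
  have "mom a k (conv X Y l v) = (\<Sum>h\<in>{-N..N}. mom a k (X (- h - 1) (Y (h + l) v)))"
    by (subst conv_window[OF X Y j(1,3), of "{-N..N}"])
      (auto simp: N_def intro!: mom_sum field_fock[OF X] field_fock[OF Y] v)
  also have "\<dots> = (\<Sum>h\<in>{-N..N}. scale (s * r) (X (- h - 1) (Y (h + l) (mom a k v)))
      + scale s (X (- h - 1) (Y' (h + (k + l)) v)) + X' (k - h - 1) (Y (h + l) v))"
  proof (rule sum.cong[OF refl])
    fix h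
    have "mom a k (X (- h - 1) (Y (h + l) v))
      = scale s (X (- h - 1) (mom a k (Y (h + l) v))) + X' (k + (- h - 1)) (Y (h + l) v)"
      using dX by (simp add: mom_deriv_def field_fock[OF Y v])
    also have "mom a k (Y (h + l) v) = scale r (Y (h + l) (mom a k v)) + Y' (k + (h + l)) v"
      using dY v by (simp add: mom_deriv_def)
    finally show "mom a k (X (- h - 1) (Y (h + l) v)) = scale (s * r) (X (- h - 1) (Y (h + l) (mom a k v)))
      + scale s (X (- h - 1) (Y' (h + (k + l)) v)) + X' (k - h - 1) (Y (h + l) v)"
    proof -
      assume e: "mom a k (X (- h - 1) (Y (h + l) v)) =
        scale s (X (- h - 1) (scale r (Y (h + l) (mom a k v)) + Y' (k + (h + l)) v)) +
        X' (k + (- h - 1)) (Y (h + l) v)"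
      have "k + (- h - 1) = k - h - 1" "k + (h + l) = h + (k + l)" by simp_all
      with e show ?thesis using v
        by (simp only: field_add[OF X] field_scale[OF X] field_fock[OF Y] field_fock[OF Y'] fock_scale
            mom_fock vec_fun.scale_right_distrib vec_fun.scale_scale)
    qed
  qed
  also have "\<dots> = scale (s * r) (conv X Y l (mom a k v)) + scale s (conv X Y' (k + l) v)
      + (\<Sum>h\<in>{-N..N}. X' (k - h - 1) (Y (h + l) v))"
    by (subst conv_window[OF X Y j(2,3), of "{-N..N}"], simp, force simp: N_def,
        subst conv_window[OF X Y' j(1,3), of "{-N..N}"], simp, force simp: N_def)
      (simp add: sum.distrib vec_fun.scale_sum_right)
  also have "(\<Sum>h\<in>{-N..N}. X' (k - h - 1) (Y (h + l) v)) = (\<Sum>h\<in>{-N-k..N-k}. X' (- h - 1) (Y (h + (k + l)) v))"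
    by (rule sum.reindex_bij_witness[of _ "\<lambda>h. h + k" "\<lambda>h. h - k"]) (auto simp: algebra_simps)
  also have "\<dots> = conv X' Y (k + l) v"
    by (rule conv_window[OF X' Y j(1,3), symmetric]) (auto simp: N_def)
  finally show "mom a k (conv X Y l v) =
      scale (s * r) (conv X Y l (mom a k v)) + (conv X' Y (k + l) v + scale s (conv X Y' (k + l) v))"
    by (simp only: add_ac)
qed

end

section \<open>Functions of the even coordinate fields\<close>

(* from here on vectors are combined by the vector space laws, not coefficient by coefficient *)
declare scale_apply [simp del]

context bcbg
begin

lemma supercommute_sum_right:
  assumes Z: "field t Z" and X: "\<And>a. a \<in> A \<Longrightarrow> field u (X a)" "\<And>a. a \<in> A \<Longrightarrow> supercommute s Z (X a)"
  shows "supercommute s Z (\<lambda>l v. \<Sum>a\<in>A. X a l v)"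
  unfolding supercommute_def
proof (intro allI ballI)
  fix k l v assume v: "v \<in> fock U"
  have "Z k (\<Sum>a\<in>A. X a l v) = (\<Sum>a\<in>A. Z k (X a l v))"
    by (rule field_sum[OF Z]) (rule field_fock[OF X(1) v])
  also have "\<dots> = (\<Sum>a\<in>A. scale s (X a l (Z k v)))"
    by (rule sum.cong[OF refl]) (rule supercommuteD[OF X(2) v])
  finally show "Z k (\<Sum>a\<in>A. X a l v) = scale s (\<Sum>a\<in>A. X a l (Z k v))"
    by (simp add: vec_fun.scale_sum_right)
qed

lemma supercommute_scale_right:
  assumes Z: "field t Z" and X: "field u X" "supercommute s Z X"
  shows "supercommute s Z (\<lambda>l v. scale c (X l v))"
  unfolding supercommute_def using X(2)
  by (simp add: supercommute_def field_scale[OF Z] field_fock[OF X(1)] vec_fun.scale_left_commute)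

lemma mom_deriv_sum:
  assumes "\<And>x. x \<in> A \<Longrightarrow> field t (X x)" "\<And>x. x \<in> A \<Longrightarrow> mom_deriv a k s (X x) (X' x)"
  shows "mom_deriv a k s (\<lambda>l v. \<Sum>x\<in>A. X x l v) (\<lambda>l v. \<Sum>x\<in>A. X' x l v)"
  unfolding mom_deriv_def
proof (intro allI ballI)
  fix l v assume v: "v \<in> fock U"
  have "mom a k (\<Sum>x\<in>A. X x l v) = (\<Sum>x\<in>A. mom a k (X x l v))"
    by (rule mom_sum) (rule field_fock[OF assms(1) v])
  also have "\<dots> = (\<Sum>x\<in>A. scale s (X x l (mom a k v)) + X' x (k + l) v)"
    using assms(2) v by (simp add: mom_deriv_def)
  finally show "mom a k (\<Sum>x\<in>A. X x l v) = scale s (\<Sum>x\<in>A. X x l (mom a k v)) + (\<Sum>x\<in>A. X' x (k + l) v)"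
    by (simp add: sum.distrib vec_fun.scale_sum_right)
qed

lemma mom_deriv_scale:
  assumes "field t X" "mom_deriv a k s X X'"
  shows "mom_deriv a k s (\<lambda>l v. scale c (X l v)) (\<lambda>l v. scale c (X' l v))"
  using assms
  by (simp add: mom_deriv_def mom_scale field_fock[OF assms(1)] vec_fun.scale_right_distrib vec_fun.scale_left_commute)

lemma mom_deriv_coord:
  "mom_deriv a k (swap_sign (parity a) (parity b)) (coord b)
     (\<lambda>l v. if a = b \<and> (parity a \<or> k \<noteq> 0) then scale hbar (one_field l v) else 0)"
  by (auto simp: mom_deriv_def mom_coord one_field_def)

lemma mom_deriv_cong:
  assumes "mom_deriv a k s X X'" "\<And>l v. v \<in> fock U \<Longrightarrow> X' l v = X'' l v"
  shows "mom_deriv a k s X X''"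
  using assms by (simp add: mom_deriv_def)

lemma supercommute_coord: "supercommute (swap_sign (parity a) (parity b)) (coord a) (coord b)"
  unfolding supercommute_def by (intro allI ballI coord_coord)

lemma swap_sign_simps [simp]:
  "swap_sign False p = 1" "swap_sign p False = 1" "swap_sign True True = - 1"
  "swap_sign p q * swap_sign p q = 1"
  by (simp_all add: swap_sign_def)

lemma coord_zero [simp]: "coord a m 0 = 0"
  using field_zero[OF field_coord] .

lemma supercommute_coord_fun: "supercommute 1 (coord a) (fun_field f)"
  by (simp add: supercommute_def fun_field_def fun_mult_coord)

lemma supercommute_fun_fun: "supercommute 1 (fun_field f) (fun_field g)"
  by (auto simp: supercommute_def fun_field_def elementary_zero) (auto simp: fun_mult_def fun_eq_iff)

text \<open>
  The homogeneous part of degree \<open>r\<close>, including the factor \<open>1/r!\<close>, of the expansion of \<open>f(\<gamma>)\<close> in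
  the fields \<open>\<gamma>\<^sup>i - x\<^sub>i\<close>.
\<close>

primrec taylor :: "nat \<Rightarrow> (('k, 'n) vec \<Rightarrow> 'k) \<Rightarrow> ('k, 'n) field_op"
  where "taylor 0 f = fun_field f"
  | "taylor (Suc r) f = (\<lambda>l v. scale (1 / of_nat (Suc r))
       (\<Sum>i\<in>UNIV. conv (coord (Inl i)) (taylor r (partial_deriv U i f)) l v))"

lemma field_taylor: "f \<in> smooth_ring U \<Longrightarrow> field (int r) (taylor r f)"
proof (induction r arbitrary: f)
  case 0
  then show ?case by (simp add: field_fun_field)
next
  case (Suc r)
  have "field (1 + int r) (conv (coord (Inl i)) (taylor r (partial_deriv U i f)))" for i
    using Suc by (intro field_conv field_coord_even) (auto intro: smooth_partial_deriv[OF open_U])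
  then have "field (1 + int r) (taylor (Suc r) f)"
    unfolding taylor.simps by (intro field_scaled field_sum_field)
  moreover have "int (Suc r) = 1 + int r" by simp
  ultimately show ?case by (simp only:)
qed

lemma field_taylor_0: "f \<in> smooth_ring U \<Longrightarrow> field 0 (taylor r f)"
  using field_mono[OF field_taylor] by simp

lemma supercommute_taylor:
  assumes Z: "field t Z" "\<And>i. supercommute 1 Z (coord (Inl i))" "\<And>g. g \<in> smooth_ring U \<Longrightarrow> supercommute 1 Z (fun_field g)"
    and f: "f \<in> smooth_ring U"
  shows "supercommute 1 Z (taylor r f)"
  using f
proof (induction r arbitrary: f)
  case (Suc r)
  have p: "partial_deriv U i f \<in> smooth_ring U" for i by (rule smooth_partial_deriv[OF open_U Suc.prems])
  have "supercommute (1 * 1) Z (conv (coord (Inl i)) (taylor r (partial_deriv U i f)))" for i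
    by (rule supercommute_conv_right[OF field_coord field_taylor_0[OF p] Z(1,2) Suc.IH[OF p]]) simp_all
  moreover have "field 0 (conv (coord (Inl i)) (taylor r (partial_deriv U i f)))" for i
    by (rule field_conv_0[OF field_coord field_taylor_0[OF p]])
  ultimately show ?case unfolding taylor.simps
    by (intro supercommute_scale_right[OF Z(1) field_sum_field] supercommute_sum_right[OF Z(1)]) auto
qed (simp add: Z)

lemma supercommute_coord_taylor: "f \<in> smooth_ring U \<Longrightarrow> supercommute 1 (coord a) (taylor r f)"
  using supercommute_taylor[OF field_coord _ supercommute_coord_fun] supercommute_coord[of a "Inl _"]
  by simp

lemma supercommute_taylor_coord: "f \<in> smooth_ring U \<Longrightarrow> supercommute 1 (taylor r f) (coord a)"
  by (rule supercommute_sym[OF supercommute_coord_taylor]) simp_all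

lemma supercommute_taylor_taylor:
  assumes "f \<in> smooth_ring U" "g \<in> smooth_ring U"
  shows "supercommute 1 (taylor r f) (taylor s g)"
proof (rule supercommute_taylor[OF field_taylor])
  show "supercommute 1 (taylor r f) (fun_field h)" if "h \<in> smooth_ring U" for h
  proof (rule supercommute_sym)
    show "supercommute 1 (fun_field h) (taylor r f)"
      by (rule supercommute_taylor[OF field_fun_field[OF that] _ supercommute_fun_fun assms(1)])
        (rule supercommute_sym[OF supercommute_coord_fun], simp)
  qed simp
qed (use assms in \<open>auto intro: supercommute_taylor_coord\<close>)

lemma taylor_add:
  assumes "f \<in> smooth_ring U" "g \<in> smooth_ring U" "v \<in> fock U"
  shows "taylor r (\<lambda>x. f x + g x) l v = taylor r f l v + taylor r g l v"
  using assms
proof (induction r arbitrary: f g l v)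
  case 0
  then show ?case by (auto simp: fun_field_def fun_mult_def scale_apply fun_eq_iff algebra_simps)
next
  case (Suc r)
  note p = smooth_partial_deriv[OF open_U Suc.prems(1)] smooth_partial_deriv[OF open_U Suc.prems(2)]
  have "conv (coord (Inl i)) (taylor r (partial_deriv U i (\<lambda>x. f x + g x))) l v
    = conv (coord (Inl i)) (taylor r (partial_deriv U i f)) l v
    + conv (coord (Inl i)) (taylor r (partial_deriv U i g)) l v" for i
  proof -
    have "conv (coord (Inl i)) (taylor r (partial_deriv U i (\<lambda>x. f x + g x))) l v
      = conv (coord (Inl i)) (\<lambda>l v. taylor r (partial_deriv U i f) l v + taylor r (partial_deriv U i g) l v) l v"
      unfolding partial_deriv_add[OF open_U Suc.prems(1,2)]
      by (rule conv_cong[OF _ _ field_plus Suc.prems(3)]) (rule Suc.IH[OF p] refl field_taylor_0 p, assumption?)+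
    then show ?thesis
      using conv_add_right[OF field_coord field_taylor_0[OF p(1)] field_taylor_0[OF p(2)] Suc.prems(3)] by simp
  qed
  then show ?case by (simp add: sum.distrib vec_fun.scale_right_distrib)
qed

lemma taylor_cmult:
  assumes "f \<in> smooth_ring U" "v \<in> fock U"
  shows "taylor r (\<lambda>x. c * f x) l v = scale c (taylor r f l v)"
  using assms
proof (induction r arbitrary: f l v)
  case 0
  then show ?case by (auto simp: fun_field_def fun_mult_def scale_apply fun_eq_iff algebra_simps)
next
  case (Suc r)
  note p = smooth_partial_deriv[OF open_U Suc.prems(1)]
  have "conv (coord (Inl i)) (taylor r (partial_deriv U i (\<lambda>x. c * f x))) l v
    = scale c (conv (coord (Inl i)) (taylor r (partial_deriv U i f)) l v)" for i
  proof -
    have "conv (coord (Inl i)) (taylor r (partial_deriv U i (\<lambda>x. c * f x))) l v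
      = conv (coord (Inl i)) (\<lambda>l v. scale c (taylor r (partial_deriv U i f) l v)) l v"
      unfolding partial_deriv_cmult[OF open_U Suc.prems(1)]
      by (rule conv_cong[OF _ _ field_scaled Suc.prems(2)]) (rule Suc.IH[OF p] refl field_taylor_0 p, assumption?)+
    then show ?thesis
      using conv_scale_right[OF field_coord field_taylor_0[OF p] Suc.prems(2)] by simp
  qed
  then show ?case by (simp add: vec_fun.scale_sum_right[symmetric] vec_fun.scale_left_commute)
qed

lemma conv_left_commute:
  assumes X: "field t X" and Y: "field u Y" and Z: "field w Z" and s: "supercommute s X Y" and v: "v \<in> fock U"
  shows "conv X (conv Y Z) l v = scale s (conv Y (conv X Z) l v)"
proof -
  have "conv X (conv Y Z) l v = conv (conv X Y) Z l v"
    by (rule conv_assoc[OF X Y Z v, symmetric])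
  also have "\<dots> = conv (\<lambda>l v. scale s (conv Y X l v)) Z l v"
    by (rule conv_cong[OF _ _ Z v]) (rule conv_commute[OF X Y s], simp_all)
  also have "\<dots> = scale s (conv Y (conv X Z) l v)"
    by (simp only: conv_scale_left conv_assoc[OF Y X Z v])
  finally show ?thesis .
qed

text \<open>
  The degree \<open>r\<close> part of a product is a Cauchy product. In the induction step the product rule
  yields the term with \<open>s\<close> factors taken from \<open>f\<close> and \<open>Suc r - s\<close> from \<open>g\<close> with multiplicity
  \<open>s + (Suc r - s) = Suc r\<close>, which is what the factor \<open>1 / Suc r\<close> in the recursion removes.
\<close>

lemma taylor_mult:
  assumes "f \<in> smooth_ring U" "g \<in> smooth_ring U" "v \<in> fock U"
  shows "taylor r (\<lambda>x. f x * g x) l v = (\<Sum>s\<le>r. conv (taylor s f) (taylor (r - s) g) l v)"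
  using assms
proof (induction r arbitrary: f g l v)
  case 0
  then show ?case
    by (simp add: conv_fun_left[OF field_fun_field]) (auto simp: fun_field_def fun_mult_def scale_apply fun_eq_iff)
next
  case (Suc r)
  note f = Suc.prems(1) and g = Suc.prems(2) and v = Suc.prems(3)
  have pf: "partial_deriv U i f \<in> smooth_ring U" and pg: "partial_deriv U i g \<in> smooth_ring U" for i
    by (rule smooth_partial_deriv[OF open_U f], rule smooth_partial_deriv[OF open_U g])
  have fm: "(\<lambda>x. partial_deriv U i f x * g x) \<in> smooth_ring U" "(\<lambda>x. f x * partial_deriv U i g x) \<in> smooth_ring U" for i
    by (intro smooth_ring.mult pf pg f g)+
  note fl = field_taylor_0[OF f] field_taylor_0[OF g] field_taylor_0[OF pf] field_taylor_0[OF pg]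
  define A where "A s = conv (taylor s f) (taylor (Suc r - s) g) l v" for s
  have step: "conv (coord (Inl i)) (taylor r (partial_deriv U i (\<lambda>x. f x * g x))) l v
    = (\<Sum>s\<le>r. conv (conv (coord (Inl i)) (taylor s (partial_deriv U i f))) (taylor (r - s) g) l v)
    + (\<Sum>s\<le>r. conv (taylor s f) (conv (coord (Inl i)) (taylor (r - s) (partial_deriv U i g))) l v)" for i
  proof -
    have "conv (coord (Inl i)) (taylor r (partial_deriv U i (\<lambda>x. f x * g x))) l v
      = conv (coord (Inl i)) (\<lambda>l v. (\<Sum>s\<le>r. conv (taylor s (partial_deriv U i f)) (taylor (r - s) g) l v)
        + (\<Sum>s\<le>r. conv (taylor s f) (taylor (r - s) (partial_deriv U i g)) l v)) l v"
    proof (rule conv_cong[where t = 0])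
      show "taylor r (partial_deriv U i (\<lambda>x. f x * g x)) l v =
        (\<Sum>s\<le>r. conv (taylor s (partial_deriv U i f)) (taylor (r - s) g) l v)
        + (\<Sum>s\<le>r. conv (taylor s f) (taylor (r - s) (partial_deriv U i g)) l v)" if "v \<in> fock U" for l v
        using that by (simp add: partial_deriv_mult[OF open_U f g] taylor_add[OF fm]
            Suc.IH[OF pf g] Suc.IH[OF f pg])
    qed (intro field_plus field_sum_field field_conv_0 fl v refl)+
    also have "\<dots> = (\<Sum>s\<le>r. conv (coord (Inl i)) (conv (taylor s (partial_deriv U i f)) (taylor (r - s) g)) l v)
      + (\<Sum>s\<le>r. conv (coord (Inl i)) (conv (taylor s f) (taylor (r - s) (partial_deriv U i g))) l v)"
      by (subst conv_add_right[OF field_coord _ _ v, where u = 0], (intro field_sum_field field_conv_0 fl)+,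
          subst conv_sum_right[OF _ field_coord v, where t = 0], (intro field_conv_0 fl)+,
          subst conv_sum_right[OF _ field_coord v, where t = 0], (intro field_conv_0 fl)+) simp
    also have "\<dots> = (\<Sum>s\<le>r. conv (conv (coord (Inl i)) (taylor s (partial_deriv U i f))) (taylor (r - s) g) l v)
      + (\<Sum>s\<le>r. conv (taylor s f) (conv (coord (Inl i)) (taylor (r - s) (partial_deriv U i g))) l v)"
      by (simp only: conv_assoc[OF field_coord fl(3) fl(2) v]
          conv_left_commute[OF field_coord fl(1) fl(4) supercommute_coord_taylor[OF f] v] vec_fun.scale_one)
    finally show ?thesis .
  qed
  have cf: "field 0 (conv (coord (Inl i)) (taylor s (partial_deriv U i f)))"
    "field 0 (conv (coord (Inl i)) (taylor s (partial_deriv U i g)))" for i s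
    by (intro field_conv_0 field_coord fl)+
  have left: "(\<Sum>i\<in>UNIV. conv (conv (coord (Inl i)) (taylor s (partial_deriv U i f))) (taylor (r - s) g) l v)
    = scale (of_nat (Suc s)) (A (Suc s))" for s
  proof -
    have "A (Suc s) = scale (1 / of_nat (Suc s))
       (conv (\<lambda>l v. \<Sum>i\<in>UNIV. conv (coord (Inl i)) (taylor s (partial_deriv U i f)) l v) (taylor (r - s) g) l v)"
      unfolding A_def taylor.simps by (subst conv_scale_left) simp
    then show ?thesis
      by (subst (asm) conv_sum_left[OF cf(1) fl(2) v]) (simp del: of_nat_Suc)
  qed
  have right: "(\<Sum>i\<in>UNIV. conv (taylor s f) (conv (coord (Inl i)) (taylor (r - s) (partial_deriv U i g))) l v)
    = scale (of_nat (Suc r - s)) (A s)" if "s \<le> r" for s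
  proof -
    have e: "Suc r - s = Suc (r - s)" using that by simp
    have "A s = scale (1 / of_nat (Suc (r - s)))
       (conv (taylor s f) (\<lambda>l v. \<Sum>i\<in>UNIV. conv (coord (Inl i)) (taylor (r - s) (partial_deriv U i g)) l v) l v)"
      unfolding A_def e taylor.simps
      by (rule conv_scale_right[OF fl(1) field_sum_field[OF cf(2)] v])
    then show ?thesis unfolding e
      by (subst (asm) conv_sum_right[OF cf(2) fl(1) v]) (simp del: of_nat_Suc)
  qed
  have "(\<Sum>i\<in>UNIV. conv (coord (Inl i)) (taylor r (partial_deriv U i (\<lambda>x. f x * g x))) l v)
    = (\<Sum>s\<le>r. scale (of_nat (Suc s)) (A (Suc s))) + (\<Sum>s\<le>r. scale (of_nat (Suc r - s)) (A s))"
    unfolding step sum.distrib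
    by (subst (1 2) sum.swap) (intro arg_cong2[where f = "(+)"] sum.cong refl left right, simp)
  also have "(\<Sum>s\<le>r. scale (of_nat (Suc s)) (A (Suc s))) = (\<Sum>s\<le>Suc r. scale (of_nat s) (A s))"
    by (simp add: sum.atMost_Suc_shift del: sum.atMost_Suc of_nat_Suc)
  also have "(\<Sum>s\<le>r. scale (of_nat (Suc r - s)) (A s)) = (\<Sum>s\<le>Suc r. scale (of_nat (Suc r - s)) (A s))"
    by simp
  also have "(\<Sum>s\<le>Suc r. scale (of_nat s) (A s)) + (\<Sum>s\<le>Suc r. scale (of_nat (Suc r - s)) (A s))
    = (\<Sum>s\<le>Suc r. scale (of_nat (Suc r)) (A s))"
    unfolding sum.distrib[symmetric] vec_fun.scale_left_distrib[symmetric] of_nat_add[symmetric]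
    by (rule sum.cong) auto
  finally show ?case
    by (simp add: A_def vec_fun.scale_sum_right[symmetric] del: of_nat_Suc sum.atMost_Suc)
qed

text \<open>
  Modes of the field \<open>f(\<gamma>)\<close>.
\<close>

definition func :: "(('k, 'n) vec \<Rightarrow> 'k) \<Rightarrow> ('k, 'n) field_op"
  where "func f l v = (\<Sum>r\<in>{r. taylor r f l v \<noteq> 0}. taylor r f l v)"

lemma taylor_vanish:
  assumes "f \<in> smooth_ring U" "v \<in> fock_le U j" "j - l - 1 < int r"
  shows "taylor r f l v = 0"
  using fock_le_negative[OF field_order[OF field_taylor[OF assms(1)] assms(2)], of l r] assms(3) by simp

lemma func_window:
  assumes "f \<in> smooth_ring U" "v \<in> fock_le U j" "j - l - 1 \<le> int N"
  shows "func f l v = (\<Sum>r\<le>N. taylor r f l v)"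
  unfolding func_def
proof (rule sum.mono_neutral_left)
  show "{r. taylor r f l v \<noteq> 0} \<subseteq> {..N}"
    using taylor_vanish[OF assms(1,2)] assms(3) by (force simp: not_le)
qed auto

lemma field_func:
  assumes f: "f \<in> smooth_ring U" shows "field 0 (func f)"
proof (rule field_0I)
  fix l v w assume v: "v \<in> fock U" and w: "w \<in> fock U"
  obtain j1 where j1: "v \<in> fock_le U j1" "0 \<le> j1" using v by (rule fock_exhausted)
  obtain j2 where j2: "w \<in> fock_le U j2" "0 \<le> j2" using w by (rule fock_exhausted)
  define j where "j = max j1 j2"
  define N where "N = nat (j - l - 1)"
  have j: "v \<in> fock_le U j" "w \<in> fock_le U j" "v + w \<in> fock_le U j"
    using j1 j2 by (auto simp: j_def elim!: fock_le_mono intro!: fock_le_add)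
  have N: "j - l - 1 \<le> int N" by (simp add: N_def)
  show "func f l (v + w) = func f l v + func f l w"
    unfolding func_window[OF f j(1) N] func_window[OF f j(2) N] func_window[OF f j(3) N] sum.distrib[symmetric]
    by (rule sum.cong[OF refl]) (rule field_add[OF field_taylor[OF f] v w])
next
  fix l c v assume v: "v \<in> fock U"
  obtain j where j: "v \<in> fock_le U j" "0 \<le> j" using v by (rule fock_exhausted)
  define N where "N = nat (j - l - 1)"
  have N: "j - l - 1 \<le> int N" by (simp add: N_def)
  show "func f l (scale c v) = scale c (func f l v)"
    unfolding func_window[OF f j(1) N] func_window[OF f fock_le_scale[OF j(1)] N] vec_fun.scale_sum_right
    by (rule sum.cong[OF refl]) (rule field_scale[OF field_taylor[OF f] v])
next
  fix j l v assume v: "v \<in> fock_le U j"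
  show "func f l v \<in> fock_le U j" unfolding func_def
    by (rule fock_le_sum) (rule field_le[OF field_taylor[OF f] v])
  show "func f l v \<in> fock_le U (j - 2 * l - 2)" unfolding func_def
    by (rule fock_le_sum) (rule field_lower[OF field_taylor[OF f] v])
qed

lemma supercommute_func:
  assumes Z: "field t Z" and s: "\<And>r. supercommute 1 Z (taylor r f)" and f: "f \<in> smooth_ring U"
  shows "supercommute 1 Z (func f)"
  unfolding supercommute_def
proof (intro allI ballI)
  fix k l v assume v: "v \<in> fock U"
  obtain j where j: "v \<in> fock_le U j" "0 \<le> j" using v by (rule fock_exhausted)
  define N where "N = nat (j - l - 1)"
  have N: "j - l - 1 \<le> int N" by (simp add: N_def)
  have "Z k (func f l v) = (\<Sum>r\<le>N. Z k (taylor r f l v))"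
    unfolding func_window[OF f j(1) N] by (rule field_sum[OF Z]) (rule field_fock[OF field_taylor[OF f] v])
  also have "\<dots> = (\<Sum>r\<le>N. scale 1 (taylor r f l (Z k v)))"
    by (rule sum.cong[OF refl]) (rule supercommuteD[OF s v])
  also have "\<dots> = scale 1 (func f l (Z k v))"
    unfolding func_window[OF f field_le[OF Z j(1)] N] by (simp add: vec_fun.scale_sum_right)
  finally show "Z k (func f l v) = scale 1 (func f l (Z k v))" .
qed

lemma supercommute_coord_func: "f \<in> smooth_ring U \<Longrightarrow> supercommute 1 (coord a) (func f)"
  by (rule supercommute_func[OF field_coord supercommute_coord_taylor])

lemma supercommute_func_func:
  assumes "f \<in> smooth_ring U" "g \<in> smooth_ring U"
  shows "supercommute 1 (func f) (func g)"
proof (rule supercommute_func[OF field_func[OF assms(1)] _ assms(2)])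
  show "supercommute 1 (func f) (taylor r g)" for r
    by (rule supercommute_sym[OF supercommute_func[OF field_taylor[OF assms(2)]
          supercommute_taylor_taylor[OF assms(2,1)] assms(1)]]) simp
qed

lemma func_add:
  assumes f: "f \<in> smooth_ring U" and g: "g \<in> smooth_ring U" and v: "v \<in> fock U"
  shows "func (\<lambda>x. f x + g x) l v = func f l v + func g l v"
proof -
  obtain j where j: "v \<in> fock_le U j" "0 \<le> j" using v by (rule fock_exhausted)
  define N where "N = nat (j - l - 1)"
  have N: "j - l - 1 \<le> int N" by (simp add: N_def)
  show ?thesis
    unfolding func_window[OF f j(1) N] func_window[OF g j(1) N]
      func_window[OF smooth_ring.add[OF f g] j(1) N] sum.distrib[symmetric]
    by (rule sum.cong[OF refl]) (rule taylor_add[OF f g v])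
qed

lemma func_cmult:
  assumes f: "f \<in> smooth_ring U" and v: "v \<in> fock U"
  shows "func (\<lambda>x. c * f x) l v = scale c (func f l v)"
proof -
  obtain j where j: "v \<in> fock_le U j" "0 \<le> j" using v by (rule fock_exhausted)
  define N where "N = nat (j - l - 1)"
  have N: "j - l - 1 \<le> int N" by (simp add: N_def)
  show ?thesis
    unfolding func_window[OF f j(1) N] func_window[OF smooth_ring.scale[OF f] j(1) N] vec_fun.scale_sum_right
    by (rule sum.cong[OF refl]) (rule taylor_cmult[OF f v])
qed

text \<open>
  Multiplicativity of \<open>f \<mapsto> f(\<gamma>)\<close>: with all sums cut off at a common large order this is
  \<open>taylor_mult\<close> summed over the order.
\<close>

lemma func_mult:
  assumes f: "f \<in> smooth_ring U" and g: "g \<in> smooth_ring U" and v: "v \<in> fock U"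
  shows "func (\<lambda>x. f x * g x) l v = conv (func f) (func g) l v"
proof -
  obtain j where j: "v \<in> fock_le U j" "0 \<le> j" using v by (rule fock_exhausted)
  (* N bounds the Taylor degrees that matter for all the modes - k - 1 and k + l with k in K *)
  define N where "N = nat (3 * j + 2 * \<bar>l\<bar>)"
  define K where "K = {- j..j - l}"
  have N: "j - l - 1 \<le> int N" using j by (simp add: N_def)
  note tf = field_taylor_0[OF f] and tg = field_taylor_0[OF g]
  have "func (\<lambda>x. f x * g x) l v = (\<Sum>n\<le>N. \<Sum>s\<le>n. conv (taylor s f) (taylor (n - s) g) l v)"
    unfolding func_window[OF smooth_ring.mult[OF f g] j(1) N]
    by (rule sum.cong[OF refl]) (rule taylor_mult[OF f g v])
  also have "\<dots> = (\<Sum>(s, r)\<in>{(s, r). s + r \<le> N}. conv (taylor s f) (taylor r g) l v)"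
    by (rule sum.triangle_reindex_eq[symmetric])
  also have "\<dots> = (\<Sum>(s, r)\<in>{..N} \<times> {..N}. conv (taylor s f) (taylor r g) l v)"
  proof (rule sum.mono_neutral_left)
    have "conv (taylor s f) (taylor r g) l v = 0" if "\<not> s + r \<le> N" for s r
      using fock_le_negative[OF field_order[OF field_conv[OF field_taylor[OF f] field_taylor[OF g]] j(1)], of l s r] N that
      by simp
    then show "\<forall>p\<in>{..N} \<times> {..N} - {(s, r). s + r \<le> N}.
        (case p of (s, r) \<Rightarrow> conv (taylor s f) (taylor r g) l v) = 0"
      by auto
  qed auto
  also have "\<dots> = (\<Sum>s\<le>N. \<Sum>r\<le>N. \<Sum>k\<in>K. taylor s f (- k - 1) (taylor r g (k + l) v))"
    unfolding sum.cartesian_product[symmetric] K_def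
    by (intro sum.cong refl conv_window[OF tf tg j]) auto
  also have "\<dots> = (\<Sum>s\<le>N. \<Sum>k\<in>K. \<Sum>r\<le>N. taylor s f (- k - 1) (taylor r g (k + l) v))"
    by (rule sum.cong[OF refl]) (rule sum.swap)
  also have "\<dots> = (\<Sum>k\<in>K. \<Sum>s\<le>N. \<Sum>r\<le>N. taylor s f (- k - 1) (taylor r g (k + l) v))"
    by (rule sum.swap)
  also have "\<dots> = (\<Sum>k\<in>K. func f (- k - 1) (func g (k + l) v))"
  proof (rule sum.cong[OF refl])
    fix k assume "k \<in> K"
    then have Nk: "j - (k + l) - 1 \<le> int N" "j - (- k - 1) - 1 \<le> int N" using j by (auto simp: K_def N_def)
    have gk: "func g (k + l) v = (\<Sum>r\<le>N. taylor r g (k + l) v)" by (rule func_window[OF g j(1) Nk(1)])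
    have "func f (- k - 1) (func g (k + l) v) = (\<Sum>s\<le>N. taylor s f (- k - 1) (func g (k + l) v))"
      by (rule func_window[OF f field_le[OF field_func[OF g] j(1)] Nk(2)])
    also have "\<dots> = (\<Sum>s\<le>N. \<Sum>r\<le>N. taylor s f (- k - 1) (taylor r g (k + l) v))"
      unfolding gk by (rule sum.cong[OF refl], rule field_sum[OF tf], rule field_fock[OF tg v])
    finally show "(\<Sum>s\<le>N. \<Sum>r\<le>N. taylor s f (- k - 1) (taylor r g (k + l) v))
      = func f (- k - 1) (func g (k + l) v)" by simp
  qed
  also have "\<dots> = conv (func f) (func g) l v"
    unfolding K_def by (rule conv_window[OF field_func[OF f] field_func[OF g] j, symmetric]) auto
  finally show ?thesis .
qed

lemma field_if: "field t X \<Longrightarrow> field t (\<lambda>l v. if B then X l v else 0)"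
  by (cases B) (simp_all only: if_True if_False field_zero_field)

lemma conv_zero_left: "conv (\<lambda>l v. 0) X l v = 0"
  by (simp add: conv_def)

lemma conv_if: "conv (\<lambda>l v. if B then X l v else 0) Y l v = (if B then conv X Y l v else 0)"
  by (cases B) (simp_all only: if_True if_False conv_zero_left)

lemma conv_zero_right: "field t X \<Longrightarrow> conv X (\<lambda>l v. 0) l v = 0"
  by (simp add: conv_def field_zero)

lemma mom_deriv_taylor_odd:
  "f \<in> smooth_ring U \<Longrightarrow> mom_deriv (Inr i) k 1 (taylor r f) (\<lambda>l v. 0)"
proof (induction r arbitrary: f)
  case 0
  then show ?case by (auto simp: mom_deriv_def fun_field_def mom_fun_mult fun_eq_iff)
next
  case (Suc r)
  note p = smooth_partial_deriv[OF open_U Suc.prems]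
  have "mom_deriv (Inr i) k 1 (conv (coord (Inl j)) (taylor r (partial_deriv U j f))) (\<lambda>l v. 0)" for j
  proof -
    have "mom_deriv (Inr i) k 1 (coord (Inl j)) (\<lambda>l v. 0)"
      using mom_deriv_coord[of "Inr i" k "Inl j"] by simp
    from mom_deriv_conv[OF field_coord field_taylor[OF p] field_zero_field field_zero_field this Suc.IH[OF p]]
    show ?thesis
      unfolding mult_1 conv_zero_left conv_zero_right[OF field_coord] vec_fun.scale_zero_right add_0_left .
  qed
  then have "mom_deriv (Inr i) k 1 (taylor (Suc r) f)
      (\<lambda>l v. scale (1 / of_nat (Suc r)) (\<Sum>j\<in>(UNIV :: 'n set). 0))"
    unfolding taylor.simps
    by (intro mom_deriv_scale[OF field_sum_field, where t = 0] mom_deriv_sum[where t = 0]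
        field_conv_0 field_coord field_taylor_0[OF p])
  then show ?case
    by (rule mom_deriv_cong) (simp only: sum.neutral_const vec_fun.scale_zero_right)
qed

text \<open>
  The part of \<open>(\<partial>\<^sub>if)(\<gamma>)\<close> produced by the momentum mode \<open>k\<close> from the degree \<open>r\<close> part of \<open>f(\<gamma>)\<close>.
  The zero mode differentiates the coefficients and preserves the degree; every other mode
  contracts one factor \<open>\<gamma>\<^sup>i - x\<^sub>i\<close> and lowers the degree by one.
\<close>

definition taylor_deriv :: "int \<Rightarrow> 'n \<Rightarrow> nat \<Rightarrow> (('k, 'n) vec \<Rightarrow> 'k) \<Rightarrow> ('k, 'n) field_op"
  where "taylor_deriv k i r f = (if k = 0 then taylor r (partial_deriv U i f)
     else case r of 0 \<Rightarrow> (\<lambda>l v. 0) | Suc r' \<Rightarrow> taylor r' (partial_deriv U i f))"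

lemma field_taylor_deriv: "f \<in> smooth_ring U \<Longrightarrow> field 0 (taylor_deriv k i r f)"
  using field_taylor_0[OF smooth_partial_deriv[OF open_U]]
  by (auto simp: taylor_deriv_def field_zero_field split: nat.split)

lemma mom_deriv_taylor:
  "f \<in> smooth_ring U \<Longrightarrow> mom_deriv (Inl i) k 1 (taylor r f) (\<lambda>l v. scale hbar (taylor_deriv k i r f l v))"
proof (induction r arbitrary: f)
  case 0
  then show ?case by (auto simp: mom_deriv_def fun_field_def mom_fun_mult taylor_deriv_def)
next
  case (Suc r)
  note f = Suc.prems
  have p: "partial_deriv U j f \<in> smooth_ring U" for j by (rule smooth_partial_deriv[OF open_U f])
  have p2: "partial_deriv U i (partial_deriv U j f) \<in> smooth_ring U" for i j
    by (rule smooth_partial_deriv[OF open_U p])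
  (* the j-th term of the recursion: the momentum contracts either the split-off factor
     or one inside the remaining Taylor part *)
  define G where "G j l v = (if i = j \<and> k \<noteq> 0 then scale hbar (taylor r (partial_deriv U j f) l v) else 0)
      + scale hbar (conv (coord (Inl j)) (taylor_deriv k i r (partial_deriv U j f)) l v)" for j l v
  have "mom_deriv (Inl i) k 1 (conv (coord (Inl j)) (taylor r (partial_deriv U j f))) (G j)" for j
  proof -
    have c: "mom_deriv (Inl i) k 1 (coord (Inl j)) (\<lambda>l v. if i = j \<and> k \<noteq> 0 then scale hbar (one_field l v) else 0)"
      using mom_deriv_coord[of "Inl i" k "Inl j"] by simp
    have fl: "field 0 (\<lambda>l v. if i = j \<and> k \<noteq> 0 then scale hbar (one_field l v) else 0)"
      by (intro field_if field_scaled field_one)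
    have "mom_deriv (Inl i) k (1 * 1) (conv (coord (Inl j)) (taylor r (partial_deriv U j f))) (\<lambda>l v.
        conv (\<lambda>l v. if i = j \<and> k \<noteq> 0 then scale hbar (one_field l v) else 0) (taylor r (partial_deriv U j f)) l v
        + scale 1 (conv (coord (Inl j)) (\<lambda>l v. scale hbar (taylor_deriv k i r (partial_deriv U j f) l v)) l v))"
      by (rule mom_deriv_conv[OF field_coord field_taylor[OF p] fl
            field_scaled[OF field_taylor_deriv[OF p]] c Suc.IH[OF p]])
    then show ?thesis
      unfolding mult_1
    proof (rule mom_deriv_cong)
      fix l v assume v: "v \<in> fock U"
      show "conv (\<lambda>l v. if i = j \<and> k \<noteq> 0 then scale hbar (one_field l v) else 0) (taylor r (partial_deriv U j f)) l v
        + scale 1 (conv (coord (Inl j)) (\<lambda>l v. scale hbar (taylor_deriv k i r (partial_deriv U j f) l v)) l v) = G j l v"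
        using v
        by (simp only: G_def conv_if conv_scale_left conv_one_left[OF field_taylor[OF p]]
            conv_scale_right[OF field_coord field_taylor_deriv[OF p]] vec_fun.scale_one)
    qed
  qed
  then have "mom_deriv (Inl i) k 1 (taylor (Suc r) f)
      (\<lambda>l v. scale (1 / of_nat (Suc r)) (\<Sum>j\<in>(UNIV :: 'n set). G j l v))"
    unfolding taylor.simps
    by (intro mom_deriv_scale[OF field_sum_field, where t = 0] mom_deriv_sum[where t = 0]
        field_conv_0 field_coord field_taylor_0[OF p])
  then show ?case
  proof (rule mom_deriv_cong)
    fix l v assume v: "v \<in> fock U"
    have first: "(\<Sum>j\<in>UNIV. if i = j \<and> k \<noteq> 0 then scale hbar (taylor r (partial_deriv U j f) l v) else 0)
      = (if k = 0 then 0 else scale hbar (taylor r (partial_deriv U i f) l v))"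
      by (simp add: sum.delta')
    have sumG: "(\<Sum>j\<in>UNIV. G j l v) = (if k = 0 then 0 else scale hbar (taylor r (partial_deriv U i f) l v))
      + scale hbar (\<Sum>j\<in>UNIV. conv (coord (Inl j)) (taylor_deriv k i r (partial_deriv U j f)) l v)"
      unfolding G_def sum.distrib first vec_fun.scale_sum_right ..
    have rec: "(\<Sum>j\<in>UNIV. conv (coord (Inl j)) (taylor q (partial_deriv U i (partial_deriv U j f))) l v)
      = scale (of_nat (Suc q)) (taylor (Suc q) (partial_deriv U i f) l v)" for q
      by (simp add: partial_deriv_commute[OF open_U f, of i] del: of_nat_Suc)
    show "scale (1 / of_nat (Suc r)) (\<Sum>j\<in>UNIV. G j l v) = scale hbar (taylor_deriv k i (Suc r) f l v)"
    proof (cases "k = 0")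
      case True
      then show ?thesis unfolding sumG
        by (simp add: taylor_deriv_def rec vec_fun.scale_left_commute del: of_nat_Suc taylor.simps(2))
    next
      case False
      show ?thesis
      proof (cases r)
        case 0
        then show ?thesis using False unfolding sumG
          by (simp add: taylor_deriv_def conv_zero_right[OF field_coord])
      next
        case (Suc q)
        have "scale hbar (taylor r (partial_deriv U i f) l v) + scale hbar (scale (of_nat r) (taylor r (partial_deriv U i f) l v))
          = scale (of_nat (Suc r)) (scale hbar (taylor r (partial_deriv U i f) l v))"
          unfolding vec_fun.scale_scale vec_fun.scale_left_distrib[symmetric]
          by (rule arg_cong2[where f = scale]) (simp_all add: algebra_simps)
        then show ?thesis using False unfolding sumG
          by (simp add: taylor_deriv_def Suc rec vec_fun.scale_left_commute del: of_nat_Suc taylor.simps(2))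
      qed
    qed
  qed
qed

lemma mom_deriv_func_odd:
  assumes f: "f \<in> smooth_ring U" shows "mom_deriv (Inr i) k 1 (func f) (\<lambda>l v. 0)"
  unfolding mom_deriv_def
proof (intro allI ballI)
  fix l v assume v: "v \<in> fock U"
  obtain j1 where j1: "v \<in> fock_le U j1" "0 \<le> j1" using v by (rule fock_exhausted)
  obtain j2 where j2: "mom (Inr i) k v \<in> fock_le U j2" "0 \<le> j2" using mom_fock[OF v] by (rule fock_exhausted)
  define N where "N = nat (max j1 j2 - l - 1)"
  have N: "j1 - l - 1 \<le> int N" "j2 - l - 1 \<le> int N" by (auto simp: N_def)
  have "mom (Inr i) k (func f l v) = (\<Sum>r\<le>N. mom (Inr i) k (taylor r f l v))"
    unfolding func_window[OF f j1(1) N(1)] by (rule mom_sum) (rule field_fock[OF field_taylor[OF f] v])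
  also have "\<dots> = (\<Sum>r\<le>N. taylor r f l (mom (Inr i) k v))"
    using mom_deriv_taylor_odd[OF f, of i k] v by (simp add: mom_deriv_def)
  finally show "mom (Inr i) k (func f l v) = scale 1 (func f l (mom (Inr i) k v)) + 0"
    unfolding func_window[OF f j2(1) N(2)] by simp
qed

text \<open>
  Whether or not the degree drops, the sum over all degrees is \<open>(\<partial>\<^sub>if)(\<gamma>)\<close>: the commutator with
  a momentum is the same field for every mode \<open>k\<close>.
\<close>

lemma mom_deriv_func:
  assumes f: "f \<in> smooth_ring U"
  shows "mom_deriv (Inl i) k 1 (func f) (\<lambda>l v. scale hbar (func (partial_deriv U i f) l v))"
  unfolding mom_deriv_def
proof (intro allI ballI)
  fix l v assume v: "v \<in> fock U"
  obtain j1 where j1: "v \<in> fock_le U j1" "0 \<le> j1" using v by (rule fock_exhausted)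
  obtain j2 where j2: "mom (Inl i) k v \<in> fock_le U j2" "0 \<le> j2" using mom_fock[OF v] by (rule fock_exhausted)
  define N where "N = Suc (nat (max j1 j2 + \<bar>l\<bar> + \<bar>k\<bar>))"
  have N: "j1 - l - 1 \<le> int N" "j2 - l - 1 \<le> int N" "j1 - (k + l) - 1 \<le> int N" "j1 - (k + l) - 1 \<le> int (N - 1)"
    using j1 j2 by (auto simp: N_def)
  note p = smooth_partial_deriv[OF open_U f]
  have d: "(\<Sum>r\<le>N. taylor_deriv k i r f (k + l) v) = func (partial_deriv U i f) (k + l) v"
  proof (cases "k = 0")
    case True
    then show ?thesis unfolding func_window[OF p j1(1) N(3)] by (simp add: taylor_deriv_def)
  next
    case False
    then show ?thesis unfolding func_window[OF p j1(1) N(4)]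
      by (simp add: N_def sum.atMost_Suc_shift taylor_deriv_def del: sum.atMost_Suc)
  qed
  have "mom (Inl i) k (func f l v) = (\<Sum>r\<le>N. mom (Inl i) k (taylor r f l v))"
    unfolding func_window[OF f j1(1) N(1)] by (rule mom_sum) (rule field_fock[OF field_taylor[OF f] v])
  also have "\<dots> = (\<Sum>r\<le>N. taylor r f l (mom (Inl i) k v) + scale hbar (taylor_deriv k i r f (k + l) v))"
    using mom_deriv_taylor[OF f, of i k] v by (simp add: mom_deriv_def)
  also have "\<dots> = func f l (mom (Inl i) k v) + scale hbar (func (partial_deriv U i f) (k + l) v)"
    unfolding func_window[OF f j2(1) N(2)] d[symmetric] sum.distrib vec_fun.scale_sum_right ..
  finally show "mom (Inl i) k (func f l v) = scale 1 (func f l (mom (Inl i) k v))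
      + scale hbar (func (partial_deriv U i f) (k + l) v)" by simp
qed

section \<open>Functions of the even and odd coordinate fields\<close>

text \<open>
  The field \<open>c\<^sub>i \<dots> c\<^sub>j f(\<gamma>)\<close> for a list of indices.
\<close>

primrec cfield :: "(('k, 'n) vec \<Rightarrow> 'k) \<Rightarrow> 'n list \<Rightarrow> ('k, 'n) field_op"
  where "cfield f [] = func f"
  | "cfield f (i # cs) = conv (coord (Inr i)) (cfield f cs)"

lemma field_cfield: "f \<in> smooth_ring U \<Longrightarrow> field 0 (cfield f cs)"
  by (induction cs) (auto intro: field_func field_conv_0 field_coord)

lemma supercommute_cfield:
  assumes Z: "field t Z" "supercommute 1 Z (func f)"
    and c: "\<And>i. supercommute (swap_sign q True) Z (coord (Inr i))" and f: "f \<in> smooth_ring U"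
  shows "supercommute (swap_sign q (odd (length cs))) Z (cfield f cs)"
proof (induction cs)
  case (Cons i cs)
  have "supercommute (swap_sign q True * swap_sign q (odd (length cs))) Z (conv (coord (Inr i)) (cfield f cs))"
    by (rule supercommute_conv_right[OF field_coord field_cfield[OF f] Z(1) c Cons.IH]) simp_all
  moreover have "swap_sign q True * swap_sign q (odd (length cs)) = (swap_sign q (odd (length (i # cs))) :: 'k)"
    by (auto simp: swap_sign_def)
  ultimately show ?case by simp
qed (use Z in simp)

lemma supercommute_coord_cfield:
  assumes f: "f \<in> smooth_ring U"
  shows "supercommute (swap_sign (parity a) (odd (length cs))) (coord a) (cfield f cs)"
proof (rule supercommute_cfield[OF field_coord supercommute_coord_func[OF f] _ f])
  show "supercommute (swap_sign (parity a) True) (coord a) (coord (Inr i))" for i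
    using supercommute_coord[of a "Inr i"] by simp
qed

lemma swap_sign_commute: "swap_sign p q = swap_sign q p"
  by (auto simp: swap_sign_def)

lemma supercommute_cfield_cfield:
  assumes f: "f \<in> smooth_ring U" and g: "g \<in> smooth_ring U"
  shows "supercommute (swap_sign (odd (length cs)) (odd (length ds))) (cfield f cs) (cfield g ds)"
proof (rule supercommute_cfield[OF field_cfield[OF f] _ _ g])
  have "supercommute (swap_sign False (odd (length cs))) (func g) (cfield f cs)"
  proof (rule supercommute_cfield[OF field_func[OF g] supercommute_func_func[OF g f] _ f])
    show "supercommute (swap_sign False True) (func g) (coord (Inr i))" for i
      using supercommute_sym[OF supercommute_coord_func[OF g]] by simp
  qed
  then show "supercommute 1 (cfield f cs) (func g)"
    using supercommute_sym[of 1 "func g" "cfield f cs"] by simp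
  show "supercommute (swap_sign (odd (length cs)) True) (cfield f cs) (coord (Inr i))" for i
    using supercommute_sym[OF supercommute_coord_cfield[OF f, of "Inr i" cs]]
    by (simp add: swap_sign_commute[of True])
qed

lemma cfield_add:
  assumes f: "f \<in> smooth_ring U" and g: "g \<in> smooth_ring U" and v: "v \<in> fock U"
  shows "cfield (\<lambda>x. f x + g x) cs l v = cfield f cs l v + cfield g cs l v"
  using v
proof (induction cs arbitrary: l v)
  case (Cons i cs)
  have "cfield (\<lambda>x. f x + g x) (i # cs) l v = conv (coord (Inr i)) (\<lambda>l v. cfield f cs l v + cfield g cs l v) l v"
    unfolding cfield.simps
    by (rule conv_cong[OF _ _ field_plus[OF field_cfield[OF f] field_cfield[OF g]] Cons.prems])
      (rule refl Cons.IH, assumption?)+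
  then show ?case
    by (simp add: conv_add_right[OF field_coord field_cfield[OF f] field_cfield[OF g] Cons.prems])
qed (simp add: func_add[OF f g])

lemma cfield_cmult:
  assumes f: "f \<in> smooth_ring U" and v: "v \<in> fock U"
  shows "cfield (\<lambda>x. c * f x) cs l v = scale c (cfield f cs l v)"
  using v
proof (induction cs arbitrary: l v)
  case (Cons i cs)
  have "cfield (\<lambda>x. c * f x) (i # cs) l v = conv (coord (Inr i)) (\<lambda>l v. scale c (cfield f cs l v)) l v"
    unfolding cfield.simps
    by (rule conv_cong[OF _ _ field_scaled[OF field_cfield[OF f]] Cons.prems])
      (rule refl Cons.IH, assumption?)+
  then show ?case
    by (simp add: conv_scale_right[OF field_coord field_cfield[OF f] Cons.prems])
qed (simp add: func_cmult[OF f])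

lemma cfield_zero: "v \<in> fock U \<Longrightarrow> cfield (\<lambda>x. 0) cs l v = 0"
  using cfield_cmult[OF smooth_ring_zero, of v 0] by simp

lemma smooth_ring_sum: "(\<And>a. a \<in> A \<Longrightarrow> f a \<in> smooth_ring U) \<Longrightarrow> (\<lambda>x. \<Sum>a\<in>A. f a x) \<in> smooth_ring U"
  by (induction A rule: infinite_finite_induct) (auto simp: smooth_ring_zero intro: smooth_ring.add)

lemma cfield_sum:
  assumes "\<And>a. a \<in> A \<Longrightarrow> f a \<in> smooth_ring U" and v: "v \<in> fock U"
  shows "cfield (\<lambda>x. \<Sum>a\<in>A. f a x) cs l v = (\<Sum>a\<in>A. cfield (f a) cs l v)"
  using assms(1)
proof (induction A rule: infinite_finite_induct)
  case (insert a A)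
  then show ?case
    by (simp add: cfield_add[OF _ smooth_ring_sum v])
qed (simp_all add: cfield_zero[OF v])

lemma cfield_mult:
  assumes f: "f \<in> smooth_ring U" and g: "g \<in> smooth_ring U" and v: "v \<in> fock U"
  shows "conv (cfield f cs) (cfield g ds) l v = cfield (\<lambda>x. f x * g x) (cs @ ds) l v"
  using v
proof (induction cs arbitrary: l v)
  case Nil
  then show ?case
  proof (induction ds arbitrary: l v)
    case Nil
    then show ?case by (simp add: func_mult[OF f g])
  next
    case (Cons i ds)
    have "conv (cfield f []) (cfield g (i # ds)) l v = conv (coord (Inr i)) (conv (func f) (cfield g ds)) l v"
      using conv_left_commute[OF field_func[OF f] field_coord field_cfield[OF g]
          supercommute_sym[OF supercommute_coord_func[OF f]] Cons.prems] by simp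
    also have "\<dots> = conv (coord (Inr i)) (cfield (\<lambda>x. f x * g x) ds) l v"
      by (rule conv_cong[OF _ _ field_cfield[OF smooth_ring.mult[OF f g]] Cons.prems])
        (use Cons.IH in simp_all)
    finally show ?case by simp
  qed
next
  case (Cons i cs)
  have "conv (cfield f (i # cs)) (cfield g ds) l v = conv (coord (Inr i)) (conv (cfield f cs) (cfield g ds)) l v"
    using conv_assoc[OF field_coord field_cfield[OF f] field_cfield[OF g] Cons.prems] by simp
  also have "\<dots> = conv (coord (Inr i)) (cfield (\<lambda>x. f x * g x) (cs @ ds)) l v"
    by (rule conv_cong[OF _ _ field_cfield[OF smooth_ring.mult[OF f g]] Cons.prems])
      (rule refl Cons.IH, assumption?)+
  finally show ?case by simp
qed

lemma cfield_swap:
  assumes f: "f \<in> smooth_ring U" and v: "v \<in> fock U"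
  shows "cfield f (i # j # cs) l v = scale (- 1) (cfield f (j # i # cs) l v)"
  using conv_left_commute[OF field_coord field_coord field_cfield[OF f] supercommute_coord v, of "Inr i" "Inr j"]
  by simp

lemma cfield_rotate:
  assumes f: "f \<in> smooth_ring U" and v: "v \<in> fock U"
  shows "cfield f [a, b, c] l v = cfield f [b, c, a] l v"
proof -
  have "cfield f [a, b, c] l v = scale (- 1) (cfield f [b, a, c] l v)"
    by (rule cfield_swap[OF f v])
  also have "cfield f [b, a, c] l v = conv (coord (Inr b)) (\<lambda>l v. scale (- 1) (cfield f [c, a] l v)) l v"
    unfolding cfield.simps(2)[of f b]
    by (rule conv_cong[OF _ _ field_scaled[OF field_cfield[OF f]] v]) (rule refl cfield_swap[OF f], assumption?)+
  also have "\<dots> = scale (- 1) (cfield f [b, c, a] l v)"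
    unfolding cfield.simps(2)[of f b] by (rule conv_scale_right[OF field_coord field_cfield[OF f] v])
  finally show ?thesis by simp
qed

text \<open>
  Fields that are homogeneous of degree \<open>n\<close> in the \<open>c\<close>'s, given by a coefficient function for
  every list of \<open>n\<close> indices. The coefficients are not required to be antisymmetric; under the
  identification of \<open>c\<^sub>i\<close> with \<open>\<partial>\<^sub>i\<close> these fields correspond to polyvector fields.
\<close>

definition form :: "nat \<Rightarrow> ('n list \<Rightarrow> ('k, 'n) vec \<Rightarrow> 'k) \<Rightarrow> ('k, 'n) field_op"
  where "form n h l v = (\<Sum>cs\<in>{cs. length cs = n}. cfield (h cs) cs l v)"

lemma finite_index_lists [simp]: "finite {cs :: 'n list. length cs = n}"
  using finite_lists_length_eq[of "UNIV :: 'n set" n] by simp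

lemma field_form: "(\<And>cs. h cs \<in> smooth_ring U) \<Longrightarrow> field 0 (form n h)"
  unfolding form_def[abs_def] by (intro field_sum_field field_cfield)

lemma supercommute_form:
  assumes g: "\<And>cs. g cs \<in> smooth_ring U" and h: "\<And>cs. h cs \<in> smooth_ring U"
  shows "supercommute (swap_sign (odd m) (odd n)) (form m g) (form n h)"
proof -
  have "supercommute (swap_sign (odd m) (odd n)) (form m g) (cfield (h ds) ds)" if "length ds = n" for ds
  proof (rule supercommute_sym)
    show "supercommute (swap_sign (odd m) (odd n)) (cfield (h ds) ds) (form m g)"
      unfolding form_def[abs_def]
    proof (rule supercommute_sum_right[OF field_cfield[OF h]])
      show "supercommute (swap_sign (odd m) (odd n)) (cfield (h ds) ds) (cfield (g cs) cs)"
        if "cs \<in> {cs. length cs = m}" for cs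
        using supercommute_cfield_cfield[OF h[of ds] g[of cs], of ds cs] that \<open>length ds = n\<close>
        by (simp add: swap_sign_commute)
    qed (rule field_cfield[OF g])
  qed simp
  then have "supercommute (swap_sign (odd m) (odd n)) (form m g)
      (\<lambda>l v. \<Sum>ds\<in>{ds. length ds = n}. cfield (h ds) ds l v)"
    by (intro supercommute_sum_right[OF field_form[of g, OF g] field_cfield[OF h]]) simp
  moreover have "form n h = (\<lambda>l v. \<Sum>ds\<in>{ds. length ds = n}. cfield (h ds) ds l v)"
    by (intro ext form_def)
  ultimately show ?thesis by (simp only:)
qed

lemma conv_form:
  assumes g: "\<And>cs. g cs \<in> smooth_ring U" and h: "\<And>cs. h cs \<in> smooth_ring U" and v: "v \<in> fock U"
  shows "conv (form m g) (form n h) l v = form (m + n) (\<lambda>cs x. g (take m cs) x * h (drop m cs) x) l v"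
proof -
  have "conv (form m g) (form n h) l v
    = (\<Sum>cs\<in>{cs. length cs = m}. \<Sum>ds\<in>{ds. length ds = n}. conv (cfield (g cs) cs) (cfield (h ds) ds) l v)"
    unfolding form_def[abs_def]
    by (subst conv_sum_left[OF field_cfield[OF g] field_sum_field[OF field_cfield[OF h]] v])
      (rule sum.cong[OF refl], rule conv_sum_right[OF field_cfield[OF h] field_cfield[OF g] v])
  also have "\<dots> = (\<Sum>(cs, ds)\<in>{cs. length cs = m} \<times> {ds. length ds = n}.
      cfield (\<lambda>x. g cs x * h ds x) (cs @ ds) l v)"
    unfolding sum.cartesian_product[symmetric]
    by (intro sum.cong refl cfield_mult g h v)
  also have "\<dots> = form (m + n) (\<lambda>cs x. g (take m cs) x * h (drop m cs) x) l v"
    unfolding form_def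
    by (rule sum.reindex_bij_witness[of _ "\<lambda>cs. (take m cs, drop m cs)" "\<lambda>(cs, ds). cs @ ds"]) auto
  finally show ?thesis .
qed

lemma form_add:
  assumes "\<And>cs. g cs \<in> smooth_ring U" "\<And>cs. h cs \<in> smooth_ring U" "v \<in> fock U"
  shows "form n g l v + form n h l v = form n (\<lambda>cs x. g cs x + h cs x) l v"
  unfolding form_def sum.distrib[symmetric] by (intro sum.cong refl cfield_add[symmetric] assms)

lemma form_sum:
  assumes "\<And>a cs. h a cs \<in> smooth_ring U" "v \<in> fock U"
  shows "(\<Sum>a\<in>A. form n (h a) l v) = form n (\<lambda>cs x. \<Sum>a\<in>A. h a cs x) l v"
  unfolding form_def by (subst sum.swap) (intro sum.cong refl cfield_sum[symmetric] assms)

lemma form_cmult: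
  assumes "\<And>cs. h cs \<in> smooth_ring U" "v \<in> fock U"
  shows "form n (\<lambda>cs x. c * h cs x) l v = scale c (form n h l v)"
  unfolding form_def vec_fun.scale_sum_right by (intro sum.cong refl cfield_cmult assms)

lemma sum_index_lists_Suc:
  "(\<Sum>cs\<in>{cs :: 'n list. length cs = Suc n}. G cs) = (\<Sum>i\<in>UNIV. \<Sum>cs\<in>{cs. length cs = n}. G (i # cs))"
proof -
  have "(\<Sum>cs\<in>{cs :: 'n list. length cs = Suc n}. G cs) = (\<Sum>(i, cs)\<in>UNIV \<times> {cs. length cs = n}. G (i # cs))"
    by (rule sum.reindex_bij_witness[of _ "\<lambda>(i, cs). i # cs" "\<lambda>cs. (hd cs, tl cs)"])
      (auto simp: length_Suc_conv)
  then show ?thesis by (simp add: sum.cartesian_product)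
qed

lemma sum_index_lists_0: "(\<Sum>cs\<in>{cs :: 'n list. length cs = 0}. G cs) = G []"
  by simp

lemma form_0: "form 0 h l v = func (h []) l v"
  and form_1: "form (Suc 0) h l v = (\<Sum>i\<in>UNIV. cfield (h [i]) [i] l v)"
  and form_2: "form (Suc (Suc 0)) h l v = (\<Sum>i\<in>UNIV. \<Sum>j\<in>UNIV. cfield (h [i, j]) [i, j] l v)"
  and form_3: "form (Suc (Suc (Suc 0))) h l v = (\<Sum>i\<in>UNIV. \<Sum>j\<in>UNIV. \<Sum>k\<in>UNIV. cfield (h [i, j, k]) [i, j, k] l v)"
  unfolding form_def sum_index_lists_Suc sum_index_lists_0 by simp_all

lemma scale_eq_self_zero: "w = scale (- 1) w \<Longrightarrow> w = (0 :: ('k, 'n) vec_fun)"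
  by (auto simp: fun_eq_iff scale_apply)

text \<open>
  Symmetric coefficients are annihilated by \<open>c\<^sub>i c\<^sub>j = - c\<^sub>j c\<^sub>i\<close>.
\<close>

lemma form_2_symmetric:
  assumes h: "\<And>cs. h cs \<in> smooth_ring U" and sym: "\<And>i j. h [i, j] = h [j, i]" and v: "v \<in> fock U"
  shows "form (Suc (Suc 0)) h l v = 0"
proof (rule scale_eq_self_zero)
  have "form (Suc (Suc 0)) h l v = (\<Sum>i\<in>UNIV. \<Sum>j\<in>UNIV. scale (- 1) (cfield (h [j, i]) [j, i] l v))"
    unfolding form_2 by (intro sum.cong refl, subst sym, rule cfield_swap[OF h v])
  also have "\<dots> = scale (- 1) (form (Suc (Suc 0)) h l v)"
    unfolding form_2 vec_fun.scale_sum_right by (rule sum.swap)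
  finally show "form (Suc (Suc 0)) h l v = scale (- 1) (form (Suc (Suc 0)) h l v)" .
qed

text \<open>
  A product of three \<open>c\<close>'s is invariant under cyclic rotation of the indices, so only the cyclic
  sum of the coefficients matters. This is the form in which the derivative of the Jacobi
  identity enters.
\<close>

lemma form_3_cyclic:
  assumes h: "\<And>cs. h cs \<in> smooth_ring U" and v: "v \<in> fock U"
    and cyc: "\<And>i j k x. h [i, j, k] x + h [j, k, i] x + h [k, i, j] x = 0"
  shows "form (Suc (Suc (Suc 0))) h l v = 0"
proof -
  let ?S = "form (Suc (Suc (Suc 0))) h l v"
  have rot: "(\<Sum>i\<in>UNIV. \<Sum>j\<in>UNIV. \<Sum>k\<in>UNIV. G j k i) = (\<Sum>i\<in>UNIV. \<Sum>j\<in>UNIV. \<Sum>k\<in>UNIV. G i j k)"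
    for G :: "'n \<Rightarrow> 'n \<Rightarrow> 'n \<Rightarrow> ('k, 'n) vec_fun"
    by (subst sum.swap) (intro sum.cong refl sum.swap)
  have s2: "?S = (\<Sum>i\<in>UNIV. \<Sum>j\<in>UNIV. \<Sum>k\<in>UNIV. cfield (h [j, k, i]) [i, j, k] l v)"
    unfolding form_3 rot[of "\<lambda>i j k. cfield (h [i, j, k]) [i, j, k] l v", symmetric]
    by (intro sum.cong refl cfield_rotate[OF h v, symmetric])
  have s3: "?S = (\<Sum>i\<in>UNIV. \<Sum>j\<in>UNIV. \<Sum>k\<in>UNIV. cfield (h [k, i, j]) [i, j, k] l v)"
    unfolding s2 rot[of "\<lambda>i j k. cfield (h [j, k, i]) [i, j, k] l v", symmetric]
    by (intro sum.cong refl cfield_rotate[OF h v, symmetric])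
  have "?S + ?S + ?S = ?S + (\<Sum>i\<in>UNIV. \<Sum>j\<in>UNIV. \<Sum>k\<in>UNIV. cfield (h [j, k, i]) [i, j, k] l v)
      + (\<Sum>i\<in>UNIV. \<Sum>j\<in>UNIV. \<Sum>k\<in>UNIV. cfield (h [k, i, j]) [i, j, k] l v)"
    by (simp only: s2[symmetric] s3[symmetric])
  also have "\<dots> = (\<Sum>i\<in>UNIV. \<Sum>j\<in>UNIV. \<Sum>k\<in>UNIV.
      cfield (\<lambda>x. h [i, j, k] x + h [j, k, i] x + h [k, i, j] x) [i, j, k] l v)"
    unfolding form_3 sum.distrib[symmetric]
    by (intro sum.cong refl) (simp only: cfield_add[OF smooth_ring.add[OF h h] h v] cfield_add[OF h h v])
  also have "\<dots> = 0" by (simp add: cyc cfield_zero[OF v] del: cfield.simps)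
  finally have "scale 3 ?S = 0"
    by (simp add: fun_eq_iff scale_apply algebra_simps)
  then show ?thesis by simp
qed

lemma mom_deriv_cfield:
  assumes f: "f \<in> smooth_ring U"
  shows "mom_deriv (Inl j) k 1 (cfield f cs) (\<lambda>l v. scale hbar (cfield (partial_deriv U j f) cs l v))"
proof (induction cs)
  case Nil
  then show ?case using mom_deriv_func[OF f] by simp
next
  case (Cons i cs)
  note p = smooth_partial_deriv[OF open_U f]
  have c: "mom_deriv (Inl j) k 1 (coord (Inr i)) (\<lambda>l v. 0)"
    using mom_deriv_coord[of "Inl j" k "Inr i"] by simp
  have "mom_deriv (Inl j) k (1 * 1) (cfield f (i # cs))
    (\<lambda>l v. conv (\<lambda>l v. 0) (cfield f cs) l v
      + scale 1 (conv (coord (Inr i)) (\<lambda>l v. scale hbar (cfield (partial_deriv U j f) cs l v)) l v))"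
    unfolding cfield.simps
    by (rule mom_deriv_conv[OF field_coord field_cfield[OF f] field_zero_field field_scaled[OF field_cfield[OF p]] c Cons.IH])
  then show ?case unfolding mult_1
    by (rule mom_deriv_cong)
      (simp only: conv_zero_left add_0_left vec_fun.scale_one cfield.simps
        conv_scale_right[OF field_coord field_cfield[OF p]])
qed

lemma scale_if: "scale c (if B then w else 0) = (if B then scale c w else 0)"
  by simp

lemma conv_if_right:
  "field t X \<Longrightarrow> conv X (\<lambda>l v. if B then Y l v else 0) l v = (if B then conv X Y l v else 0)"
  by (cases B) (simp_all only: if_True if_False conv_zero_right)

lemma mom_deriv_cfield_odd_single:
  assumes f: "f \<in> smooth_ring U"
  shows "mom_deriv (Inr j) k (- 1) (cfield f [a]) (\<lambda>l v. scale hbar (if j = a then func f l v else 0))"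
proof -
  have c: "mom_deriv (Inr j) k (- 1) (coord (Inr a)) (\<lambda>l v. if j = a then scale hbar (one_field l v) else 0)"
    using mom_deriv_coord[of "Inr j" k "Inr a"] by simp
  have fl: "field 0 (\<lambda>l v. if j = a then scale hbar (one_field l v) else 0)"
    by (intro field_if field_scaled field_one)
  have "mom_deriv (Inr j) k (- 1 * 1) (cfield f [a])
    (\<lambda>l v. conv (\<lambda>l v. if j = a then scale hbar (one_field l v) else 0) (func f) l v
      + scale (- 1) (conv (coord (Inr a)) (\<lambda>l v. 0) l v))"
    unfolding cfield.simps
    by (rule mom_deriv_conv[OF field_coord field_func[OF f] fl field_zero_field c mom_deriv_func_odd[OF f]])
  then show ?thesis unfolding mult_1_right
  proof (rule mom_deriv_cong)
    fix l v assume v: "v \<in> fock U"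
    show "conv (\<lambda>l v. if j = a then scale hbar (one_field l v) else 0) (func f) l v
      + scale (- 1) (conv (coord (Inr a)) (\<lambda>l v. 0) l v) = scale hbar (if j = a then func f l v else 0)"
      by (simp only: conv_if conv_scale_left conv_one_left[OF field_func[OF f] v]
        conv_zero_right[OF field_coord] scale_if vec_fun.scale_zero_right add_0_right)
  qed
qed

text \<open>
  The momentum \<open>b\<^sup>j\<close> acts as the left derivative with respect to \<open>c\<^sub>j\<close>, with a sign for passing
  the first factor.
\<close>

lemma mom_deriv_cfield_odd_pair:
  assumes f: "f \<in> smooth_ring U"
  shows "mom_deriv (Inr j) k 1 (cfield f [a, b])
    (\<lambda>l v. scale hbar ((if j = a then cfield f [b] l v else 0) - (if j = b then cfield f [a] l v else 0)))"
proof -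
  have c: "mom_deriv (Inr j) k (- 1) (coord (Inr a)) (\<lambda>l v. if j = a then scale hbar (one_field l v) else 0)"
    using mom_deriv_coord[of "Inr j" k "Inr a"] by simp
  have fl: "field 0 (\<lambda>l v. if j = a then scale hbar (one_field l v) else 0)"
    by (intro field_if field_scaled field_one)
  have fl2: "field 0 (\<lambda>l v. scale hbar (if j = b then func f l v else 0))"
    by (intro field_scaled field_if field_func f)
  have "mom_deriv (Inr j) k (- 1 * - 1) (cfield f [a, b])
    (\<lambda>l v. conv (\<lambda>l v. if j = a then scale hbar (one_field l v) else 0) (cfield f [b]) l v
      + scale (- 1) (conv (coord (Inr a)) (\<lambda>l v. scale hbar (if j = b then func f l v else 0)) l v))"
    unfolding cfield.simps(2)[of f a]
    by (rule mom_deriv_conv[OF field_coord field_cfield[OF f] fl fl2 c mom_deriv_cfield_odd_single[OF f]])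
  then have "mom_deriv (Inr j) k 1 (cfield f [a, b])
    (\<lambda>l v. conv (\<lambda>l v. if j = a then scale hbar (one_field l v) else 0) (cfield f [b]) l v
      + scale (- 1) (conv (coord (Inr a)) (\<lambda>l v. scale hbar (if j = b then func f l v else 0)) l v))"
    by (simp only: minus_mult_minus mult_1)
  then show ?thesis
  proof (rule mom_deriv_cong)
    fix l v assume v: "v \<in> fock U"
    have "conv (coord (Inr a)) (\<lambda>l v. scale hbar (if j = b then func f l v else 0)) l v
      = scale hbar (if j = b then cfield f [a] l v else 0)"
      unfolding conv_scale_right[OF field_coord field_if[OF field_func[OF f]] v]
      by (simp only: conv_if_right[OF field_coord] cfield.simps)
    then show "conv (\<lambda>l v. if j = a then scale hbar (one_field l v) else 0) (cfield f [b]) l v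
      + scale (- 1) (conv (coord (Inr a)) (\<lambda>l v. scale hbar (if j = b then func f l v else 0)) l v)
      = scale hbar ((if j = a then cfield f [b] l v else 0) - (if j = b then cfield f [a] l v else 0))"
      unfolding conv_if conv_scale_left conv_one_left[OF field_cfield[OF f] v]
      by (cases "j = a"; cases "j = b") (simp_all add: vec_fun.scale_right_diff_distrib del: cfield.simps)
  qed
qed

end

section \<open>The Hamiltonian vector field of the Poisson bivector\<close>

lemma sum_UNIV_sum: "(\<Sum>a\<in>(UNIV :: ('n::finite + 'n) set). G a) = (\<Sum>j\<in>UNIV. G (Inl j)) + (\<Sum>k\<in>UNIV. G (Inr k))"
  unfolding UNIV_Plus_UNIV[symmetric] by (subst sum.Plus) (auto simp: o_def)

context bcbg
begin

lemma partial_deriv_sum: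
  assumes "\<And>a. a \<in> A \<Longrightarrow> f a \<in> smooth_ring U"
  shows "partial_deriv U i (\<lambda>x. \<Sum>a\<in>A. f a x) = (\<lambda>x. \<Sum>a\<in>A. partial_deriv U i (f a) x)"
  using assms
  by (induction A rule: infinite_finite_induct)
    (simp_all add: partial_deriv_zero partial_deriv_add[OF open_U _ smooth_ring_sum])

lemma mom_deriv_form:
  assumes h: "\<And>cs. h cs \<in> smooth_ring U"
  shows "mom_deriv (Inl j) k 1 (form n h) (\<lambda>l v. scale hbar (form n (\<lambda>cs. partial_deriv U j (h cs)) l v))"
proof -
  have "mom_deriv (Inl j) k 1 (form n h)
    (\<lambda>l v. \<Sum>cs\<in>{cs. length cs = n}. scale hbar (cfield (partial_deriv U j (h cs)) cs l v))"
    unfolding form_def[abs_def] by (rule mom_deriv_sum[OF field_cfield[OF h] mom_deriv_cfield[OF h]])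
  then show ?thesis
    by (rule mom_deriv_cong) (simp only: form_def vec_fun.scale_sum_right)
qed

end

text \<open>
  Members of \<open>smooth_ring U\<close> vanish outside \<open>U\<close>, so the identities for \<open>P\<close> may be demanded at
  all points; they are then equations between functions and can be differentiated.
\<close>

locale poisson_bcbg = bcbg U hbar
  for U :: "('k::{real_normed_field,banach} ^ 'n::{finite,linorder}) set" and hbar :: 'k +
  fixes P :: "'n \<Rightarrow> 'n \<Rightarrow> ('k, 'n) vec \<Rightarrow> 'k"
  assumes P_smooth: "P i j \<in> smooth_ring U"
    and P_antisym: "P i j x = - P j i x"
    and jacobi: "(\<Sum>l\<in>UNIV. P l j x * partial_deriv U l (P i k) x
             + P l i x * partial_deriv U l (P k j) x
             + P l k x * partial_deriv U l (P j i) x) = 0"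
begin

lemma dP_smooth: "partial_deriv U k (P i j) \<in> smooth_ring U"
  by (rule smooth_partial_deriv[OF open_U P_smooth])

lemma dP_antisym: "partial_deriv U k (P i j) x = - partial_deriv U k (P j i) x"
proof -
  have "P i j = (\<lambda>x. (- 1) * P j i x)" using P_antisym[of i j] by (simp add: fun_eq_iff)
  then show ?thesis using partial_deriv_cmult[OF open_U P_smooth[of j i], of k "- 1"] by simp
qed

lemma jacobi_deriv:
  "(\<Sum>l\<in>UNIV. partial_deriv U m (P l j) x * partial_deriv U l (P i k) x
             + P l j x * partial_deriv U m (partial_deriv U l (P i k)) x
             + (partial_deriv U m (P l i) x * partial_deriv U l (P k j) x
             + P l i x * partial_deriv U m (partial_deriv U l (P k j)) x)
             + (partial_deriv U m (P l k) x * partial_deriv U l (P j i) x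
             + P l k x * partial_deriv U m (partial_deriv U l (P j i)) x)) = 0"
proof -
  note sm = smooth_ring.mult[OF P_smooth dP_smooth]
  have "partial_deriv U m (\<lambda>x. \<Sum>l\<in>UNIV. P l j x * partial_deriv U l (P i k) x
             + P l i x * partial_deriv U l (P k j) x
             + P l k x * partial_deriv U l (P j i) x) x = 0"
    by (simp only: jacobi partial_deriv_zero)
  then show ?thesis
    by (simp only: partial_deriv_sum[OF smooth_ring.add[OF smooth_ring.add[OF sm sm] sm]]
        partial_deriv_add[OF open_U smooth_ring.add[OF sm sm] sm] partial_deriv_add[OF open_U sm sm]
        partial_deriv_mult[OF open_U P_smooth dP_smooth])
qed

text \<open>
  Coefficients of the Hamiltonian vector field: \<open>-2 P\<^sup>i\<^sup>j\<close> for the direction \<open>\<gamma>\<^sup>j\<close> and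
  \<open>\<partial>\<^sub>kP\<^sup>i\<^sup>j\<close> for the direction \<open>c\<^sub>k\<close>. The factor 2 collects the two terms \<open>c \<beta>\<close> and \<open>-\<beta> c\<close> of
  the field, the sign comes from the momentum being \<open>-\<beta>\<close>. The parity of \<open>D a\<close> is opposite to
  that of \<open>a\<close>.
\<close>

fun dcoeff :: "'n + 'n \<Rightarrow> 'n list \<Rightarrow> ('k, 'n) vec \<Rightarrow> 'k"
  where "dcoeff (Inl j) cs = (\<lambda>x. (- 2) * P (cs ! 0) j x)"
  | "dcoeff (Inr k) cs = partial_deriv U k (P (cs ! 0) (cs ! Suc 0))"

fun ddegree :: "'n + 'n \<Rightarrow> nat"
  where "ddegree (Inl j) = Suc 0" | "ddegree (Inr k) = Suc (Suc 0)"

lemma dcoeff_smooth: "dcoeff a cs \<in> smooth_ring U"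
  by (cases a) (simp_all only: dcoeff.simps smooth_ring.scale[OF P_smooth] dP_smooth)

definition D :: "'n + 'n \<Rightarrow> ('k, 'n) field_op"
  where "D a = form (ddegree a) (dcoeff a)"

text \<open>
  Coefficients of the derivative of \<open>D b\<close> in direction \<open>a\<close>. In the last case the derivative of
  \<open>\<partial>\<^sub>kP\<^sup>l\<^sup>m c\<^sub>l c\<^sub>m\<close> with respect to \<open>c\<^sub>i\<close> is \<open>-2 \<partial>\<^sub>kP\<^sup>l\<^sup>i c\<^sub>l\<close> by antisymmetry of \<open>P\<close>, and this
  is \<open>\<partial>\<^sub>k\<close> of the component \<open>D (Inl i)\<close>.
\<close>

fun jcoeff :: "'n + 'n \<Rightarrow> 'n + 'n \<Rightarrow> 'n list \<Rightarrow> ('k, 'n) vec \<Rightarrow> 'k"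
  where "jcoeff (Inl j) b cs = partial_deriv U j (dcoeff b cs)"
  | "jcoeff (Inr i) (Inl j) cs = dcoeff (Inl j) [i]"
  | "jcoeff (Inr i) (Inr k) cs = partial_deriv U k (dcoeff (Inl i) cs)"

fun jdegree :: "'n + 'n \<Rightarrow> 'n + 'n \<Rightarrow> nat"
  where "jdegree (Inl j) b = ddegree b"
  | "jdegree (Inr i) (Inl j) = 0"
  | "jdegree (Inr i) (Inr k) = Suc 0"

lemma jcoeff_smooth: "jcoeff a b cs \<in> smooth_ring U"
  by (cases a; cases b) (auto intro!: smooth_partial_deriv[OF open_U] dcoeff_smooth simp del: dcoeff.simps)

definition J :: "'n + 'n \<Rightarrow> 'n + 'n \<Rightarrow> ('k, 'n) field_op"
  where "J a b = form (jdegree a b) (jcoeff a b)"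

lemma field_D: "field 0 (D a)" and field_J: "field 0 (J a b)"
  unfolding D_def J_def by (intro field_form dcoeff_smooth jcoeff_smooth)+

lemma odd_ddegree: "odd (ddegree a) \<longleftrightarrow> \<not> parity a"
  by (cases a) auto

lemma odd_jdegree: "odd (jdegree a b) \<longleftrightarrow> parity a = parity b"
  by (cases a; cases b) auto

lemma supercommute_D_D: "supercommute (swap_sign (\<not> parity a) (\<not> parity b)) (D a) (D b)"
  using supercommute_form[of "dcoeff a" "dcoeff b" "ddegree a" "ddegree b", OF dcoeff_smooth dcoeff_smooth]
  by (simp only: D_def odd_ddegree)

lemma supercommute_D_J: "supercommute (swap_sign (\<not> parity a) (parity b = parity c)) (D a) (J b c)"
  using supercommute_form[of "dcoeff a" "jcoeff b c" "ddegree a" "jdegree b c", OF dcoeff_smooth jcoeff_smooth]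
  by (simp only: D_def J_def odd_ddegree odd_jdegree)

text \<open>
  Momenta act on \<open>D\<close> by differentiation, with a single contraction and the same derivative field
  for all modes.
\<close>

lemma mom_deriv_D: "mom_deriv a k (swap_sign (parity a) (\<not> parity b)) (D b) (\<lambda>l v. scale hbar (J a b l v))"
proof -
  consider j where "a = Inl j" | i j where "a = Inr i" "b = Inl j" | i m where "a = Inr i" "b = Inr m"
    by (cases a; cases b) auto
  then show ?thesis
  proof cases
    case 1
    then show ?thesis using mom_deriv_form[of "dcoeff b" j k "ddegree b", OF dcoeff_smooth]
      by (simp add: D_def J_def jcoeff.simps(1)[abs_def] del: dcoeff.simps)
  next
    case (2 i j)
    have "D b = (\<lambda>l v. \<Sum>c\<in>UNIV. cfield (dcoeff b [c]) [c] l v)"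
      using 2 by (intro ext) (simp only: D_def ddegree.simps form_1)
    moreover have "mom_deriv (Inr i) k (- 1) (\<lambda>l v. \<Sum>c\<in>UNIV. cfield (dcoeff b [c]) [c] l v)
        (\<lambda>l v. \<Sum>c\<in>UNIV. scale hbar (if i = c then func (dcoeff b [c]) l v else 0))"
      by (rule mom_deriv_sum[OF field_cfield[OF dcoeff_smooth] mom_deriv_cfield_odd_single[OF dcoeff_smooth]])
    moreover have "(\<Sum>c\<in>UNIV. scale hbar (if i = c then func (dcoeff b [c]) l v else 0)) = scale hbar (J a b l v)" for l v
      unfolding vec_fun.scale_sum_right[symmetric] using 2
      by (simp add: J_def form_0 sum.delta' del: dcoeff.simps)
    ultimately show ?thesis using 2 by (simp only: parity_simps swap_sign_simps not_False_eq_True)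
  next
    case (3 i m)
    let ?f = "\<lambda>c d. dcoeff b [c, d]"
    have "D b = (\<lambda>l v. \<Sum>c\<in>UNIV. \<Sum>d\<in>UNIV. cfield (?f c d) [c, d] l v)"
      using 3 by (intro ext) (simp only: D_def ddegree.simps form_2)
    moreover have "mom_deriv (Inr i) k 1 (\<lambda>l v. \<Sum>c\<in>UNIV. \<Sum>d\<in>UNIV. cfield (?f c d) [c, d] l v)
        (\<lambda>l v. \<Sum>c\<in>UNIV. \<Sum>d\<in>UNIV. scale hbar ((if i = c then cfield (?f c d) [d] l v else 0)
           - (if i = d then cfield (?f c d) [c] l v else 0)))"
      by (intro mom_deriv_sum[OF field_sum_field[OF field_cfield[OF dcoeff_smooth]]]
          mom_deriv_sum[OF field_cfield[OF dcoeff_smooth]] mom_deriv_cfield_odd_pair[OF dcoeff_smooth])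
    moreover have "(\<Sum>c\<in>UNIV. \<Sum>d\<in>UNIV. scale hbar ((if i = c then cfield (?f c d) [d] l v else 0)
           - (if i = d then cfield (?f c d) [c] l v else 0))) = scale hbar (J a b l v)" if v: "v \<in> fock U" for l v
    proof -
      have e1: "(\<Sum>c\<in>UNIV. \<Sum>d\<in>UNIV. if i = c then cfield (?f c d) [d] l v else 0) = (\<Sum>d\<in>UNIV. cfield (?f i d) [d] l v)"
        by (subst sum.swap) (simp only: sum.delta' finite_UNIV UNIV_I if_True finite)
      have e2: "(\<Sum>c\<in>UNIV. \<Sum>d\<in>UNIV. if i = d then cfield (?f c d) [c] l v else 0) = (\<Sum>d\<in>UNIV. cfield (?f d i) [d] l v)"
        by (simp only: sum.delta' finite_UNIV UNIV_I if_True finite)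
      have e3: "cfield (?f i d) [d] l v - cfield (?f d i) [d] l v = cfield (jcoeff a b [d]) [d] l v" for d
      proof -
        have "?f i d = (\<lambda>x. (- 1) * partial_deriv U m (P d i) x)"
          using 3 dP_antisym[of m i d] by (simp add: fun_eq_iff)
        moreover have "?f d i = partial_deriv U m (P d i)" using 3 by simp
        moreover have "jcoeff a b [d] = (\<lambda>x. (- 2) * partial_deriv U m (P d i) x)"
          using 3 partial_deriv_cmult[OF open_U P_smooth[of d i], of m "- 2"] by simp
        ultimately show ?thesis
          unfolding cfield_cmult[OF dP_smooth v]
          by (simp only: cfield_cmult[OF dP_smooth v]) (simp add: fun_eq_iff scale_apply del: cfield.simps)
      qed
      show ?thesis
        unfolding vec_fun.scale_sum_right[symmetric] sum_subtractf e1 e2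
        unfolding sum_subtractf[symmetric] e3
        using 3 by (simp only: J_def jdegree.simps form_1)
    qed
    ultimately show ?thesis using 3
      by (simp only: parity_simps swap_sign_simps not_True_eq_False) (rule mom_deriv_cong)
  qed
qed

text \<open>
  The left side is a quadratic expression in the \<open>c\<close>'s whose coefficient minus its transpose is
  \<open>-4\<close> times the Jacobi expression; hence the coefficient is symmetric.
\<close>

lemma D_J_local_even:
  assumes v: "v \<in> fock U"
  shows "(\<Sum>a\<in>UNIV. conv (D a) (J a (Inl m)) l v) = 0"
proof -
  define H1 where "H1 j cs x = dcoeff (Inl j) (take 1 cs) x * jcoeff (Inl j) (Inl m) (drop 1 cs) x" for j cs x
  define H2 where "H2 k cs x = dcoeff (Inr k) (take 2 cs) x * jcoeff (Inr k) (Inl m) (drop 2 cs) x" for k cs x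
  have sm: "H1 j cs \<in> smooth_ring U" "H2 j cs \<in> smooth_ring U" for j cs
    unfolding H1_def[abs_def] H2_def[abs_def] by (intro smooth_ring.mult dcoeff_smooth jcoeff_smooth)+
  have c: "conv (D (Inl j)) (J (Inl j) (Inl m)) l v = form (Suc (Suc 0)) (H1 j) l v"
    "conv (D (Inr k)) (J (Inr k) (Inl m)) l v = form (Suc (Suc 0)) (H2 k) l v" for j k
    unfolding D_def J_def conv_form[OF dcoeff_smooth jcoeff_smooth v] H1_def[abs_def] H2_def[abs_def]
    by (simp_all add: numeral_2_eq_2 del: dcoeff.simps jcoeff.simps)
  have "(\<Sum>a\<in>UNIV. conv (D a) (J a (Inl m)) l v)
    = form (Suc (Suc 0)) (\<lambda>cs x. (\<Sum>j\<in>UNIV. H1 j cs x) + (\<Sum>k\<in>UNIV. H2 k cs x)) l v"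
    unfolding sum_UNIV_sum c form_sum[OF sm(1) v] form_sum[OF sm(2) v]
    by (rule form_add[OF smooth_ring_sum smooth_ring_sum v]) (rule sm)+
  also have "\<dots> = 0"
  proof (rule form_2_symmetric[OF _ _ v])
    show "(\<lambda>x. (\<Sum>j\<in>UNIV. H1 j cs x) + (\<Sum>k\<in>UNIV. H2 k cs x)) \<in> smooth_ring U" for cs
      by (intro smooth_ring.add smooth_ring_sum sm)
    fix a b
    show "(\<lambda>x. (\<Sum>j\<in>UNIV. H1 j [a, b] x) + (\<Sum>k\<in>UNIV. H2 k [a, b] x))
      = (\<lambda>x. (\<Sum>j\<in>UNIV. H1 j [b, a] x) + (\<Sum>k\<in>UNIV. H2 k [b, a] x))"
    proof
      fix x
      have H1: "H1 j [a, b] x = 4 * P a j x * partial_deriv U j (P b m) x" for j a b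
        unfolding H1_def using partial_deriv_cmult[OF open_U P_smooth[of b m], of j "- 2"] by simp
      have H2: "H2 j [a, b] x = - 2 * partial_deriv U j (P a b) x * P j m x" for j a b
        unfolding H2_def by (simp add: numeral_2_eq_2[symmetric])
      (* the Jacobi identity for the indices m, a, b *)
      have "(\<Sum>j\<in>UNIV. H1 j [a, b] x + H2 j [a, b] x - H1 j [b, a] x - H2 j [b, a] x)
        = (\<Sum>j\<in>UNIV. (- 4) * (P j m x * partial_deriv U j (P a b) x
             + P j a x * partial_deriv U j (P b m) x
             + P j b x * partial_deriv U j (P m a) x))"
        unfolding H1 H2
        by (intro sum.cong refl)
          (simp add: P_antisym[of a] P_antisym[of b] dP_antisym[of _ b a] dP_antisym[of _ m a] algebra_simps)
      also have "\<dots> = 0" unfolding sum_distrib_left[symmetric] jacobi by simp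
      finally show "(\<Sum>j\<in>UNIV. H1 j [a, b] x) + (\<Sum>k\<in>UNIV. H2 k [a, b] x)
        = (\<Sum>j\<in>UNIV. H1 j [b, a] x) + (\<Sum>k\<in>UNIV. H2 k [b, a] x)"
        by (simp only: sum.distrib sum_subtractf) algebra
    qed
  qed
  finally show ?thesis .
qed

text \<open>
  The left side is cubic in the \<open>c\<close>'s, and the cyclic sum of its coefficient is twice the
  derivative \<open>jacobi_deriv\<close> of the Jacobi identity.
\<close>

lemma D_J_local_odd:
  assumes v: "v \<in> fock U"
  shows "(\<Sum>a\<in>UNIV. conv (D a) (J a (Inr m)) l v) = 0"
proof -
  define H1 where "H1 j cs x = dcoeff (Inl j) (take 1 cs) x * jcoeff (Inl j) (Inr m) (drop 1 cs) x" for j cs x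
  define H2 where "H2 k cs x = dcoeff (Inr k) (take 2 cs) x * jcoeff (Inr k) (Inr m) (drop 2 cs) x" for k cs x
  have sm: "H1 j cs \<in> smooth_ring U" "H2 j cs \<in> smooth_ring U" for j cs
    unfolding H1_def[abs_def] H2_def[abs_def] by (intro smooth_ring.mult dcoeff_smooth jcoeff_smooth)+
  have c: "conv (D (Inl j)) (J (Inl j) (Inr m)) l v = form (Suc (Suc (Suc 0))) (H1 j) l v"
    "conv (D (Inr k)) (J (Inr k) (Inr m)) l v = form (Suc (Suc (Suc 0))) (H2 k) l v" for j k
    unfolding D_def J_def conv_form[OF dcoeff_smooth jcoeff_smooth v] H1_def[abs_def] H2_def[abs_def]
    by (simp_all add: numeral_2_eq_2 del: dcoeff.simps jcoeff.simps)
  have "(\<Sum>a\<in>UNIV. conv (D a) (J a (Inr m)) l v)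
    = form (Suc (Suc (Suc 0))) (\<lambda>cs x. (\<Sum>j\<in>UNIV. H1 j cs x) + (\<Sum>k\<in>UNIV. H2 k cs x)) l v"
    unfolding sum_UNIV_sum c form_sum[OF sm(1) v] form_sum[OF sm(2) v]
    by (rule form_add[OF smooth_ring_sum smooth_ring_sum v]) (rule sm)+
  also have "\<dots> = 0"
  proof (rule form_3_cyclic[OF _ v])
    show "(\<lambda>x. (\<Sum>j\<in>UNIV. H1 j cs x) + (\<Sum>k\<in>UNIV. H2 k cs x)) \<in> smooth_ring U" for cs
      by (intro smooth_ring.add smooth_ring_sum sm)
    fix a b c x
    let ?d = "partial_deriv U"
    have H1: "H1 j [a, b, c] x = - 2 * P a j x * ?d j (?d m (P b c)) x" for j a b c
      unfolding H1_def by (simp add: numeral_2_eq_2[symmetric])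
    have H2: "H2 j [a, b, c] x = - 2 * ?d j (P a b) x * ?d m (P c j) x" for j a b c
      unfolding H2_def using partial_deriv_cmult[OF open_U P_smooth[of c j], of m "- 2"] by (simp add: numeral_2_eq_2[symmetric])
    have "(\<Sum>j\<in>UNIV. H1 j [a, b, c] x + H2 j [a, b, c] x + (H1 j [b, c, a] x + H2 j [b, c, a] x)
        + (H1 j [c, a, b] x + H2 j [c, a, b] x))
      = (\<Sum>l\<in>UNIV. 2 * (?d m (P l a) x * ?d l (P b c) x
             + P l a x * ?d m (?d l (P b c)) x
             + (?d m (P l b) x * ?d l (P c a) x
             + P l b x * ?d m (?d l (P c a)) x)
             + (?d m (P l c) x * ?d l (P a b) x
             + P l c x * ?d m (?d l (P a b)) x)))"
      unfolding H1 H2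
      by (intro sum.cong refl)
        (simp add: P_antisym[of a] P_antisym[of b] P_antisym[of c] dP_antisym[of m a] dP_antisym[of m b] dP_antisym[of m c]
          partial_deriv_commute[OF open_U P_smooth, of m] algebra_simps)
    also have "\<dots> = 0" unfolding sum_distrib_left[symmetric] jacobi_deriv by simp
    finally show "(\<Sum>j\<in>UNIV. H1 j [a, b, c] x) + (\<Sum>k\<in>UNIV. H2 k [a, b, c] x)
      + ((\<Sum>j\<in>UNIV. H1 j [b, c, a] x) + (\<Sum>k\<in>UNIV. H2 k [b, c, a] x))
      + ((\<Sum>j\<in>UNIV. H1 j [c, a, b] x) + (\<Sum>k\<in>UNIV. H2 k [c, a, b] x)) = 0"
      by (simp add: sum.distrib)
  qed
  finally show ?thesis .
qed

text \<open>
  The vector field \<open>D\<close> applied to its own components is zero: \<open>D\<^sup>2 = 0\<close> at the level of fields.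
\<close>

lemma D_J_local: "v \<in> fock U \<Longrightarrow> (\<Sum>a\<in>UNIV. conv (D a) (J a b) l v) = 0"
  using D_J_local_even D_J_local_odd by (cases b) auto

text \<open>
  The Jacobian of a Hamiltonian vector field for an odd symplectic form is periplectic. Its two
  diagonal blocks are transposes of each other, one off-diagonal block consists of second
  derivatives of \<open>P\<close> and is symmetric, the other is \<open>-2 P\<close> and is antisymmetric.
\<close>

lemma J_antisymmetric_blocks:
  assumes v: "v \<in> fock U"
  shows "J (Inr i) (Inr k) = J (Inl k) (Inl i)"
    and "J (Inl j) (Inr k) = J (Inl k) (Inr j)"
    and "J (Inr i) (Inl j) l v = scale (- 1) (J (Inr j) (Inl i) l v)"
proof -
  show "J (Inr i) (Inr k) = J (Inl k) (Inl i)"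
    by (simp add: J_def fun_eq_iff[of "jcoeff _ _"] form_def[abs_def])
  show "J (Inl j) (Inr k) = J (Inl k) (Inr j)"
    by (simp add: J_def form_def[abs_def] partial_deriv_commute[OF open_U P_smooth, of j])
  have "jcoeff (Inr i) (Inl j) = (\<lambda>cs x. (- 1) * jcoeff (Inr j) (Inl i) cs x)"
    using P_antisym[of i j] by (simp add: fun_eq_iff)
  then show "J (Inr i) (Inl j) l v = scale (- 1) (J (Inr j) (Inl i) l v)"
    unfolding J_def by (simp only: jdegree.simps form_cmult[OF jcoeff_smooth v])
qed

text \<open>
  The double contractions. The even-even and odd-odd loops agree by transposition and enter with
  opposite signs; each of the two mixed sums changes sign when the summation indices are
  exchanged. The modes \<open>s\<close> and \<open>t\<close> are arbitrary, so no sum over modes is involved in this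
  cancellation.
\<close>

lemma J_supertrace:
  assumes v: "v \<in> fock U"
  shows "(\<Sum>a\<in>UNIV. \<Sum>b\<in>UNIV. scale (if parity a then - 1 else 1) (J a b s (J b a t v))) = 0"
proof -
  have mixed1: "(\<Sum>j\<in>UNIV. \<Sum>k\<in>UNIV. J (Inl j) (Inr k) s (J (Inr k) (Inl j) t v)) = 0" (is "?S = 0")
  proof (rule scale_eq_self_zero)
    have "J (Inl j) (Inr k) s (J (Inr k) (Inl j) t v) = scale (- 1) (J (Inl k) (Inr j) s (J (Inr j) (Inl k) t v))" for j k
      by (simp only: J_antisymmetric_blocks(2)[OF v, of j k] J_antisymmetric_blocks(3)[OF v, of k j]
          field_scale[OF field_J field_fock[OF field_J v]])
    then have "?S = (\<Sum>j\<in>UNIV. \<Sum>k\<in>UNIV. scale (- 1) (J (Inl k) (Inr j) s (J (Inr j) (Inl k) t v)))"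
      by (intro sum.cong refl)
    also have "\<dots> = scale (- 1) ?S" unfolding vec_fun.scale_sum_right by (rule sum.swap)
    finally show "?S = scale (- 1) ?S" .
  qed
  have mixed2: "(\<Sum>k\<in>UNIV. \<Sum>j\<in>UNIV. J (Inr k) (Inl j) s (J (Inl j) (Inr k) t v)) = 0" (is "?S = 0")
  proof (rule scale_eq_self_zero)
    have "J (Inr k) (Inl j) s (J (Inl j) (Inr k) t v) = scale (- 1) (J (Inr j) (Inl k) s (J (Inl k) (Inr j) t v))" for j k
      by (simp only: J_antisymmetric_blocks(2)[OF v, of j k] J_antisymmetric_blocks(3)[OF field_fock[OF field_J v], of k j])
    then have "?S = (\<Sum>k\<in>UNIV. \<Sum>j\<in>UNIV. scale (- 1) (J (Inr j) (Inl k) s (J (Inl k) (Inr j) t v)))"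
      by (intro sum.cong refl)
    also have "\<dots> = scale (- 1) ?S" unfolding vec_fun.scale_sum_right by (rule sum.swap)
    finally show "?S = scale (- 1) ?S" .
  qed
  have "(\<Sum>i\<in>UNIV. \<Sum>k\<in>UNIV. J (Inr i) (Inr k) s (J (Inr k) (Inr i) t v))
    = (\<Sum>i\<in>UNIV. \<Sum>k\<in>UNIV. J (Inl k) (Inl i) s (J (Inl i) (Inl k) t v))"
    by (simp only: J_antisymmetric_blocks(1)[OF v])
  also have "\<dots> = (\<Sum>i\<in>UNIV. \<Sum>k\<in>UNIV. J (Inl i) (Inl k) s (J (Inl k) (Inl i) t v))"
    by (rule sum.swap)
  finally show ?thesis
    by (simp add: sum_UNIV_sum sum.distrib sum_negf mixed1 mixed2)
qed

end

section \<open>Normal ordering of words\<close>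

text \<open>
  Reindexing of a sum over the support of \<open>T\<close> when each word in the support is composed, in one
  way, of a letter \<open>k\<close> and a shorter word \<open>w'\<close>, and the letter contributes an additive operator
  \<open>G k\<close>. Finiteness of the support comes along.
\<close>

lemma sum_over_fibres:
  fixes T :: "'w \<Rightarrow> 'v::comm_monoid_add"
  assumes K: "finite K"
    and cover: "\<And>w. w \<in> W \<Longrightarrow> T w \<noteq> 0 \<Longrightarrow> \<exists>k\<in>K. \<exists>w'\<in>W' k. T' k w' \<noteq> 0 \<and> w = \<Phi> k w'"
    and trm: "\<And>k w'. k \<in> K \<Longrightarrow> w' \<in> W' k \<Longrightarrow> \<Phi> k w' \<in> W \<and> T (\<Phi> k w') = G k (T' k w')"
    and inj: "\<And>k k' w w'. w \<in> W' k \<Longrightarrow> w' \<in> W' k' \<Longrightarrow> \<Phi> k w = \<Phi> k' w' \<Longrightarrow> k = k' \<and> w = w'"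
    and fin: "\<And>k. k \<in> K \<Longrightarrow> finite {w' \<in> W' k. T' k w' \<noteq> 0}"
    and G: "\<And>k. k \<in> K \<Longrightarrow> G k (\<Sum>w'\<in>{w' \<in> W' k. T' k w' \<noteq> 0}. T' k w') = (\<Sum>w'\<in>{w' \<in> W' k. T' k w' \<noteq> 0}. G k (T' k w'))"
  shows "finite {w \<in> W. T w \<noteq> 0}"
    and "(\<Sum>w\<in>{w \<in> W. T w \<noteq> 0}. T w) = (\<Sum>k\<in>K. G k (\<Sum>w'\<in>{w' \<in> W' k. T' k w' \<noteq> 0}. T' k w'))"
proof -
  define B where "B = (SIGMA k:K. {w' \<in> W' k. T' k w' \<noteq> 0})"
  have B: "finite B" using K fin by (auto simp: B_def)
  have sub: "{w \<in> W. T w \<noteq> 0} \<subseteq> (\<lambda>(k, w'). \<Phi> k w') ` B"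
  proof
    fix w assume "w \<in> {w \<in> W. T w \<noteq> 0}"
    then obtain k w' where "k \<in> K" "w' \<in> W' k" "T' k w' \<noteq> 0" "w = \<Phi> k w'" using cover by blast
    then show "w \<in> (\<lambda>(k, w'). \<Phi> k w') ` B" by (intro image_eqI[of _ _ "(k, w')"]) (auto simp: B_def)
  qed
  then show "finite {w \<in> W. T w \<noteq> 0}" using B finite_subset by blast
  have "(\<Sum>w\<in>{w \<in> W. T w \<noteq> 0}. T w) = (\<Sum>w\<in>(\<lambda>(k, w'). \<Phi> k w') ` B. T w)"
    by (rule sum.mono_neutral_left) (use B sub trm in \<open>auto simp: B_def\<close>)
  also have "\<dots> = (\<Sum>p\<in>B. T (\<Phi> (fst p) (snd p)))"
    by (subst sum.reindex) (auto simp: inj_on_def B_def case_prod_unfold dest: inj)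
  also have "\<dots> = (\<Sum>(k, w')\<in>B. G k (T' k w'))"
    by (rule sum.cong) (use trm in \<open>auto simp: B_def\<close>)
  also have "\<dots> = (\<Sum>k\<in>K. \<Sum>w'\<in>{w' \<in> W' k. T' k w' \<noteq> 0}. G k (T' k w'))"
    unfolding B_def by (rule sum.Sigma[symmetric]) (use K fin in auto)
  also have "\<dots> = (\<Sum>k\<in>K. G k (\<Sum>w'\<in>{w' \<in> W' k. T' k w' \<noteq> 0}. T' k w'))"
    by (rule sum.cong[OF refl]) (rule G[symmetric])
  finally show "(\<Sum>w\<in>{w \<in> W. T w \<noteq> 0}. T w) = (\<Sum>k\<in>K. G k (\<Sum>w'\<in>{w' \<in> W' k. T' k w' \<noteq> 0}. T' k w'))" .
qed

definition coord_gen :: "'n + 'n \<Rightarrow> 'n gen"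
  where "coord_gen a = (case a of Inl i \<Rightarrow> Gamma i | Inr i \<Rightarrow> CF i)"

definition mom_gen :: "'n + 'n \<Rightarrow> 'n gen"
  where "mom_gen a = (case a of Inl i \<Rightarrow> Beta i | Inr i \<Rightarrow> BF i)"

lemma odd_coord_gen [simp]: "odd_gen (coord_gen a) = parity a"
  by (cases a) (auto simp: coord_gen_def)

lemma odd_mom_gen [simp]: "odd_gen (mom_gen a) = parity a"
  by (cases a) (auto simp: mom_gen_def)

definition word_gens :: "(('n + 'n) \<times> int) list \<Rightarrow> ('n gen \<times> int) list"
  where "word_gens w = map (\<lambda>(a, m). (coord_gen a, m)) w"

text \<open>
  Words without the mode \<open>-1\<close> of \<open>\<gamma>\<close>; for these \<open>coord\<close> agrees with the generating modes.
\<close>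

definition proper_word :: "(('n + 'n) \<times> int) list \<Rightarrow> bool"
  where "proper_word w \<longleftrightarrow> (\<forall>(a, m)\<in>set w. \<not> parity a \<longrightarrow> m \<noteq> - 1)"

definition odd_word :: "(('n + 'n) \<times> int) list \<Rightarrow> bool"
  where "odd_word w \<longleftrightarrow> odd (length (filter (parity \<circ> fst) w))"

lemma odd_word_simps [simp]:
  "\<not> odd_word []" "odd_word (p # w) \<longleftrightarrow> (parity (fst p) \<noteq> odd_word w)"
  "odd_word (w @ w') \<longleftrightarrow> (odd_word w \<noteq> odd_word w')"
  by (auto simp: odd_word_def)

lemma odd_word_gens: "odd (length (filter (odd_gen \<circ> fst) (word_gens w))) = odd_word w"
  by (induction w) (auto simp: word_gens_def)

lemma word_gens_simps [simp]:
  "word_gens [] = []" "word_gens ((a, m) # w) = (coord_gen a, m) # word_gens w"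
  "word_gens (w @ w') = word_gens w @ word_gens w'"
  by (auto simp: word_gens_def)

lemma proper_word_simps [simp]:
  "proper_word []" "proper_word ((a, m) # w) \<longleftrightarrow> (\<not> parity a \<longrightarrow> m \<noteq> - 1) \<and> proper_word w"
  "proper_word (w @ w') \<longleftrightarrow> proper_word w \<and> proper_word w'"
  by (auto simp: proper_word_def)

context bcbg
begin

fun cword :: "(('n + 'n) \<times> int) list \<Rightarrow> ('k, 'n) vec_fun \<Rightarrow> ('k, 'n) vec_fun"
  where "cword [] v = v" | "cword ((a, m) # w) v = coord a m (cword w v)"

lemma cword_fock: "v \<in> fock U \<Longrightarrow> cword w v \<in> fock U"
  by (induction w v rule: cword.induct) auto

lemma cword_scale: "cword w (scale c v) = scale c (cword w v)"
  by (induction w v rule: cword.induct) (auto simp: coord_scale)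

lemma cword_le: "v \<in> fock_le U j \<Longrightarrow> cword w v \<in> fock_le U j"
  by (induction w v rule: cword.induct) (auto intro: coord_filtered)

text \<open>
  The exponent of \<open>z\<close> that accompanies a word of modes.
\<close>

definition word_index :: "(('n + 'n) \<times> int) list \<Rightarrow> int"
  where "word_index w = (\<Sum>m\<leftarrow>map snd w. - m - 1)"

text \<open>
  Each letter \<open>\<gamma>\<close> contributes order one, so long words in \<open>\<gamma>\<close> with a given power of \<open>z\<close> vanish
  on a given vector.
\<close>

lemma cword_order:
  "v \<in> fock_le U j \<Longrightarrow> cword w v \<in> fock_le U (j + word_index w - int (length (filter (\<lambda>p. \<not> parity (fst p)) w)))"
proof (induction w v rule: cword.induct)
  case (2 a m w v)
  let ?j = "j + word_index w - int (length (filter (\<lambda>p. \<not> parity (fst p)) w))"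
  have "coord a m (cword w v) \<in> fock_le U (?j - m - 1)" if "parity a"
    using field_order[OF field_coord 2(1)[OF 2(2)], of a m] by (simp only: diff_zero)
  moreover have "coord a m (cword w v) \<in> fock_le U (?j - m - 2)" if "\<not> parity a"
    by (rule coord_filtered(3)[OF 2(1)[OF 2(2)] that])
  ultimately show ?case by (cases "parity a") (simp_all add: word_index_def algebra_simps)
qed (simp add: word_index_def)

lemma coord_cword:
  "v \<in> fock U \<Longrightarrow> coord a m (cword w v) = scale (swap_sign (parity a) (odd_word w)) (cword w (coord a m v))"
proof (induction w v rule: cword.induct)
  case (2 b l w v)
  have "coord a m (coord b l (cword w v)) = scale (swap_sign (parity a) (parity b)) (coord b l (coord a m (cword w v)))"
    by (rule coord_coord[OF cword_fock[OF 2(2)]])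
  also have "\<dots> = scale (swap_sign (parity a) (parity b) * swap_sign (parity a) (odd_word w)) (coord b l (cword w (coord a m v)))"
    using 2 by (simp add: coord_scale)
  also have "swap_sign (parity a) (parity b) * swap_sign (parity a) (odd_word w) = (swap_sign (parity a) (odd_word ((b, l) # w)) :: 'k)"
    by (auto simp: swap_sign_def)
  finally show ?case by simp
qed simp

lemma gm_coord_gen: "(\<not> parity a \<longrightarrow> m \<noteq> - 1) \<Longrightarrow> gm (coord_gen a) m v = coord a m v"
  by (cases a) (auto simp: coord_gen_def coord_def)

lemma gm_mom_gen: "gm (mom_gen a) m v = scale (if parity a then 1 else - 1) (mom a m v)"
  by (cases a) (auto simp: mom_gen_def mom_def)

lemma gm_mom_gen_fock: "v \<in> fock U \<Longrightarrow> gm (mom_gen a) m v \<in> fock U"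
  by (simp only: gm_mom_gen fock_scale mom_fock)

lemma gm_mom_gen_scale: "v \<in> fock U \<Longrightarrow> gm (mom_gen a) m (scale c v) = scale c (gm (mom_gen a) m v)"
  by (simp only: gm_mom_gen mom_scale vec_fun.scale_left_commute)

lemma gm_mom_coord:
  assumes "v \<in> fock U" "m < 0 \<longleftrightarrow> k < 0"
  shows "gm (mom_gen b) m (coord a k v) = scale (swap_sign (parity b) (parity a)) (coord a k (gm (mom_gen b) m v))"
proof -
  have "mom b m (coord a k v) = scale (swap_sign (parity b) (parity a)) (coord a k (mom b m v))"
    using mom_coord[OF assms(1), of b m a k] assms(2) by auto
  then show ?thesis by (simp only: gm_mom_gen coord_scale vec_fun.scale_left_commute)
qed

text \<open>
  Normal ordering is invisible on coordinate letters, as they supercommute.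
\<close>

lemma nop_cword:
  "v \<in> fock U \<Longrightarrow> proper_word w \<Longrightarrow> nop U hbar (word_gens w) v = cword w v"
proof (induction w arbitrary: v)
  case (Cons p w)
  obtain a m where p: "p = (a, m)" by (cases p)
  have IH: "nop U hbar (word_gens w) v' = cword w v'" if "v' \<in> fock U" for v'
    using Cons.IH[OF that] Cons.prems(2) by (simp add: p)
  show ?case
  proof (cases "m < 0")
    case True
    then show ?thesis using Cons.prems IH[OF Cons.prems(1)] by (simp add: p gm_coord_gen)
  next
    case False
    then show ?thesis using Cons.prems IH[OF coord_fock[OF Cons.prems(1)], of a m]
      by (simp add: p gm_coord_gen coord_cword odd_word_gens swap_sign_def)
  qed
qed simp

text \<open>
  Normal ordering moves a creation mode of the only momentum to the far left and an annihilation
  mode to the far right. By definition normal ordering already separates the two types; within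
  its own type the momentum has no contractions and can be brought to the end.
\<close>

lemma nop_one_momentum:
  assumes "v \<in> fock U" "proper_word w1" "proper_word w2"
  shows "nop U hbar (word_gens w1 @ (mom_gen b, m) # word_gens w2) v =
    (if m < 0 then scale (swap_sign (parity b) (odd_word w1)) (gm (mom_gen b) m (cword (w1 @ w2) v))
     else scale (swap_sign (parity b) (odd_word w2)) (cword (w1 @ w2) (gm (mom_gen b) m v)))"
  using assms(1,2)
proof (induction w1 arbitrary: v)
  case Nil
  then show ?case
    using nop_cword[OF _ assms(3)] by (auto simp: odd_word_gens swap_sign_def gm_mom_gen_fock)
next
  case (Cons p w1)
  note v = Cons.prems(1)
  obtain a k where p: "p = (a, k)" by (cases p)
  have pr: "proper_word w1" and ak: "\<not> parity a \<longrightarrow> k \<noteq> - 1" using Cons.prems(2) by (simp_all add: p)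
  have num: "odd (length (filter (odd_gen \<circ> fst) (word_gens w1 @ (mom_gen b, m) # word_gens w2)))
    = (odd_word (w1 @ w2) \<noteq> parity b)"
    using odd_word_gens[of w1] odd_word_gens[of w2] by auto
  let ?w = "w1 @ w2" and ?n = "nop U hbar (word_gens w1 @ (mom_gen b, m) # word_gens w2)"
  show ?case
  proof (cases "k < 0")
    case k: True
    have "nop U hbar (word_gens (p # w1) @ (mom_gen b, m) # word_gens w2) v = coord a k (?n v)"
      using k by (simp add: p gm_coord_gen[OF ak])
    also have "\<dots> = (if m < 0 then scale (swap_sign (parity b) (odd_word w1)) (coord a k (gm (mom_gen b) m (cword ?w v)))
     else scale (swap_sign (parity b) (odd_word w2)) (coord a k (cword ?w (gm (mom_gen b) m v))))"
      using Cons.IH[OF v pr] by (simp add: coord_scale)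
    also have "\<dots> = (if m < 0 then scale (swap_sign (parity b) (odd_word (p # w1))) (gm (mom_gen b) m (coord a k (cword ?w v)))
     else scale (swap_sign (parity b) (odd_word w2)) (coord a k (cword ?w (gm (mom_gen b) m v))))"
      using k gm_mom_coord[OF cword_fock[OF v], of m k b a ?w]
      by (auto simp: p swap_sign_def)
    finally show ?thesis by (simp add: p)
  next
    case k: False
    have "nop U hbar (word_gens (p # w1) @ (mom_gen b, m) # word_gens w2) v
      = scale (swap_sign (parity a) (odd_word ?w \<noteq> parity b)) (?n (coord a k v))"
      using k num by (auto simp: p gm_coord_gen[OF ak] swap_sign_def)
    also have "\<dots> = (if m < 0 then scale (swap_sign (parity b) (odd_word (p # w1))) (gm (mom_gen b) m (coord a k (cword ?w v)))
     else scale (swap_sign (parity b) (odd_word w2)) (coord a k (cword ?w (gm (mom_gen b) m v))))"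
      using k gm_mom_coord[OF v, of m k b a] coord_cword[OF v, of a k ?w]
        coord_cword[OF gm_mom_gen_fock[OF v], of a k ?w b m]
      by (auto simp: p swap_sign_def Cons.IH[OF coord_fock[OF v] pr] gm_mom_gen_scale cword_fock v
          cword_scale)
    finally show ?thesis by (simp add: p)
  qed
qed

section \<open>Normally ordered fields as convolution products\<close>

definition gamma_word :: "('n \<times> int) list \<Rightarrow> (('n + 'n) \<times> int) list"
  where "gamma_word u = map (\<lambda>(i, m). (Inl i, m)) u"

definition c_word :: "'n list \<Rightarrow> int list \<Rightarrow> (('n + 'n) \<times> int) list"
  where "c_word cs ms = zip (map Inr cs) ms"

lemma gamma_word_simps [simp]:
  "gamma_word [] = []" "gamma_word ((i, m) # u) = (Inl i, m) # gamma_word u"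
  by (auto simp: gamma_word_def)

lemma c_word_simps [simp]: "c_word [] ms = []" "c_word (i # cs) (m # ms) = (Inr i, m) # c_word cs ms"
  by (auto simp: c_word_def)

lemma word_gens_gamma: "word_gens (gamma_word u) = map (\<lambda>(i, m). (Gamma i, m)) u"
  by (induction u) (auto simp: coord_gen_def)

lemma word_gens_c: "word_gens (c_word cs ms) = zip (map CF cs) ms"
  by (induction cs ms rule: list_induct2') (auto simp: coord_gen_def c_word_def)

lemma proper_gamma_word: "proper_word (gamma_word u) \<longleftrightarrow> (\<forall>(i, m)\<in>set u. m \<noteq> - 1)"
  by (induction u) auto

lemma proper_c_word: "proper_word (c_word cs ms)"
  by (induction cs ms rule: list_induct2') (auto simp: c_word_def)

lemma odd_gamma_word [simp]: "\<not> odd_word (gamma_word u)"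
  by (induction u) auto

lemma odd_c_word: "length ms = length cs \<Longrightarrow> odd_word (c_word cs ms) = odd (length cs)"
  by (induction ms cs rule: list_induct2) auto

lemma length_filter_gamma: "length (filter (\<lambda>p. \<not> parity (fst p)) (gamma_word u @ c_word cs ms)) = length u"
proof -
  have "filter (\<lambda>p. \<not> parity (fst p)) (c_word cs ms) = []"
    by (induction cs ms rule: list_induct2') (auto simp: c_word_def)
  moreover have "filter (\<lambda>p. \<not> parity (fst p)) (gamma_word u) = gamma_word u"
    by (induction u) auto
  ultimately show ?thesis by (simp add: gamma_word_def)
qed

lemma word_index_append: "word_index (w @ w') = word_index w + word_index w'"
  by (simp add: word_index_def)

lemma word_index_gamma: "word_index (gamma_word u) = (\<Sum>m\<leftarrow>map snd u. - m - 1)"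
  by (induction u) (auto simp: word_index_def)

lemma word_index_c: "length ms = length cs \<Longrightarrow> word_index (c_word cs ms) = (\<Sum>m\<leftarrow>ms. - m - 1)"
  by (simp add: word_index_def c_word_def)

lemma cword_append: "cword (w1 @ w2) v = cword w1 (cword w2 v)"
  by (induction w1) auto

definition iter_deriv :: "'n list \<Rightarrow> (('k, 'n) vec \<Rightarrow> 'k) \<Rightarrow> ('k, 'n) vec \<Rightarrow> 'k"
  where "iter_deriv is f = foldr (partial_deriv U) is f"

lemma iter_deriv_smooth: "f \<in> smooth_ring U \<Longrightarrow> iter_deriv is f \<in> smooth_ring U"
  by (induction "is") (auto simp: iter_deriv_def intro: smooth_partial_deriv[OF open_U])

text \<open>
  The recursion for \<open>taylor\<close> differentiates on the inside, the definition of \<open>field_term\<close> on the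
  outside.
\<close>

lemma iter_deriv_Cons: "f \<in> smooth_ring U \<Longrightarrow> iter_deriv (i # is) f = iter_deriv is (partial_deriv U i f)"
proof (induction "is")
  case (Cons j js)
  have "iter_deriv (i # j # js) f = partial_deriv U i (partial_deriv U j (iter_deriv js f))"
    by (simp add: iter_deriv_def)
  also have "\<dots> = partial_deriv U j (iter_deriv (i # js) f)"
    using partial_deriv_commute[OF open_U iter_deriv_smooth[OF Cons.prems]] by (simp add: iter_deriv_def)
  finally show ?case using Cons by (simp add: iter_deriv_def)
qed (simp add: iter_deriv_def)

definition word_term :: "(('k, 'n) vec \<Rightarrow> 'k) \<Rightarrow> ('n \<times> int) list \<Rightarrow> (('n + 'n) \<times> int) list \<Rightarrow> ('k, 'n) vec_fun \<Rightarrow> ('k, 'n) vec_fun"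
  where "word_term f u w v = fun_mult (iter_deriv (map fst u) f) (cword (gamma_word u @ w) v)"

lemma word_term_Cons:
  "f \<in> smooth_ring U \<Longrightarrow> word_term f ((i, m) # u) w v = coord (Inl i) m (word_term (partial_deriv U i f) u w v)"
  unfolding word_term_def by (simp add: iter_deriv_Cons fun_mult_coord)

lemma word_term_le:
  assumes f: "f \<in> smooth_ring U" and v: "v \<in> fock_le U j"
  shows "word_term f u w v \<in> fock_le U j"
  unfolding word_term_def by (intro fun_mult_fock_le cword_le v iter_deriv_smooth f)

lemma word_term_order:
  assumes f: "f \<in> smooth_ring U" and v: "v \<in> fock_le U j"
  shows "word_term f u (c_word cs ms) v \<in> fock_le U (j + word_index (gamma_word u @ c_word cs ms) - int (length u))"
  unfolding word_term_def
  using fun_mult_fock_le[OF cword_order[OF v, of "gamma_word u @ c_word cs ms"] iter_deriv_smooth[OF f]]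
  by (simp only: length_filter_gamma)

text \<open>
  The convolution indexed by the mode \<open>m\<close> of the left factor, as it arises from words.
\<close>

lemma conv_modes:
  assumes "finite I" "\<And>m. m \<notin> I \<Longrightarrow> X m (Y (l - m - 1) v) = 0"
  shows "conv X Y l v = (\<Sum>m\<in>I. X m (Y (l - m - 1) v))"
proof -
  have e: "- m - 1 + l = l - m - 1" "- (- m - 1) - 1 = m" for m :: int by simp_all
  have "conv X Y l v = (\<Sum>k\<in>(\<lambda>m. - m - 1) ` I. X (- k - 1) (Y (k + l) v))"
  proof (rule conv_eqI)
    fix k assume "k \<notin> (\<lambda>m. - m - 1) ` I"
    then have "- k - 1 \<notin> I" by force
    from assms(2)[OF this] show "X (- k - 1) (Y (k + l) v) = 0" by (simp add: add.commute)
  qed (simp add: assms)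
  also have "\<dots> = (\<Sum>m\<in>I. X m (Y (l - m - 1) v))"
    by (subst sum.reindex) (simp_all add: inj_on_def e)
  finally show ?thesis .
qed

lemma conv_modes_window:
  assumes "field t X" "field u Y" "v \<in> fock_le U j" "0 \<le> j" "finite I" "{l - j..j} \<subseteq> I"
  shows "conv X Y l v = (\<Sum>m\<in>I. X m (Y (l - m - 1) v))"
proof (rule conv_modes[OF assms(5)])
  fix m assume "m \<notin> I"
  then have "m \<notin> {l - j..j}" using assms(6) by blast
  then have "m < l - j \<or> j < m" by auto
  then show "X m (Y (l - m - 1) v) = 0"
    using conv_term_zero[OF assms(1,2,3), of "- m - 1" l] assms(4) by (auto simp: algebra_simps)
qed

definition gamma_lists :: "nat \<Rightarrow> int \<Rightarrow> ('n \<times> int) list set"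
  where "gamma_lists r l = {u. length u = r \<and> (\<forall>(i, m)\<in>set u. m \<noteq> - 1) \<and> (\<Sum>m\<leftarrow>map snd u. - m - 1) = - l - 1}"

text \<open>
  Splitting off the first letter of a word in the \<open>\<gamma>\<^sup>i - x\<^sub>i\<close> matches the recursion for
  \<open>taylor\<close>; the factor \<open>fact r\<close> is the one that \<open>field_term\<close> divides by.
\<close>

lemma taylor_words:
  assumes f: "f \<in> smooth_ring U" and v: "v \<in> fock U"
  shows "finite {u \<in> gamma_lists r l. word_term f u [] v \<noteq> 0} \<and>
    (\<Sum>u\<in>{u \<in> gamma_lists r l. word_term f u [] v \<noteq> 0}. word_term f u [] v) = scale (fact r) (taylor r f l v)"
  using f
proof (induction r arbitrary: f l)
  case 0
  have g: "gamma_lists 0 l = (if l = - 1 then {[]} else {})"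
    by (auto simp: gamma_lists_def)
  have S: "{u \<in> gamma_lists 0 l. word_term f u [] v \<noteq> 0} = (if l = - 1 \<and> fun_mult f v \<noteq> 0 then {[]} else {})"
    by (auto simp: g word_term_def iter_deriv_def)
  show ?case
    unfolding S by (cases "l = - 1"; cases "fun_mult f v = 0")
      (simp_all add: word_term_def iter_deriv_def fun_field_def)
next
  case (Suc r)
  note f = Suc.prems
  note p = smooth_partial_deriv[OF open_U f]
  obtain j where j: "v \<in> fock_le U j" "0 \<le> j" using v by (rule fock_exhausted)
  define K where "K = (UNIV :: 'n set) \<times> ({l - j..j} - {- 1})"
  define W' where "W' = (\<lambda>(i :: 'n, m). gamma_lists r (l - m - 1))"
  define T' where "T' = (\<lambda>(i, m :: int) u. word_term (partial_deriv U i f) u [] v)"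
  define G where "G = (\<lambda>(i, m). coord (Inl i) m)"
  have K: "finite K" by (simp add: K_def)
  have cover: "\<exists>k\<in>K. \<exists>w'\<in>W' k. T' k w' \<noteq> 0 \<and> w = k # w'"
    if w: "w \<in> gamma_lists (Suc r) l" "word_term f w [] v \<noteq> 0" for w
  proof -
    obtain i m u where wu: "w = (i, m) # u" using w(1) by (cases w) (auto simp: gamma_lists_def)
    have u: "u \<in> gamma_lists r (l - m - 1)" "m \<noteq> - 1" using w(1) by (auto simp: gamma_lists_def wu)
    let ?t = "word_term (partial_deriv U i f) u [] v"
    have ne: "coord (Inl i) m ?t \<noteq> 0" using w(2) by (simp add: wu word_term_Cons[OF f])
    then have t: "?t \<noteq> 0" by auto
    have "?t \<in> fock_le U (j + word_index (gamma_word u @ c_word [] []) - int (length u))"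
      using word_term_order[OF p j(1), of i u "[]" "[]"] by simp
    then have "0 \<le> j + word_index (gamma_word u @ c_word [] []) - int (length u)" using t fock_le_negative by force
    moreover have "word_index (gamma_word u @ c_word [] []) = - (l - m - 1) - 1"
      using u(1) by (simp add: word_index_gamma gamma_lists_def)
    ultimately have "l - j \<le> m" by simp
    moreover have "m \<le> j"
      using ne field_vanish[OF field_coord word_term_le[OF p j(1)], of m "Inl i" i u "[]"] j(2) by force
    ultimately have "(i, m) \<in> K" using u(2) by (simp add: K_def)
    then show ?thesis using u(1) t by (intro bexI[of _ "(i, m)"] bexI[of _ u]) (auto simp: W'_def T'_def wu)
  qed
  have trm: "k # w' \<in> gamma_lists (Suc r) l \<and> word_term f (k # w') [] v = G k (T' k w')"
    if "k \<in> K" "w' \<in> W' k" for k w'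
    using that word_term_Cons[OF f] by (cases k) (auto simp: W'_def K_def T'_def G_def gamma_lists_def)
  have fin: "finite {w' \<in> W' k. T' k w' \<noteq> 0}" for k
    by (cases k) (simp only: W'_def T'_def case_prod_conv conjunct1[OF Suc.IH[OF p]])
  have Gs: "G k (\<Sum>w'\<in>{w' \<in> W' k. T' k w' \<noteq> 0}. T' k w') = (\<Sum>w'\<in>{w' \<in> W' k. T' k w' \<noteq> 0}. G k (T' k w'))" for k
    unfolding G_def
    by (cases k) (auto simp: T'_def intro!: field_sum[OF field_coord] fock_le_fock[OF word_term_le[OF p j(1)]])
  note sp = sum_over_fibres[where T = "\<lambda>w. word_term f w [] v" and W = "gamma_lists (Suc r) l" and \<Phi> = "(#)" and T' = T' and G = G,
      OF K cover trm _ fin Gs, simplified]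
  have "(\<Sum>u\<in>{u \<in> gamma_lists (Suc r) l. word_term f u [] v \<noteq> 0}. word_term f u [] v)
    = (\<Sum>k\<in>K. G k (\<Sum>w'\<in>{w' \<in> W' k. T' k w' \<noteq> 0}. T' k w'))" by (rule sp(2))
  also have "\<dots> = (\<Sum>(i, m)\<in>K. coord (Inl i) m (scale (fact r) (taylor r (partial_deriv U i f) (l - m - 1) v)))"
    by (rule sum.cong[OF refl]) (simp only: W'_def T'_def G_def case_prod_beta conjunct2[OF Suc.IH[OF p]])
  also have "\<dots> = scale (fact r) (\<Sum>i\<in>UNIV. \<Sum>m\<in>{l - j..j} - {- 1}. coord (Inl i) m (taylor r (partial_deriv U i f) (l - m - 1) v))"
    unfolding K_def sum.cartesian_product[symmetric] coord_scale vec_fun.scale_sum_right ..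
  also have "(\<Sum>i\<in>UNIV. \<Sum>m\<in>{l - j..j} - {- 1}. coord (Inl i) m (taylor r (partial_deriv U i f) (l - m - 1) v))
    = (\<Sum>i\<in>UNIV. conv (coord (Inl i)) (taylor r (partial_deriv U i f)) l v)"
  proof (rule sum.cong[OF refl])
    fix i
    have "conv (coord (Inl i)) (taylor r (partial_deriv U i f)) l v
      = (\<Sum>m\<in>{l - j..j}. coord (Inl i) m (taylor r (partial_deriv U i f) (l - m - 1) v))"
      by (rule conv_modes_window[OF field_coord field_taylor[OF p] j]) auto
    also have "\<dots> = (\<Sum>m\<in>{l - j..j} - {- 1}. coord (Inl i) m (taylor r (partial_deriv U i f) (l - m - 1) v))"
      by (rule sum.mono_neutral_right) (auto simp: coord_def)
    finally show "(\<Sum>m\<in>{l - j..j} - {- 1}. coord (Inl i) m (taylor r (partial_deriv U i f) (l - m - 1) v))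
      = conv (coord (Inl i)) (taylor r (partial_deriv U i f)) l v" ..
  qed
  also have "scale (fact r) \<dots> = scale (fact (Suc r)) (taylor (Suc r) f l v)"
    by (simp add: mult.commute del: of_nat_Suc)
  finally show ?case using sp(1) by (intro conjI)
qed

lemma field_term_c:
  assumes v: "v \<in> fock U" and w: "(u, ms) \<in> mode_words (length cs) l"
  shows "field_term U hbar f (map CF cs) v (u, ms) = scale (1 / fact (length u)) (word_term f u (c_word cs ms) v)"
proof -
  have "proper_word (gamma_word u @ c_word cs ms)"
    using w by (auto simp: proper_gamma_word proper_c_word mode_words_def)
  from nop_cword[OF v this] show ?thesis
    by (simp add: field_term_def word_term_def iter_deriv_def word_gens_gamma word_gens_c)
qed

lemma field_term_c_le:
  assumes f: "f \<in> smooth_ring U" and v: "v \<in> fock_le U j" and w: "(u, ms) \<in> mode_words (length cs) l"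
  shows "field_term U hbar f (map CF cs) v (u, ms) \<in> fock_le U j"
    and "field_term U hbar f (map CF cs) v (u, ms) \<in> fock_le U (j - l - 1 - int (length u))"
proof -
  have "word_index (gamma_word u @ c_word cs ms) = - l - 1"
    using w by (auto simp: word_index_append word_index_gamma word_index_c mode_words_def)
  then have e: "j + word_index (gamma_word u @ c_word cs ms) - int (length u) = j - l - 1 - int (length u)"
    by simp
  show "field_term U hbar f (map CF cs) v (u, ms) \<in> fock_le U (j - l - 1 - int (length u))"
    using fock_le_scale[OF word_term_order[OF f v, of u cs ms]]
    by (simp only: field_term_c[OF fock_le_fock[OF v] w] e)
  show "field_term U hbar f (map CF cs) v (u, ms) \<in> fock_le U j"
    using fock_le_scale[OF word_term_le[OF f v]] by (simp add: field_term_c[OF fock_le_fock[OF v] w])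
qed

lemma normal_field_func:
  assumes f: "f \<in> smooth_ring U" and v: "v \<in> fock U"
  shows "finite {w \<in> mode_words 0 l. field_term U hbar f [] v w \<noteq> 0} \<and> normal_field U hbar f [] l v = func f l v"
proof -
  obtain j where j: "v \<in> fock_le U j" "0 \<le> j" using v by (rule fock_exhausted)
  define R where "R = nat (j - l - 1)"
  have R: "j - l - 1 \<le> int R" by (simp add: R_def)
  have ft: "field_term U hbar f [] v (u, []) = scale (1 / fact (length u)) (word_term f u [] v)"
    if "(u, []) \<in> mode_words 0 l" for u
    using field_term_c[OF v, of u "[]" "[]" l f] that by simp
  have mw: "(u, ms) \<in> mode_words 0 l \<longleftrightarrow> ms = [] \<and> u \<in> gamma_lists (length u) l" for u ms
    by (auto simp: mode_words_def gamma_lists_def)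
  have cover: "\<exists>r\<in>{..R}. \<exists>u\<in>gamma_lists r l. word_term f u [] v \<noteq> 0 \<and> w = (u, [])"
    if w: "w \<in> mode_words 0 l" "field_term U hbar f [] v w \<noteq> 0" for w
  proof -
    obtain u where u: "w = (u, [])" "u \<in> gamma_lists (length u) l" using w(1) mw by (cases w) auto
    have "word_term f u [] v \<noteq> 0" using w ft by (auto simp: u(1))
    moreover have "field_term U hbar f [] v (u, []) \<in> fock_le U (j - l - 1 - int (length u))"
      using field_term_c_le(2)[OF f j(1), of u "[]" "[]" l] w(1) by (simp add: u(1))
    then have "length u \<le> R" using w(2) fock_le_negative R by (force simp: u(1))
    ultimately show ?thesis using u by auto
  qed
  have trm: "(u, []) \<in> mode_words 0 l \<and> field_term U hbar f [] v (u, []) = scale (1 / fact r) (word_term f u [] v)"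
    if "r \<in> {..R}" "u \<in> gamma_lists r l" for r u
    using that ft[of u] mw[of u "[]"] by (auto simp: gamma_lists_def)
  have inj: "r = r' \<and> u = u'" if "u \<in> gamma_lists r l" "u' \<in> gamma_lists r' l" "(u, []) = (u', [])" for r r' u u'
    using that by (auto simp: gamma_lists_def)
  note sp = sum_over_fibres[where T = "field_term U hbar f [] v" and W = "mode_words 0 l" and K = "{..R}" and
      \<Phi> = "\<lambda>r u. (u, [])" and T' = "\<lambda>r u. word_term f u [] v" and G = "\<lambda>r. scale (1 / fact r)" and
      W' = "\<lambda>r. gamma_lists r l", OF _ cover trm inj conjunct1[OF taylor_words[OF f v]] vec_fun.scale_sum_right]
  have "normal_field U hbar f [] l v = (\<Sum>r\<le>R. scale (1 / fact r) (scale (fact r) (taylor r f l v)))"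
    unfolding normal_field_def using sp(2) by (simp add: conjunct2[OF taylor_words[OF f v]])
  also have "\<dots> = func f l v" by (simp add: func_window[OF f j(1) R])
  finally show ?thesis using sp(1) by (intro conjI) simp_all
qed

lemma mode_words_Cons:
  "(u, m # ms) \<in> mode_words (Suc n) l \<longleftrightarrow> (u, ms) \<in> mode_words n (l - m - 1)"
  by (auto simp: mode_words_def)

text \<open>
  Splitting off the mode of the first \<open>c\<close> matches the recursion for \<open>cfield\<close>.
\<close>

lemma normal_field_cfield:
  assumes f: "f \<in> smooth_ring U" and v: "v \<in> fock U"
  shows "finite {w \<in> mode_words (length cs) l. field_term U hbar f (map CF cs) v w \<noteq> 0} \<and>
    normal_field U hbar f (map CF cs) l v = cfield f cs l v"
proof (induction cs arbitrary: l)
  case Nil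
  then show ?case using normal_field_func[OF f v] by (simp only: list.size list.map cfield.simps)
next
  case (Cons i cs)
  obtain j where j: "v \<in> fock_le U j" "0 \<le> j" using v by (rule fock_exhausted)
  let ?T = "field_term U hbar f (map CF (i # cs)) v" and ?T' = "field_term U hbar f (map CF cs) v"
  let ?\<Phi> = "\<lambda>m (w :: ('n \<times> int) list \<times> int list). (fst w, m # snd w)"
  have ft: "?T (u, m # ms) = coord (Inr i) m (?T' (u, ms))" if "(u, ms) \<in> mode_words (length cs) (l - m - 1)" for u m ms
  proof -
    have c: "cword (gamma_word u) (coord (Inr i) m x) = coord (Inr i) m (cword (gamma_word u) x)" if "x \<in> fock U" for x
      using coord_cword[OF that, of "Inr i" m "gamma_word u"] by simp
    have "(u, m # ms) \<in> mode_words (length (i # cs)) l" using that by (simp add: mode_words_Cons)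
    from field_term_c[OF v this] field_term_c[OF v that] show ?thesis
      by (simp add: word_term_def cword_append c[OF cword_fock[OF v]] fun_mult_coord coord_scale)
  qed
  have cover: "\<exists>m\<in>{l - j..j}. \<exists>w'\<in>mode_words (length cs) (l - m - 1). ?T' w' \<noteq> 0 \<and> w = ?\<Phi> m w'"
    if w: "w \<in> mode_words (length (i # cs)) l" "?T w \<noteq> 0" for w
  proof -
    obtain u m ms where wu: "w = (u, m # ms)"
      using w(1) by (cases w; cases "snd w") (auto simp: mode_words_def)
    have w': "(u, ms) \<in> mode_words (length cs) (l - m - 1)" using w(1) by (simp add: wu mode_words_Cons)
    have ne: "coord (Inr i) m (?T' (u, ms)) \<noteq> 0" using w(2) ft[OF w'] by (simp add: wu)
    then have ne': "?T' (u, ms) \<noteq> 0" by auto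
    have "m \<le> j"
      using ne field_vanish[OF field_coord field_term_c_le(1)[OF f j(1) w'], of m "Inr i"] j(2) by force
    moreover have "0 \<le> j - (l - m - 1) - 1 - int (length u)"
      using ne' fock_le_negative[OF field_term_c_le(2)[OF f j(1) w']] by force
    ultimately show ?thesis using w' ne' by (intro bexI[of _ m] bexI[of _ "(u, ms)"]) (auto simp: wu)
  qed
  have trm: "?\<Phi> m w' \<in> mode_words (length (i # cs)) l \<and> ?T (?\<Phi> m w') = coord (Inr i) m (?T' w')"
    if "m \<in> {l - j..j}" "w' \<in> mode_words (length cs) (l - m - 1)" for m w'
    using that ft[of "fst w'" "snd w'" m] by (simp add: mode_words_Cons)
  have inj: "m = m' \<and> w = w'" if "?\<Phi> m w = ?\<Phi> m' w'" for m m' w w'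
    using that by (simp add: prod_eq_iff)
  have Gs: "coord (Inr i) m (\<Sum>w'\<in>{w' \<in> mode_words (length cs) (l - m - 1). ?T' w' \<noteq> 0}. ?T' w')
    = (\<Sum>w'\<in>{w' \<in> mode_words (length cs) (l - m - 1). ?T' w' \<noteq> 0}. coord (Inr i) m (?T' w'))" for m
    by (rule field_sum[OF field_coord]) (use field_term_c_le(1)[OF f j(1)] fock_le_fock in fastforce)
  note sp = sum_over_fibres[where T = ?T and T' = "\<lambda>_. ?T'" and W = "mode_words (length (i # cs)) l"
      and W' = "\<lambda>m. mode_words (length cs) (l - m - 1)" and G = "coord (Inr i)" and K = "{l - j..j}" and \<Phi> = ?\<Phi>,
      OF _ cover trm inj conjunct1[OF Cons.IH] Gs]
  have "normal_field U hbar f (map CF (i # cs)) l v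
    = (\<Sum>m\<in>{l - j..j}. coord (Inr i) m (normal_field U hbar f (map CF cs) (l - m - 1) v))"
    unfolding normal_field_def length_map by (rule sp(2)) simp_all
  also have "\<dots> = (\<Sum>m\<in>{l - j..j}. coord (Inr i) m (cfield f cs (l - m - 1) v))"
    by (simp only: conjunct2[OF Cons.IH])
  also have "\<dots> = cfield f (i # cs) l v"
    unfolding cfield.simps by (rule conv_modes_window[OF field_coord field_cfield[OF f] j, symmetric]) auto
  finally have nf: "normal_field U hbar f (map CF (i # cs)) l v = cfield f (i # cs) l v" .
  have "finite {w \<in> mode_words (length (i # cs)) l. ?T w \<noteq> 0}" by (rule sp(1)) simp_all
  then show ?case using nf by (rule conjI)
qed

definition insert_at :: "nat \<Rightarrow> 'a \<Rightarrow> 'a list \<Rightarrow> 'a list"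
  where "insert_at r x xs = take r xs @ x # drop r xs"

lemma c_word_append: "length cs1 = length ms1 \<Longrightarrow> c_word (cs1 @ cs2) (ms1 @ ms2) = c_word cs1 ms1 @ c_word cs2 ms2"
  by (simp add: c_word_def)

lemma mode_words_insert:
  assumes "r \<le> n"
  shows "length ms = n \<Longrightarrow> (u, insert_at r m ms) \<in> mode_words (Suc n) l \<longleftrightarrow> (u, ms) \<in> mode_words n (l - m - 1)"
proof -
  assume "length ms = n"
  have "(\<Sum>m\<leftarrow>ms. - m - 1) = (\<Sum>m\<leftarrow>take r ms. - m - 1) + (\<Sum>m\<leftarrow>drop r ms. - m - 1)"
    by (subst append_take_drop_id[of r ms, symmetric], subst map_append, subst sum_list_append) simp
  then show ?thesis using \<open>length ms = n\<close> assms by (auto simp: mode_words_def insert_at_def)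
qed

lemma fun_mult_mom_gen:
  assumes "v \<in> fock U" "f \<in> smooth_ring U" "m < 0"
  shows "fun_mult f (gm (mom_gen b) m v) = gm (mom_gen b) m (fun_mult f v)"
  using mom_fun_mult[OF assms(1,2), of b m] assms(3)
  by (cases b) (auto simp: gm_mom_gen elementary_minus)

text \<open>
  The two ways of combining a momentum mode with an operator in coordinates that normal ordering
  prescribes.
\<close>

definition place_mom :: "'n + 'n \<Rightarrow> int \<Rightarrow> (('k, 'n) vec_fun \<Rightarrow> ('k, 'n) vec_fun) \<Rightarrow> ('k, 'n) vec_fun \<Rightarrow> ('k, 'n) vec_fun"
  where "place_mom b m X v = (if m < 0 then gm (mom_gen b) m (X v) else X (gm (mom_gen b) m v))"

text \<open>
  Splitting off the momentum letter from all words, wherever it stands among the \<open>c\<close>'s. An odd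
  momentum passes an even number of \<open>c\<close>'s on either side, so no sign remains. The window
  \<open>{- M..M}\<close> works because annihilation modes beyond \<open>M\<close> kill \<open>v\<close> and a creation mode \<open>m < - M\<close>
  would leave a coordinate factor with too low a power of \<open>z\<close>.
\<close>

lemma normal_field_mom:
  assumes f: "f \<in> smooth_ring U" and j: "v \<in> fock_le U j"
    and par: "parity b \<Longrightarrow> even (length cs1) \<and> even (length cs2)"
    and M: "0 \<le> M" "j - N \<le> M" "\<And>m. M < m \<Longrightarrow> mom b m v = 0"
  shows "normal_field U hbar f (map CF cs1 @ mom_gen b # map CF cs2) N v
    = (\<Sum>m\<in>{- M..M}. place_mom b m (cfield f (cs1 @ cs2) (N - m - 1)) v)"
proof -
  note v = fock_le_fock[OF j]
  define n r where "n = length (cs1 @ cs2)" and "r = length cs1"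
  let ?as = "map CF cs1 @ mom_gen b # map CF cs2" and ?bs = "map CF (cs1 @ cs2)"
  let ?T = "field_term U hbar f ?as v"
  (* T' is a term without the momentum letter, evaluated after the momentum has acted
     if m \<ge> 0; G applies the momentum afterwards if m < 0 *)
  define T' where "T' m = field_term U hbar f ?bs (if m < 0 then v else gm (mom_gen b) m v)" for m
  define G where "G m = (if m < 0 then gm (mom_gen b) m else (\<lambda>x. x))" for m
  let ?\<Phi> = "\<lambda>m (w :: ('n \<times> int) list \<times> int list). (fst w, insert_at r m (snd w))"
  have rn: "r \<le> n" by (simp add: r_def n_def)
  have fck: "(if m < 0 then v else gm (mom_gen b) m v) \<in> fock U" for m
    using v gm_mom_gen_fock by simp
  have ft: "?T (u, insert_at r m ms) = G m (T' m (u, ms))" if w: "(u, ms) \<in> mode_words n (N - m - 1)" for u m ms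
  proof -
    have len: "length ms = n" using w by (simp add: mode_words_def)
    define ms1 ms2 where "ms1 = take r ms" and "ms2 = drop r ms"
    have ms: "ms = ms1 @ ms2" "length ms1 = length cs1" "length ms2 = length cs2"
      using len by (auto simp: ms1_def ms2_def r_def n_def)
    have ins: "insert_at r m ms = ms1 @ m # ms2" by (simp add: insert_at_def ms1_def ms2_def)
    have pr: "proper_word (gamma_word u @ c_word cs1 ms1)" "proper_word (c_word cs2 ms2)"
      using w by (auto simp: proper_gamma_word proper_c_word mode_words_def)
    have letters: "map (\<lambda>(i, m). (Gamma i, m)) u @ zip ?as (insert_at r m ms)
      = word_gens (gamma_word u @ c_word cs1 ms1) @ (mom_gen b, m) # word_gens (c_word cs2 ms2)"
      using ms(2,3) by (simp add: ins word_gens_gamma word_gens_c)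
    have sg: "swap_sign (parity b) (odd_word (gamma_word u @ c_word cs1 ms1)) = (1 :: 'k)"
      "swap_sign (parity b) (odd_word (c_word cs2 ms2)) = (1 :: 'k)"
      using par ms by (auto simp: swap_sign_def odd_c_word)
    have cat: "(gamma_word u @ c_word cs1 ms1) @ c_word cs2 ms2 = gamma_word u @ c_word (cs1 @ cs2) ms"
      using ms by (simp add: c_word_append)
    have nop: "nop U hbar (map (\<lambda>(i, m). (Gamma i, m)) u @ zip ?as (insert_at r m ms)) v
      = G m (cword (gamma_word u @ c_word (cs1 @ cs2) ms) (if m < 0 then v else gm (mom_gen b) m v))"
      unfolding letters nop_one_momentum[OF v pr] sg cat by (simp add: G_def)
    have "T' m (u, ms) = scale (1 / fact (length u)) (word_term f u (c_word (cs1 @ cs2) ms) (if m < 0 then v else gm (mom_gen b) m v))"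
      unfolding T'_def by (rule field_term_c[OF fck]) (use w in \<open>simp add: n_def\<close>)
    moreover have "?T (u, insert_at r m ms) = scale (1 / fact (length u)) (fun_mult (iter_deriv (map fst u) f)
        (nop U hbar (map (\<lambda>(i, m). (Gamma i, m)) u @ zip ?as (insert_at r m ms)) v))"
      by (simp add: field_term_def iter_deriv_def)
    ultimately show ?thesis
      unfolding nop word_term_def
      using fun_mult_mom_gen[OF cword_fock[OF v] iter_deriv_smooth[OF f]]
      by (auto simp: G_def gm_mom_gen_scale fock_le_fock[OF fun_mult_fock_le[OF cword_le[OF j] iter_deriv_smooth[OF f]]])
  qed
  have T'fock: "T' m w' \<in> fock U" if "w' \<in> mode_words n (N - m - 1)" for m w'
  proof -
    obtain j' where "(if m < 0 then v else gm (mom_gen b) m v) \<in> fock_le U j'" using fck fock_exhausted by metis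
    moreover have "(fst w', snd w') \<in> mode_words (length (cs1 @ cs2)) (N - m - 1)"
      using that by (simp add: n_def)
    ultimately have "field_term U hbar f ?bs (if m < 0 then v else gm (mom_gen b) m v) (fst w', snd w') \<in> fock U"
      by (intro fock_le_fock[OF field_term_c_le(1)[OF f]])
    then show ?thesis by (simp only: T'_def prod.collapse)
  qed
  have T'zero: "T' m (u, ms) = 0" if "M < m" "(u, ms) \<in> mode_words n (N - m - 1)" for m u ms
  proof -
    have z: "(if m < 0 then v else gm (mom_gen b) m v) = 0" using M that by (simp add: gm_mom_gen)
    have "cword w 0 = 0" for w using cword_scale[of w 0 0] by (simp only: vec_fun.scale_zero_left)
    then have "word_term f u (c_word (cs1 @ cs2) ms) 0 = 0" by (simp add: word_term_def elementary_zero)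
    moreover have "T' m (u, ms) = scale (1 / fact (length u)) (word_term f u (c_word (cs1 @ cs2) ms) 0)"
      unfolding T'_def z by (rule field_term_c[OF fock_zero]) (use that in \<open>simp add: n_def\<close>)
    ultimately show ?thesis by (simp only: vec_fun.scale_zero_right)
  qed
  have G0: "G m 0 = 0" for m by (simp add: G_def gm_mom_gen)
  have cover: "\<exists>m\<in>{- M..M}. \<exists>w'\<in>mode_words n (N - m - 1). T' m w' \<noteq> 0 \<and> w = ?\<Phi> m w'"
    if w: "w \<in> mode_words (Suc n) N" "?T w \<noteq> 0" for w
  proof -
    obtain u ms0 where wu: "w = (u, ms0)" by (cases w)
    have len: "length ms0 = Suc n" using w(1) by (simp add: wu mode_words_def)
    define m ms where "m = ms0 ! r" and "ms = take r ms0 @ drop (Suc r) ms0"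
    have r: "r < length ms0" using rn len by simp
    have ins: "insert_at r m ms = ms0" and lms: "length ms = n"
      using id_take_nth_drop[OF r] r len by (simp_all add: insert_at_def m_def ms_def)
    have w': "(u, ms) \<in> mode_words n (N - m - 1)"
      using w(1) mode_words_insert[OF rn lms, of u m N] by (simp add: wu ins)
    have ne: "T' m (u, ms) \<noteq> 0"
    proof
      assume "T' m (u, ms) = 0"
      then have "?T w = 0" using ft[OF w'] by (simp only: wu ins G0)
      then show False using w(2) by (rule notE[rotated])
    qed
    then have "m \<le> M" using T'zero[OF _ w'] by force
    moreover have "- M \<le> m"
    proof (cases "m < 0")
      case True
      then have T': "T' m = field_term U hbar f ?bs v" by (simp add: T'_def)
      have "(u, ms) \<in> mode_words (length (cs1 @ cs2)) (N - m - 1)" using w' by (simp add: n_def)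
      from field_term_c_le(2)[OF f j this] have "0 \<le> j - (N - m - 1) - 1 - int (length u)"
        using ne fock_le_negative unfolding T' by force
      then show ?thesis using M by simp
    qed (use M in simp)
    ultimately show ?thesis using w' ne by (intro bexI[of _ m] bexI[of _ "(u, ms)"]) (auto simp: wu ins)
  qed
  have trm: "?\<Phi> m w' \<in> mode_words (Suc n) N \<and> ?T (?\<Phi> m w') = G m (T' m w')"
    if "m \<in> {- M..M}" "w' \<in> mode_words n (N - m - 1)" for m w'
  proof -
    have "length (snd w') = n" using that(2) by (auto simp: mode_words_def)
    then show ?thesis
      using that ft[of "fst w'" "snd w'" m] mode_words_insert[OF rn, of "snd w'" "fst w'" m N] by simp
  qed
  have inj: "m = m' \<and> w = w'"
    if "w \<in> mode_words n (N - m - 1)" "w' \<in> mode_words n (N - m' - 1)" "?\<Phi> m w = ?\<Phi> m' w'" for m m' w w'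
  proof -
    have l: "length (snd w) = n" "length (snd w') = n" using that(1,2) by (auto simp: mode_words_def)
    have "take r (snd w) = take r (snd w')" "m # drop r (snd w) = m' # drop r (snd w')"
      using that(3) l rn by (auto simp: insert_at_def append_eq_append_conv)
    then have eq: "take r (snd w) @ drop r (snd w) = take r (snd w') @ drop r (snd w')" "m = m'" by simp_all
    have "snd w = snd w'" using eq(1) unfolding append_take_drop_id .
    then show ?thesis using that(3) eq(2) by (simp add: prod_eq_iff)
  qed
  have fin: "finite {w' \<in> mode_words n (N - m - 1). T' m w' \<noteq> 0}" for m
    unfolding T'_def n_def by (rule conjunct1[OF normal_field_cfield[OF f fck]])
  have Gs: "G m (\<Sum>w'\<in>{w' \<in> mode_words n (N - m - 1). T' m w' \<noteq> 0}. T' m w')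
    = (\<Sum>w'\<in>{w' \<in> mode_words n (N - m - 1). T' m w' \<noteq> 0}. G m (T' m w'))" for m
  proof (cases "m < 0")
    case True
    then have G: "G m x = scale (if parity b then 1 else - 1) (mom b m x)" for x
      by (simp only: G_def if_True gm_mom_gen)
    show ?thesis unfolding G vec_fun.scale_sum_right[symmetric]
      by (rule arg_cong[where f = "scale _"], rule mom_sum) (rule T'fock, simp)
  qed (simp add: G_def)
  have nf: "(\<Sum>w'\<in>{w' \<in> mode_words n (N - m - 1). T' m w' \<noteq> 0}. T' m w')
    = cfield f (cs1 @ cs2) (N - m - 1) (if m < 0 then v else gm (mom_gen b) m v)" for m
    unfolding T'_def n_def conjunct2[OF normal_field_cfield[OF f fck], symmetric]
    unfolding normal_field_def length_map ..
  note sp = sum_over_fibres(2)[where T = ?T and T' = T' and W = "mode_words (Suc n) N"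
      and W' = "\<lambda>m. mode_words n (N - m - 1)" and G = G and K = "{- M..M}" and \<Phi> = ?\<Phi>,
      OF _ cover trm inj fin Gs]
  have "normal_field U hbar f ?as N v
    = (\<Sum>m\<in>{- M..M}. G m (\<Sum>w'\<in>{w' \<in> mode_words n (N - m - 1). T' m w' \<noteq> 0}. T' m w'))"
    unfolding normal_field_def
    using sp by (simp add: n_def)
  also have "\<dots> = (\<Sum>m\<in>{- M..M}. place_mom b m (cfield f (cs1 @ cs2) (N - m - 1)) v)"
    unfolding nf by (rule sum.cong) (auto simp: place_mom_def G_def)
  finally show ?thesis .
qed

section \<open>The differential as a sum over modes\<close>

lemma mom_eventually_zero:
  assumes v: "v \<in> fock U"
  shows "\<exists>M\<ge>0. \<forall>m>M. \<forall>a. mom a m v = 0"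
proof -
  define supp where "supp = {mn. v mn \<noteq> 0}"
  define E where "E = (\<Union>mn\<in>supp. set_mset (fst mn))"
  define S where "S = (\<Union>mn\<in>supp. snd mn)"
  have fs: "finite supp" using v by (simp add: fock_def supp_def)
  have "finite (snd mn)" if "mn \<in> supp" for mn
    using that odd_finite_fock[OF v] unfolding supp_def odd_finite_def by (cases mn) auto
  then have fin: "finite E" "finite S" using fs by (auto simp: E_def S_def)
  define N where "N = Max (insert 0 ((\<lambda>g. case g of GammaV i m \<Rightarrow> m | BetaV i m \<Rightarrow> 0) ` E \<union>
      (\<lambda>s. case s of CV i m \<Rightarrow> m | BV i m \<Rightarrow> 0) ` S))"
  have NE: "m \<le> N" if "GammaV i m \<in> E" for i m
    unfolding N_def using that fin by (intro Max_ge) (auto intro!: image_eqI[of _ _ "GammaV i m"])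
  have NS: "m \<le> N" if "CV i m \<in> S" for i m
    unfolding N_def using that fin by (intro Max_ge) (auto intro!: image_eqI[of _ _ "CV i m"])
  have ed: "even_deriv g v = 0" if "g \<notin> E" for g
  proof -
    have "v (add_mset g M, T) = 0" for M T
      using that by (force simp: E_def supp_def)
    then show ?thesis by (auto simp: even_deriv_def fun_eq_iff)
  qed
  have od: "odd_deriv s v = 0" if "s \<notin> S" for s
  proof -
    have "v (M, insert s T) = 0" for M T
      using that by (force simp: S_def supp_def)
    then show ?thesis by (auto simp: odd_deriv_def fun_eq_iff)
  qed
  have "mom a m v = 0" if "int N < m" for a m
  proof -
    have "nat (m + 1) > N" using that by linarith
    then have "GammaV i (nat (m + 1)) \<notin> E" "CV i (nat (m + 1)) \<notin> S" for i
      using NE NS by (meson not_le)+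
    then show ?thesis using that ed od by (cases a) (auto simp: mom_simps)
  qed
  then show ?thesis by (intro exI[of _ "int N"]) auto
qed

lemma place_mom_scale_field:
  assumes "\<And>v. v \<in> fock U \<Longrightarrow> X v = scale c (Y v)" "\<And>v. v \<in> fock U \<Longrightarrow> Y v \<in> fock U" "v \<in> fock U"
  shows "place_mom b m X v = scale c (place_mom b m Y v)"
  using assms gm_mom_gen_scale[of "Y v" b m c] gm_mom_gen_fock[of v b m] by (simp add: place_mom_def)

lemma place_mom_sum_field:
  assumes "\<And>x v. v \<in> fock U \<Longrightarrow> Y x v \<in> fock U" "v \<in> fock U"
  shows "place_mom b m (\<lambda>v. \<Sum>x\<in>A. Y x v) v = (\<Sum>x\<in>A. place_mom b m (Y x) v)"
proof (cases "m < 0")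
  case True
  then show ?thesis
    by (simp only: place_mom_def if_True gm_mom_gen mom_sum[OF assms(1)[OF assms(2)]] vec_fun.scale_sum_right)
qed (simp add: place_mom_def)

end

context poisson_bcbg
begin

abbreviation Q :: "('k, 'n) vec_fun \<Rightarrow> ('k, 'n) vec_fun"
  where "Q \<equiv> d_qL U hbar P"

text \<open>
  The contribution of the momentum mode \<open>m\<close> to the residue: \<open>D a\<close> enters with the complementary
  mode \<open>- m - 1\<close>.
\<close>

definition ordered_mode :: "'n + 'n \<Rightarrow> int \<Rightarrow> ('k, 'n) vec_fun \<Rightarrow> ('k, 'n) vec_fun"
  where "ordered_mode a m v = (if m < 0 then mom a m (D a (- m - 1) v) else D a (- m - 1) (mom a m v))"

lemma D_fock [simp]: "v \<in> fock U \<Longrightarrow> D a l v \<in> fock U"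
  by (rule field_fock[OF field_D])

lemma J_fock [simp]: "v \<in> fock U \<Longrightarrow> J a b l v \<in> fock U"
  by (rule field_fock[OF field_J])

lemmas D_scale = field_scale[OF field_D]
lemmas D_add = field_add[OF field_D]

lemma ordered_mode_place_mom: "ordered_mode a m v = scale (if parity a then 1 else - 1) (place_mom a m (D a (- m - 1)) v)"
  if "v \<in> fock U"
  using that by (cases "m < 0") (simp_all only: ordered_mode_def place_mom_def if_True if_False gm_mom_gen
      D_scale mom_fock vec_fun.scale_scale, simp_all)

lemma ordered_mode_even:
  assumes v: "v \<in> fock U"
  shows "ordered_mode (Inl j) m v = (\<Sum>i\<in>UNIV. scale 2 (place_mom (Inl j) m (cfield (P i j) [i] (- m - 1)) v))"
proof -
  have D: "D (Inl j) l v = (\<Sum>i\<in>UNIV. scale (- 2) (cfield (P i j) [i] l v))" if "v \<in> fock U" for l v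
    using that by (simp only: D_def ddegree.simps form_1 dcoeff.simps nth_Cons_0 cfield_cmult[OF P_smooth])
  have sc: "scale (- 2) (cfield (P i j) [i] l v) \<in> fock U" if "v \<in> fock U" for i l v
    by (rule fock_scale[OF field_fock[OF field_cfield[OF P_smooth] that]])
  have "place_mom (Inl j) m (D (Inl j) (- m - 1)) v
    = place_mom (Inl j) m (\<lambda>v. \<Sum>i\<in>UNIV. scale (- 2) (cfield (P i j) [i] (- m - 1) v)) v"
    using v gm_mom_gen_fock[OF v] D by (simp add: place_mom_def del: cfield.simps)
  also have "\<dots> = (\<Sum>i\<in>UNIV. place_mom (Inl j) m (\<lambda>v. scale (- 2) (cfield (P i j) [i] (- m - 1) v)) v)"
    by (rule place_mom_sum_field[OF sc v])
  also have "\<dots> = (\<Sum>i\<in>UNIV. scale (- 2) (place_mom (Inl j) m (cfield (P i j) [i] (- m - 1)) v))"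
    by (intro sum.cong refl place_mom_scale_field v field_fock[OF field_cfield[OF P_smooth]])
  finally show ?thesis
    by (simp add: ordered_mode_place_mom[OF v] sum_negf[symmetric] del: cfield.simps)
qed

lemma ordered_mode_odd:
  assumes v: "v \<in> fock U"
  shows "ordered_mode (Inr k) m v =
    (\<Sum>i\<in>UNIV. \<Sum>j\<in>UNIV. place_mom (Inr k) m (cfield (partial_deriv U k (P i j)) [i, j] (- m - 1)) v)"
proof -
  have D: "D (Inr k) l v = (\<Sum>i\<in>UNIV. \<Sum>j\<in>UNIV. cfield (partial_deriv U k (P i j)) [i, j] l v)" for l v
    by (simp only: D_def ddegree.simps form_2 dcoeff.simps nth_Cons_0 nth_Cons_Suc)
  have fl: "cfield (partial_deriv U k (P i j)) [i, j] l v \<in> fock U" if "v \<in> fock U" for i j l v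
    by (rule field_fock[OF field_cfield[OF dP_smooth] that])
  have "place_mom (Inr k) m (D (Inr k) (- m - 1)) v
    = place_mom (Inr k) m (\<lambda>v. \<Sum>i\<in>UNIV. \<Sum>j\<in>UNIV. cfield (partial_deriv U k (P i j)) [i, j] (- m - 1) v) v"
    by (simp only: place_mom_def D)
  also have "\<dots> = (\<Sum>i\<in>UNIV. place_mom (Inr k) m (\<lambda>v. \<Sum>j\<in>UNIV. cfield (partial_deriv U k (P i j)) [i, j] (- m - 1) v) v)"
    by (rule place_mom_sum_field[OF fock_sum[OF fl] v])
  also have "\<dots> = (\<Sum>i\<in>UNIV. \<Sum>j\<in>UNIV. place_mom (Inr k) m (cfield (partial_deriv U k (P i j)) [i, j] (- m - 1)) v)"
    by (intro sum.cong refl place_mom_sum_field[OF fl v])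
  finally show ?thesis by (simp only: ordered_mode_place_mom[OF v] parity_simps if_True vec_fun.scale_one)
qed

text \<open>
  The differential is the zero mode of the normally ordered product \<open>\<Sum>\<^sub>a D\<^sup>a p\<^sub>a\<close>. By
  antisymmetry of \<open>P\<close> the terms \<open>c \<beta>\<close> and \<open>- \<beta> c\<close> of the field give equal contributions after
  relabelling.
\<close>

lemma Q_modes:
  assumes v: "v \<in> fock U"
  shows "\<exists>M0\<ge>0. \<forall>M\<ge>M0. Q v = (\<Sum>m\<in>{- M..M}. \<Sum>a\<in>UNIV. ordered_mode a m v)"
proof -
  obtain j0 where j: "v \<in> fock_le U j0" "0 \<le> j0" using v by (rule fock_exhausted)
  obtain M1 where M1: "0 \<le> M1" "\<And>m a. M1 < m \<Longrightarrow> mom a m v = 0" using mom_eventually_zero[OF v] by auto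
  have "Q v = (\<Sum>m\<in>{- M..M}. \<Sum>a\<in>UNIV. ordered_mode a m v)" if M: "max j0 M1 \<le> M" for M
  proof -
    have M': "0 \<le> M" "j0 - 0 \<le> M" "\<And>m a. M < m \<Longrightarrow> mom a m v = 0" using M M1 j by auto
    define A where "A i j m = place_mom (Inl j) m (cfield (P i j) [i] (- m - 1)) v" for i j m
    have a: "normal_field U hbar (P i j) [CF i, Beta j] 0 v = (\<Sum>m\<in>{- M..M}. A i j m)" for i j
      using normal_field_mom[OF P_smooth j(1) _ M', of "Inl j" "[i]" "[]" i j]
      by (simp add: A_def mom_gen_def del: cfield.simps)
    have b: "normal_field U hbar (P i j) [Beta i, CF j] 0 v = (\<Sum>m\<in>{- M..M}. scale (- 1) (A j i m))" for i j
    proof -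
      have Pneg: "P i j = (\<lambda>x. (- 1) * P j i x)" using P_antisym[of i j] by (simp add: fun_eq_iff)
      have "normal_field U hbar (P i j) [Beta i, CF j] 0 v
        = (\<Sum>m\<in>{- M..M}. place_mom (Inl i) m (cfield (P i j) [j] (- m - 1)) v)"
        using normal_field_mom[OF P_smooth j(1) _ M', of "Inl i" "[]" "[j]" i j]
        by (simp add: mom_gen_def del: cfield.simps)
      also have "\<dots> = (\<Sum>m\<in>{- M..M}. scale (- 1) (A j i m))"
        unfolding A_def
        by (intro sum.cong refl place_mom_scale_field v field_fock[OF field_cfield[OF P_smooth]])
          (subst Pneg, rule cfield_cmult[OF P_smooth])
      finally show ?thesis .
    qed
    have c: "normal_field U hbar (partial_deriv U k (P i j)) [CF i, CF j, BF k] 0 v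
      = (\<Sum>m\<in>{- M..M}. place_mom (Inr k) m (cfield (partial_deriv U k (P i j)) [i, j] (- m - 1)) v)" for i j k
      using normal_field_mom[OF dP_smooth j(1) _ M', of "Inr k" "[i, j]" "[]" k i j]
      by (simp add: mom_gen_def del: cfield.simps)
    have first: "(\<Sum>i\<in>UNIV. \<Sum>j\<in>UNIV. (\<Sum>m\<in>{- M..M}. A i j m) - (\<Sum>m\<in>{- M..M}. scale (- 1) (A j i m)))
      = (\<Sum>m\<in>{- M..M}. \<Sum>j\<in>UNIV. ordered_mode (Inl j) m v)"
    proof -
      have "(\<Sum>i\<in>UNIV. \<Sum>j\<in>UNIV. (\<Sum>m\<in>{- M..M}. A i j m) - (\<Sum>m\<in>{- M..M}. scale (- 1) (A j i m)))
        = (\<Sum>i\<in>UNIV. \<Sum>j\<in>UNIV. \<Sum>m\<in>{- M..M}. A i j m) + (\<Sum>i\<in>UNIV. \<Sum>j\<in>UNIV. \<Sum>m\<in>{- M..M}. A j i m)"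
        unfolding sum.distrib[symmetric] sum_subtractf[symmetric] by simp
      also have "(\<Sum>i\<in>UNIV. \<Sum>j\<in>UNIV. \<Sum>m\<in>{- M..M}. A j i m) = (\<Sum>i\<in>UNIV. \<Sum>j\<in>UNIV. \<Sum>m\<in>{- M..M}. A i j m)"
        by (rule sum.swap)
      also have "(\<Sum>i\<in>UNIV. \<Sum>j\<in>UNIV. \<Sum>m\<in>{- M..M}. A i j m) + (\<Sum>i\<in>UNIV. \<Sum>j\<in>UNIV. \<Sum>m\<in>{- M..M}. A i j m)
        = (\<Sum>i\<in>UNIV. \<Sum>j\<in>UNIV. \<Sum>m\<in>{- M..M}. scale 2 (A i j m))"
        unfolding sum.distrib[symmetric] by (intro sum.cong refl) (simp add: fun_eq_iff scale_apply)
      also have "\<dots> = (\<Sum>j\<in>UNIV. \<Sum>m\<in>{- M..M}. \<Sum>i\<in>UNIV. scale 2 (A i j m))"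
        by (subst sum.swap) (intro sum.cong refl sum.swap)
      also have "\<dots> = (\<Sum>m\<in>{- M..M}. \<Sum>j\<in>UNIV. ordered_mode (Inl j) m v)"
        by (subst sum.swap) (simp only: A_def ordered_mode_even[OF v])
      finally show ?thesis .
    qed
    have second: "(\<Sum>i\<in>UNIV. \<Sum>j\<in>UNIV. \<Sum>k\<in>UNIV. \<Sum>m\<in>{- M..M}.
          place_mom (Inr k) m (cfield (partial_deriv U k (P i j)) [i, j] (- m - 1)) v)
      = (\<Sum>m\<in>{- M..M}. \<Sum>k\<in>UNIV. ordered_mode (Inr k) m v)" (is "?L = _")
    proof -
      have pairs: "(\<Sum>p\<in>A \<times> B. F p) = (\<Sum>x\<in>A. \<Sum>y\<in>B. F (x, y))"
        for A :: "'x set" and B :: "'y set" and F :: "'x \<times> 'y \<Rightarrow> ('k, 'n) vec_fun"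
        by (simp add: sum.cartesian_product)
      let ?B = "\<lambda>i j k m. place_mom (Inr k) m (cfield (partial_deriv U k (P i j)) [i, j] (- m - 1)) v"
      have "?L = (\<Sum>p\<in>UNIV \<times> UNIV. \<Sum>q\<in>UNIV \<times> {- M..M}. ?B (fst p) (snd p) (fst q) (snd q))"
        by (simp only: pairs fst_conv snd_conv)
      also have "\<dots> = (\<Sum>q\<in>UNIV \<times> {- M..M}. \<Sum>p\<in>UNIV \<times> UNIV. ?B (fst p) (snd p) (fst q) (snd q))"
        by (rule sum.swap)
      also have "\<dots> = (\<Sum>k\<in>UNIV. \<Sum>m\<in>{- M..M}. \<Sum>i\<in>UNIV. \<Sum>j\<in>UNIV. ?B i j k m)"
        by (simp only: pairs fst_conv snd_conv)
      also have "\<dots> = (\<Sum>m\<in>{- M..M}. \<Sum>k\<in>UNIV. ordered_mode (Inr k) m v)"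
        by (subst sum.swap) (simp only: ordered_mode_odd[OF v])
      finally show ?thesis .
    qed
    show ?thesis
      unfolding d_qL_def residue_op_def qL_field_def a b c first second sum_UNIV_sum sum.distrib ..
  qed
  then show ?thesis using j(2) by (intro exI[of _ "max j0 M1"]) auto
qed

lemma ordered_mode_zero [simp]: "ordered_mode a m 0 = 0"
  using field_zero[OF field_D, of a] by (simp add: ordered_mode_def)

lemma ordered_mode_fock [simp]: "v \<in> fock U \<Longrightarrow> ordered_mode a m v \<in> fock U"
  by (simp add: ordered_mode_def)

lemma Q_fock [simp]: "v \<in> fock U \<Longrightarrow> Q v \<in> fock U"
  using Q_modes[of v] by (metis (no_types, lifting) fock_sum ordered_mode_fock order_refl)

text \<open>
  A window, depending on the vector, beyond which no mode contributes to \<open>Q v\<close>.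
\<close>

definition mode_bound :: "('k, 'n) vec_fun \<Rightarrow> int"
  where "mode_bound v = (SOME M0. M0 \<ge> 0 \<and> (\<forall>M\<ge>M0. Q v = (\<Sum>m\<in>{- M..M}. \<Sum>a\<in>UNIV. ordered_mode a m v)))"

lemma Q_window:
  assumes "v \<in> fock U" "mode_bound v \<le> M"
  shows "Q v = (\<Sum>m\<in>{- M..M}. \<Sum>a\<in>UNIV. ordered_mode a m v)"
  using someI_ex[OF Q_modes[OF assms(1), folded Bex_def]] assms(2) unfolding mode_bound_def by blast

end

context poisson_bcbg
begin

section \<open>The square of the differential\<close>

text \<open>
  The sign \<open>(-1)\<^bsup>|D a|\<^esup>\<close> for passing the odd operator \<open>Q\<close> through \<open>D a\<close>.
\<close>

definition D_sign :: "'n + 'n \<Rightarrow> 'k"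
  where "D_sign a = (if parity a then 1 else - 1)"

lemma mom_D:
  "v \<in> fock U \<Longrightarrow> mom a k (D b l v) = scale (swap_sign (parity a) (\<not> parity b)) (D b l (mom a k v)) + scale hbar (J a b (k + l) v)"
  using mom_deriv_D[of a k b] by (simp add: mom_deriv_def)

lemma D_D: "v \<in> fock U \<Longrightarrow> D a k (D b l v) = scale (swap_sign (\<not> parity a) (\<not> parity b)) (D b l (D a k v))"
  by (rule supercommuteD[OF supercommute_D_D])

lemma J_D: "v \<in> fock U \<Longrightarrow> J b c l (D a k v) = scale (swap_sign (\<not> parity a) (parity b = parity c)) (D a k (J b c l v))"
  by (rule supercommuteD[OF supercommute_sym[OF supercommute_D_J]]) simp_all

text \<open>
  In either order of the two factors there is exactly one contraction, between the momentum and
  \<open>D b\<close>.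
\<close>

lemma ordered_mode_D:
  assumes v: "v \<in> fock U"
  shows "ordered_mode a m (D b l v) = scale (D_sign b) (D b l (ordered_mode a m v))
    + scale hbar (D a (- m - 1) (J a b (m + l) v))"
proof (cases "m < 0")
  case False
  have "D a (- m - 1) (mom a m (D b l v))
    = scale (swap_sign (parity a) (\<not> parity b)) (D a (- m - 1) (D b l (mom a m v))) + scale hbar (D a (- m - 1) (J a b (m + l) v))"
    using v by (simp only: mom_D D_add D_scale fock_scale D_fock J_fock mom_fock)
  also have "D a (- m - 1) (D b l (mom a m v)) = scale (swap_sign (\<not> parity a) (\<not> parity b)) (D b l (D a (- m - 1) (mom a m v)))"
    using v by (intro D_D mom_fock)
  also have "scale (swap_sign (parity a) (\<not> parity b)) \<dots> = scale (D_sign b) (D b l (D a (- m - 1) (mom a m v)))"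
    unfolding vec_fun.scale_scale
    by (rule arg_cong2[where f = scale]) (auto simp: swap_sign_def D_sign_def)
  finally show ?thesis unfolding ordered_mode_def using False by (simp only: if_False)
next
  case True
  have "mom a m (D a (- m - 1) (D b l v)) = scale (swap_sign (\<not> parity a) (\<not> parity b)) (mom a m (D b l (D a (- m - 1) v)))"
    using v by (simp only: D_D[of v a _ b] mom_scale D_fock)
  also have "mom a m (D b l (D a (- m - 1) v)) = scale (swap_sign (parity a) (\<not> parity b)) (D b l (mom a m (D a (- m - 1) v)))
    + scale hbar (J a b (m + l) (D a (- m - 1) v))"
    using v by (intro mom_D D_fock)
  also have "J a b (m + l) (D a (- m - 1) v) = scale (swap_sign (\<not> parity a) (parity a = parity b)) (D a (- m - 1) (J a b (m + l) v))"
    by (rule J_D[OF v])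
  also have "scale (swap_sign (\<not> parity a) (\<not> parity b)) (scale (swap_sign (parity a) (\<not> parity b)) (D b l (mom a m (D a (- m - 1) v)))
    + scale hbar (scale (swap_sign (\<not> parity a) (parity a = parity b)) (D a (- m - 1) (J a b (m + l) v))))
    = scale (D_sign b) (D b l (mom a m (D a (- m - 1) v))) + scale hbar (D a (- m - 1) (J a b (m + l) v))"
    unfolding vec_fun.scale_right_distrib vec_fun.scale_scale
    by (rule arg_cong2[where f = "(+)"]; rule arg_cong2[where f = scale]) (auto simp: swap_sign_def D_sign_def)
  finally show ?thesis unfolding ordered_mode_def using True by (simp only: if_True)
qed

lemma ordered_mode_add: "v \<in> fock U \<Longrightarrow> w \<in> fock U \<Longrightarrow> ordered_mode a m (v + w) = ordered_mode a m v + ordered_mode a m w"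
  by (simp add: ordered_mode_def mom_add D_add)

lemma Q_add:
  assumes "v \<in> fock U" "w \<in> fock U" shows "Q (v + w) = Q v + Q w"
proof -
  define M where "M = max (mode_bound (v + w)) (max (mode_bound v) (mode_bound w))"
  have M: "mode_bound (v + w) \<le> M" "mode_bound v \<le> M" "mode_bound w \<le> M" by (simp_all add: M_def)
  show ?thesis
    unfolding Q_window[OF fock_add[OF assms] M(1)] Q_window[OF assms(1) M(2)] Q_window[OF assms(2) M(3)]
      ordered_mode_add[OF assms] sum.distrib ..
qed

lemma Q_zero [simp]: "Q 0 = 0"
  using Q_add[OF fock_zero fock_zero] by simp

lemma Q_sum: "(\<And>x. x \<in> A \<Longrightarrow> g x \<in> fock U) \<Longrightarrow> Q (sum g A) = (\<Sum>x\<in>A. Q (g x))"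
proof (induction A rule: infinite_finite_induct)
  case (insert x A)
  then have g: "g x \<in> fock U" "sum g A \<in> fock U" by (auto intro: fock_sum)
  have "Q (sum g A) = (\<Sum>x\<in>A. Q (g x))" using insert by blast
  then show ?case unfolding sum.insert[OF insert(1,2)] Q_add[OF g] by (simp only:)
qed simp_all

lemma D_sum: "(\<And>x. x \<in> A \<Longrightarrow> g x \<in> fock U) \<Longrightarrow> D a l (sum g A) = (\<Sum>x\<in>A. D a l (g x))"
  by (rule field_sum[OF field_D])

text \<open>
  The contractions in \<open>ordered_mode_D\<close> sum up to \<open>\<Sum>\<^sub>a D\<^sup>a J\<^sub>a\<^sub>b = 0\<close>.
\<close>

lemma Q_D:
  assumes v: "v \<in> fock U"
  shows "Q (D b l v) = scale (D_sign b) (D b l (Q v))"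
proof -
  obtain j where j: "v \<in> fock_le U j" "0 \<le> j" using v by (rule fock_exhausted)
  define M where "M = max (mode_bound (D b l v)) (max (mode_bound v) (j + \<bar>l\<bar>))"
  have M: "mode_bound (D b l v) \<le> M" "mode_bound v \<le> M" "j + \<bar>l\<bar> \<le> M" by (simp_all add: M_def)
  have "(\<Sum>m\<in>{- M..M}. \<Sum>a\<in>UNIV. D a (- m - 1) (J a b (m + l) v)) = (\<Sum>a\<in>UNIV. conv (D a) (J a b) l v)"
    by (subst sum.swap) (intro sum.cong refl conv_window[OF field_D field_J j, symmetric], use M in auto)
  also have "\<dots> = 0" by (rule D_J_local[OF v])
  finally have loc: "(\<Sum>m\<in>{- M..M}. \<Sum>a\<in>UNIV. D a (- m - 1) (J a b (m + l) v)) = 0" .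
  have "Q (D b l v) = scale (D_sign b) (\<Sum>m\<in>{- M..M}. \<Sum>a\<in>UNIV. D b l (ordered_mode a m v))
      + scale hbar (\<Sum>m\<in>{- M..M}. \<Sum>a\<in>UNIV. D a (- m - 1) (J a b (m + l) v))"
    unfolding Q_window[OF D_fock[OF v] M(1)] ordered_mode_D[OF v] sum.distrib vec_fun.scale_sum_right ..
  also have "\<dots> = scale (D_sign b) (D b l (Q v))"
    unfolding loc Q_window[OF v M(2)]
    using v by (simp add: D_sum fock_sum)
  finally show ?thesis .
qed

text \<open>
  Two momentum modes next to each other supercommute, and so do two modes of \<open>D\<close>; as each
  product \<open>D\<^sup>a p\<^sub>a\<close> is odd, the exchange of two of them costs the sign \<open>-1\<close>, and the terms with
  both momenta on the right cancel in pairs.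
\<close>

lemma annihilation_annihilation_antisym:
  assumes v: "v \<in> fock U"
  shows "scale (D_sign b) (D b s (D a r (mom a k (mom b m v)))) = scale (- 1) (scale (D_sign a) (D a r (D b s (mom b m (mom a k v)))))"
proof -
  let ?c = "swap_sign (\<not> parity b) (\<not> parity a) :: 'k" and ?d = "swap_sign (parity a) (parity b) :: 'k"
  have "D b s (D a r (mom a k (mom b m v))) = scale ?c (D a r (D b s (mom a k (mom b m v))))"
    using v by (intro D_D mom_fock)
  also have "\<dots> = scale (?c * ?d) (D a r (D b s (mom b m (mom a k v))))"
    unfolding mom_mom[OF v, of a k b m] using v by (simp only: D_scale mom_fock D_fock vec_fun.scale_scale)
  finally have e: "D b s (D a r (mom a k (mom b m v))) = scale (?c * ?d) (D a r (D b s (mom b m (mom a k v))))" .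
  show ?thesis unfolding e vec_fun.scale_scale
    by (rule arg_cong2[where f = scale, OF _ refl]) (auto simp: swap_sign_def D_sign_def)
qed

text \<open>
  Moving both momenta to the left costs one contraction.
\<close>

lemma creation_creation:
  assumes v: "v \<in> fock U"
  shows "mom a k (D a r (mom b m (D b s v))) =
    scale (swap_sign (parity b) (\<not> parity a)) (mom a k (mom b m (D a r (D b s v))))
    - scale hbar (scale (D_sign a) (mom a k (D b s (J b a (m + r) v))))"
proof -
  let ?c = "swap_sign (parity b) (\<not> parity a) :: 'k"
  have "mom b m (D a r (D b s v)) = scale ?c (D a r (mom b m (D b s v))) + scale hbar (J b a (m + r) (D b s v))"
    using v by (intro mom_D D_fock)
  then have "scale ?c (mom b m (D a r (D b s v))) = D a r (mom b m (D b s v)) + scale ?c (scale hbar (J b a (m + r) (D b s v)))"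
    by (simp add: vec_fun.scale_right_distrib)
  then have "D a r (mom b m (D b s v)) = scale ?c (mom b m (D a r (D b s v))) + scale (- (?c * hbar)) (J b a (m + r) (D b s v))"
    by simp
  also have "J b a (m + r) (D b s v) = scale (swap_sign (\<not> parity b) (parity b = parity a)) (D b s (J b a (m + r) v))"
    by (rule J_D[OF v])
  finally have "mom a k (D a r (mom b m (D b s v))) = scale ?c (mom a k (mom b m (D a r (D b s v))))
    + scale (- (?c * hbar) * swap_sign (\<not> parity b) (parity b = parity a)) (mom a k (D b s (J b a (m + r) v)))"
    using v by (simp only: mom_add mom_scale fock_scale D_fock J_fock mom_fock vec_fun.scale_scale)
  also have "- (?c * hbar) * swap_sign (\<not> parity b) (parity b = parity a) = - (hbar * D_sign a)"
    by (auto simp: swap_sign_def D_sign_def)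
  finally show ?thesis
    by (simp only: vec_fun.scale_minus_left vec_fun.scale_scale diff_conv_add_uminus)
qed

text \<open>
  After both momenta have been moved to the left, exchanging the two factors changes the sign.
\<close>

lemma creation_creation_antisym:
  assumes v: "v \<in> fock U"
  shows "scale (swap_sign (parity b) (\<not> parity a)) (mom a k (mom b m (D a r (D b s v))))
    = scale (- 1) (scale (swap_sign (parity a) (\<not> parity b)) (mom b m (mom a k (D b s (D a r v)))))"
proof -
  let ?c = "swap_sign (parity a) (parity b) :: 'k" and ?d = "swap_sign (\<not> parity a) (\<not> parity b) :: 'k"
  have "mom a k (mom b m (D a r (D b s v))) = scale ?c (mom b m (mom a k (D a r (D b s v))))"
    using v by (intro mom_mom D_fock)
  also have "\<dots> = scale (?c * ?d) (mom b m (mom a k (D b s (D a r v))))"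
    unfolding D_D[OF v, of a r b s] using v by (simp only: mom_scale mom_fock D_fock vec_fun.scale_scale)
  finally have e: "mom a k (mom b m (D a r (D b s v))) = scale (?c * ?d) (mom b m (mom a k (D b s (D a r v))))" .
  show ?thesis unfolding e vec_fun.scale_scale
    by (rule arg_cong2[where f = scale, OF _ refl]) (auto simp: swap_sign_def)
qed

text \<open>
  The two summands are the terms of \<open>Q\<^sup>2\<close> in which the momentum mode \<open>k\<close> stands on the left of
  \<open>D\<close> and the mode \<open>m\<close> on the right, for the two orders of the factors. Their parts with two
  momenta cancel, and one single and one double contraction are left over.
\<close>

lemma mixed_modes:
  assumes v: "v \<in> fock U"
  shows "scale (D_sign b) (D b s (mom a k (D a r (mom b m v)))) + D b s (mom b m (mom a k (D a r v)))
    = scale (hbar * hbar) (scale (D_sign a) (J a b (k + s) (J b a (m + r) v)))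
      - scale hbar (scale (D_sign a) (mom a k (D b s (J b a (m + r) v))))"
proof -
  let ?c = "swap_sign (parity b) (\<not> parity a) :: 'k" and ?d = "swap_sign (parity a) (parity b) :: 'k"
    and ?e = "swap_sign (parity a) (\<not> parity b) :: 'k"
  have "D b s (mom b m (mom a k (D a r v))) = scale ?d (D b s (mom a k (mom b m (D a r v))))"
    using mom_mom[OF D_fock[OF v], of b m a k a r] v
    by (simp only: D_scale mom_fock D_fock swap_sign_commute[of "parity b" "parity a"])
  also have "mom b m (D a r v) = scale ?c (D a r (mom b m v)) + scale hbar (J b a (m + r) v)"
    by (rule mom_D[OF v])
  finally have A: "D b s (mom b m (mom a k (D a r v))) = scale (?d * ?c) (D b s (mom a k (D a r (mom b m v))))
    + scale (?d * hbar) (D b s (mom a k (J b a (m + r) v)))"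
    using v by (simp only: mom_add mom_scale D_add D_scale fock_scale D_fock J_fock mom_fock
        vec_fun.scale_scale vec_fun.scale_right_distrib mult.assoc)
  have B: "?d * ?c = - D_sign b" by (auto simp: swap_sign_def D_sign_def)
  have C: "D b s (mom a k (J b a (m + r) v))
    = scale ?e (mom a k (D b s (J b a (m + r) v))) - scale ?e (scale hbar (J a b (k + s) (J b a (m + r) v)))"
    using mom_D[OF J_fock[OF v], of a k b s b a "m + r"] by (simp add: vec_fun.scale_right_distrib)
  have E: "scale (?d * hbar) (scale ?e x - scale ?e (scale hbar y))
    = scale (hbar * hbar) (scale (D_sign a) y) - scale hbar (scale (D_sign a) x)" for x y :: "('k, 'n) vec_fun"
    by (auto simp: swap_sign_def D_sign_def fun_eq_iff scale_apply algebra_simps)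
  show ?thesis unfolding A B C E
    by (simp only: vec_fun.scale_minus_left add.assoc[symmetric] right_minus add_0_left)
qed

text \<open>
  The square is a finite double sum over momentum modes. According to the types of the two modes
  it splits into four parts; after the cancellations of \<open>annihilation_annihilation_antisym\<close> and
  \<open>creation_creation_antisym\<close> and of the two mixed parts against each other there remain single
  contractions \<open>Y\<close> and double contractions \<open>Z\<close>. The single contractions from two creation modes
  and from mixed modes combine to the sum over all modes of \<open>D b\<close> that occurs in \<open>D_J_local\<close>,
  and \<open>Z\<close> sums to zero by \<open>J_supertrace\<close>.
\<close>

theorem Q_squared_zero:
  assumes v: "v \<in> fock U"
  shows "Q (Q v) = 0"
proof -
  obtain j where j: "v \<in> fock_le U j" "0 \<le> j" using v by (rule fock_exhausted)
  obtain M1 where M1: "0 \<le> M1" "\<And>m a. M1 < m \<Longrightarrow> mom a m v = 0" using mom_eventually_zero[OF v] by auto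
  (* K0 is a window for Q v; K is one for all the vectors to which the second Q is applied *)
  define K0 where "K0 = max j (max M1 (mode_bound v))"
  define S where "S = (\<lambda>(a, m). mode_bound (mom a m v)) ` (UNIV \<times> {- K0..K0})
    \<union> (\<lambda>(a, m). mode_bound (mom a m (D a (- m - 1) v))) ` (UNIV \<times> {- K0..K0})"
  define K where "K = Max (insert K0 S)"
  have finS: "finite S" by (simp add: S_def)
  note maxK = Max_ge[OF finite.insertI[OF finS], of _ K0, folded K_def]
  have K0: "K0 \<le> K" by (rule maxK) simp
  have Kb: "mode_bound (mom a m v) \<le> K" "mode_bound (mom a m (D a (- m - 1) v)) \<le> K"
    if "m \<in> {- K0..K0}" for a m
    by (rule maxK, use that in \<open>force simp: S_def\<close>)+
  define pos neg where "pos = {0..K}" and "neg = {- K..-1}"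
  have Kpos: "0 \<le> K" using K0 j(2) by (simp add: K0_def)
  have I: "{- K..K} = neg \<union> pos" "neg \<inter> pos = {}" "finite neg" "finite pos" using Kpos by (auto simp: pos_def neg_def)
  have split: "(\<Sum>m\<in>{- K..K}. F m) = (\<Sum>m\<in>neg. F m) + (\<Sum>m\<in>pos. F m)" for F :: "int \<Rightarrow> ('k, 'n) vec_fun"
    unfolding I(1) by (rule sum.union_disjoint[OF I(3,4,2)])
  have sgn: "m < 0" if "m \<in> neg" for m using that by (simp add: neg_def)
  have sgp: "\<not> m < 0" if "m \<in> pos" for m using that by (simp add: pos_def)
  have win0: "(0 :: ('k, 'n) vec_fun) = (\<Sum>k\<in>{- K..K}. \<Sum>a\<in>UNIV. ordered_mode a k 0)" by simp
  (* for an annihilation mode m the coordinate factor D b stands on the left, and Q passes it *)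
  have Qpos: "Q (ordered_mode b m v) = (\<Sum>k\<in>{- K..K}. \<Sum>a\<in>UNIV. scale (D_sign b) (D b (- m - 1) (ordered_mode a k (mom b m v))))"
    if m: "m \<in> pos" for b m
  proof -
    have "Q (mom b m v) = (\<Sum>k\<in>{- K..K}. \<Sum>a\<in>UNIV. ordered_mode a k (mom b m v))"
    proof (cases "m \<le> K0")
      case True
      then have "m \<in> {- K0..K0}" using m by (simp add: pos_def)
      from Kb(1)[OF this] show ?thesis by (intro Q_window mom_fock v)
    next
      case False
      then have "mom b m v = 0" by (intro M1(2)) (simp add: K0_def)
      then show ?thesis by (simp only: Q_zero win0[symmetric])
    qed
    then show ?thesis
      using v sgp[OF m] Q_D[OF mom_fock[OF v]]
      by (simp add: ordered_mode_def[of b m] D_sum fock_sum vec_fun.scale_sum_right)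
  qed
  have Qneg: "Q (ordered_mode b m v) = (\<Sum>k\<in>{- K..K}. \<Sum>a\<in>UNIV. ordered_mode a k (mom b m (D b (- m - 1) v)))"
    if m: "m \<in> neg" for b m
  proof -
    have "Q (mom b m (D b (- m - 1) v)) = (\<Sum>k\<in>{- K..K}. \<Sum>a\<in>UNIV. ordered_mode a k (mom b m (D b (- m - 1) v)))"
    proof (cases "- K0 \<le> m")
      case True
      then have "m \<in> {- K0..K0}" using m j(2) by (auto simp: neg_def K0_def)
      from Kb(2)[OF this] show ?thesis by (intro Q_window mom_fock D_fock v)
    next
      case False
      then have "D b (- m - 1) v = 0"
        using m by (intro field_vanish[OF field_D j(1)]) (auto simp: K0_def neg_def)
      then show ?thesis by (simp only: mom_zero Q_zero win0[symmetric])
    qed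
    then show ?thesis using sgn[OF m] by (simp add: ordered_mode_def[of b m])
  qed
  (* the letters P and N record whether the modes k and m are annihilation (non-negative)
     or creation (negative) modes *)
  define PP where "PP k a m b = scale (D_sign b) (D b (- m - 1) (D a (- k - 1) (mom a k (mom b m v))))" for k a m b
  define NP where "NP k a m b = scale (D_sign b) (D b (- m - 1) (mom a k (D a (- k - 1) (mom b m v))))" for k a m b
  define PN where "PN k a m b = D a (- k - 1) (mom a k (mom b m (D b (- m - 1) v)))" for k a m b
  define NN where "NN k a m b = mom a k (D a (- k - 1) (mom b m (D b (- m - 1) v)))" for k a m b
  have "Q v = (\<Sum>m\<in>{- K..K}. \<Sum>b\<in>UNIV. ordered_mode b m v)"
    by (rule Q_window[OF v]) (use K0 in \<open>simp add: K0_def\<close>)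
  then have "Q (Q v) = (\<Sum>m\<in>{- K..K}. \<Sum>b\<in>UNIV. Q (ordered_mode b m v))"
    using v by (simp only: Q_sum fock_sum ordered_mode_fock)
  also have "\<dots> = (\<Sum>m\<in>neg. \<Sum>b\<in>UNIV. \<Sum>k\<in>{- K..K}. \<Sum>a\<in>UNIV. ordered_mode a k (mom b m (D b (- m - 1) v)))
    + (\<Sum>m\<in>pos. \<Sum>b\<in>UNIV. \<Sum>k\<in>{- K..K}. \<Sum>a\<in>UNIV. scale (D_sign b) (D b (- m - 1) (ordered_mode a k (mom b m v))))"
    unfolding split[of "\<lambda>m. \<Sum>b\<in>UNIV. Q (ordered_mode b m v)"]
    by (intro arg_cong2[where f = "(+)"] sum.cong refl Qneg Qpos)
  also have "\<dots> = ((\<Sum>m\<in>neg. \<Sum>b\<in>UNIV. \<Sum>k\<in>neg. \<Sum>a\<in>UNIV. NN k a m b) + (\<Sum>m\<in>neg. \<Sum>b\<in>UNIV. \<Sum>k\<in>pos. \<Sum>a\<in>UNIV. PN k a m b))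
    + ((\<Sum>m\<in>pos. \<Sum>b\<in>UNIV. \<Sum>k\<in>neg. \<Sum>a\<in>UNIV. NP k a m b) + (\<Sum>m\<in>pos. \<Sum>b\<in>UNIV. \<Sum>k\<in>pos. \<Sum>a\<in>UNIV. PP k a m b))"
    unfolding split sum.distrib
    by (intro arg_cong2[where f = "(+)"] sum.cong refl)
      (simp_all add: ordered_mode_def NN_def PN_def NP_def PP_def sgn sgp)
  finally have QQ: "Q (Q v) = \<dots>" .
  have swap_modes: "(\<Sum>m\<in>A. \<Sum>b\<in>UNIV. \<Sum>k\<in>B. \<Sum>a\<in>UNIV. F m b k a) = (\<Sum>m\<in>B. \<Sum>b\<in>UNIV. \<Sum>k\<in>A. \<Sum>a\<in>UNIV. F k a m b)"
    for A B :: "int set" and F :: "int \<Rightarrow> 'n + 'n \<Rightarrow> int \<Rightarrow> 'n + 'n \<Rightarrow> ('k, 'n) vec_fun"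
  proof -
    have "(\<Sum>p\<in>A \<times> UNIV. \<Sum>q\<in>B \<times> UNIV. F (fst p) (snd p) (fst q) (snd q))
      = (\<Sum>q\<in>B \<times> UNIV. \<Sum>p\<in>A \<times> UNIV. F (fst p) (snd p) (fst q) (snd q))" by (rule sum.swap)
    moreover have pairs: "(\<Sum>p\<in>A \<times> UNIV. G p) = (\<Sum>m\<in>A. \<Sum>b\<in>UNIV. G (m, b))"
      for A :: "int set" and G :: "int \<times> ('n + 'n) \<Rightarrow> ('k, 'n) vec_fun"
      by (simp add: sum.cartesian_product)
    ultimately show ?thesis by (simp only: pairs fst_conv snd_conv)
  qed
  have pp: "(\<Sum>m\<in>pos. \<Sum>b\<in>UNIV. \<Sum>k\<in>pos. \<Sum>a\<in>UNIV. PP k a m b) = 0" (is "?S = 0")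
  proof (rule scale_eq_self_zero)
    have "?S = (\<Sum>m\<in>pos. \<Sum>b\<in>UNIV. \<Sum>k\<in>pos. \<Sum>a\<in>UNIV. scale (- 1) (PP m b k a))"
      unfolding PP_def by (intro sum.cong refl annihilation_annihilation_antisym[OF v])
    also have "\<dots> = (\<Sum>m\<in>pos. \<Sum>b\<in>UNIV. \<Sum>k\<in>pos. \<Sum>a\<in>UNIV. scale (- 1) (PP k a m b))"
      by (rule swap_modes)
    finally show "?S = scale (- 1) ?S" unfolding vec_fun.scale_sum_right .
  qed
  (* two momenta, single contraction, double contraction *)
  define X where "X k a m b = scale (swap_sign (parity b) (\<not> parity a))
    (mom a k (mom b m (D a (- k - 1) (D b (- m - 1) v))))" for k a m b
  define Y where "Y k a m b = scale hbar (scale (D_sign a) (mom a k (D b (- m - 1) (J b a (m - k - 1) v))))" for k a m b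
  define Z where "Z k a m b = scale (hbar * hbar) (scale (D_sign a) (J a b (k - m - 1) (J b a (m - k - 1) v)))" for k a m b
  have xx: "(\<Sum>m\<in>neg. \<Sum>b\<in>UNIV. \<Sum>k\<in>neg. \<Sum>a\<in>UNIV. X k a m b) = 0" (is "?S = 0")
  proof (rule scale_eq_self_zero)
    have "?S = (\<Sum>m\<in>neg. \<Sum>b\<in>UNIV. \<Sum>k\<in>neg. \<Sum>a\<in>UNIV. scale (- 1) (X m b k a))"
      unfolding X_def by (intro sum.cong refl creation_creation_antisym[OF v])
    also have "\<dots> = (\<Sum>m\<in>neg. \<Sum>b\<in>UNIV. \<Sum>k\<in>neg. \<Sum>a\<in>UNIV. scale (- 1) (X k a m b))"
      by (rule swap_modes)
    finally show "?S = scale (- 1) ?S" unfolding vec_fun.scale_sum_right .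
  qed
  have index: "m + (- k - 1) = m - k - 1" "k + (- m - 1) = k - m - 1" for m k :: int by simp_all
  have nn: "NN k a m b = X k a m b - Y k a m b" for k a m b
    unfolding NN_def X_def Y_def creation_creation[OF v] index ..
  have mix: "NP k a m b + PN m b k a = Z k a m b - Y k a m b" for k a m b
    unfolding NP_def PN_def Z_def Y_def mixed_modes[OF v] index ..
  have "(\<Sum>m\<in>neg. \<Sum>b\<in>UNIV. \<Sum>k\<in>pos. \<Sum>a\<in>UNIV. PN k a m b) = (\<Sum>m\<in>pos. \<Sum>b\<in>UNIV. \<Sum>k\<in>neg. \<Sum>a\<in>UNIV. PN m b k a)"
    by (rule swap_modes)
  then have "Q (Q v) = (\<Sum>m\<in>neg. \<Sum>b\<in>UNIV. \<Sum>k\<in>neg. \<Sum>a\<in>UNIV. NN k a m b)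
    + (\<Sum>m\<in>pos. \<Sum>b\<in>UNIV. \<Sum>k\<in>neg. \<Sum>a\<in>UNIV. NP k a m b + PN m b k a)"
    unfolding QQ pp sum.distrib by simp
  also have "\<dots> = (\<Sum>m\<in>pos. \<Sum>b\<in>UNIV. \<Sum>k\<in>neg. \<Sum>a\<in>UNIV. Z k a m b)
    - ((\<Sum>m\<in>neg. \<Sum>b\<in>UNIV. \<Sum>k\<in>neg. \<Sum>a\<in>UNIV. Y k a m b) + (\<Sum>m\<in>pos. \<Sum>b\<in>UNIV. \<Sum>k\<in>neg. \<Sum>a\<in>UNIV. Y k a m b))"
    unfolding nn mix sum_subtractf xx by simp
  also have "(\<Sum>m\<in>pos. \<Sum>b\<in>UNIV. \<Sum>k\<in>neg. \<Sum>a\<in>UNIV. Z k a m b) = 0"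
  proof (rule sum.neutral, rule ballI)
    fix m
    have "(\<Sum>b\<in>UNIV. \<Sum>a\<in>UNIV. Z k a m b) = 0" for k
    proof -
      have "(\<Sum>b\<in>UNIV. \<Sum>a\<in>UNIV. Z k a m b) = (\<Sum>a\<in>UNIV. \<Sum>b\<in>UNIV. Z k a m b)" by (rule sum.swap)
      also have "\<dots> = scale (- (hbar * hbar)) (\<Sum>a\<in>UNIV. \<Sum>b\<in>UNIV.
          scale (if parity a then - 1 else 1) (J a b (k - m - 1) (J b a (m - k - 1) v)))"
        unfolding Z_def vec_fun.scale_sum_right vec_fun.scale_scale
        by (intro sum.cong refl arg_cong2[where f = scale]) (auto simp: D_sign_def)
      also have "\<dots> = 0" unfolding J_supertrace[OF v] by simp
      finally show ?thesis .
    qed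
    then show "(\<Sum>b\<in>UNIV. \<Sum>k\<in>neg. \<Sum>a\<in>UNIV. Z k a m b) = 0"
      by (subst sum.swap) simp
  qed
  also have "(\<Sum>m\<in>neg. \<Sum>b\<in>UNIV. \<Sum>k\<in>neg. \<Sum>a\<in>UNIV. Y k a m b) + (\<Sum>m\<in>pos. \<Sum>b\<in>UNIV. \<Sum>k\<in>neg. \<Sum>a\<in>UNIV. Y k a m b) = 0"
  proof -
    have "(\<Sum>m\<in>{- K..K}. \<Sum>b\<in>UNIV. Y k a m b) = 0" if k: "k \<in> neg" for k a
    proof -
      have e: "- k - 1 + m = m - k - 1" "m + (- k - 1) = m - k - 1" for m by simp_all
      have "(\<Sum>m\<in>{- K..K}. \<Sum>b\<in>UNIV. D b (- m - 1) (J b a (m - k - 1) v))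
        = (\<Sum>b\<in>UNIV. conv (D b) (J b a) (- k - 1) v)"
        unfolding e(2)[symmetric]
        by (subst sum.swap) (intro sum.cong refl conv_window[OF field_D field_J j, symmetric],
            use K0 k in \<open>auto simp: K0_def neg_def\<close>)
      also have "\<dots> = 0" by (rule D_J_local[OF v])
      finally have "mom a k (\<Sum>m\<in>{- K..K}. \<Sum>b\<in>UNIV. D b (- m - 1) (J b a (m - k - 1) v)) = 0" by simp
      then have "(\<Sum>m\<in>{- K..K}. \<Sum>b\<in>UNIV. mom a k (D b (- m - 1) (J b a (m - k - 1) v))) = 0"
        using v by (simp only: mom_sum fock_sum D_fock J_fock)
      then show ?thesis unfolding Y_def vec_fun.scale_sum_right[symmetric] by simp
    qed
    then have "(\<Sum>k\<in>neg. \<Sum>a\<in>UNIV. \<Sum>m\<in>{- K..K}. \<Sum>b\<in>UNIV. Y k a m b) = 0" by simp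
    then have "(\<Sum>m\<in>{- K..K}. \<Sum>b\<in>UNIV. \<Sum>k\<in>neg. \<Sum>a\<in>UNIV. Y k a m b) = 0"
      by (subst swap_modes)
    then show ?thesis unfolding split .
  qed
  finally show ?thesis by (simp only: diff_zero)
qed

end

section \<open>Coefficients outside the chart\<close>

lemma bcbg_space_fock: "v \<in> bcbg_space U \<Longrightarrow> v \<in> fock U"
  unfolding bcbg_space_def fock_def odd_finite_def
  by (auto intro: smooth_ring.analytic)

lemma analytic_fun_on_cong:
  fixes U :: "('k::{real_normed_field,banach} ^ 'n::finite) set"
  assumes U: "open U" and f: "analytic_fun_on U f" and eq: "\<And>x. x \<in> U \<Longrightarrow> g x = f x"
  shows "analytic_fun_on U g"
  unfolding analytic_fun_on_def
proof
  fix p assume p: "p \<in> U"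
  obtain r a where r: "0 < r" "poly_box p r \<subseteq> U"
    and a: "\<forall>x\<in>poly_box p r. ((\<lambda>\<alpha>. a \<alpha> * multi_power (x - p) \<alpha>) has_sum f x) UNIV"
    using analytic_fun_on_power_series[OF U f p] .
  show "\<exists>r>0. \<exists>a. \<forall>x. (\<forall>i. norm (x $ i - p $ i) < r) \<longrightarrow>
       ((\<lambda>\<alpha>. a \<alpha> * (\<Prod>i\<in>UNIV. (x $ i - p $ i) ^ \<alpha> i)) has_sum g x) UNIV"
  proof (intro exI[of _ r] exI[of _ a] conjI allI impI)
    fix x assume "\<forall>i. norm (x $ i - p $ i) < r"
    then have x: "x \<in> poly_box p r" by (simp add: poly_box_def)
    then show "((\<lambda>\<alpha>. a \<alpha> * (\<Prod>i\<in>UNIV. (x $ i - p $ i) ^ \<alpha> i)) has_sum g x) UNIV"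
      using a r(2) eq[of x] by (auto simp: multi_power_def)
  qed (rule r)
qed

text \<open>
  Vectors supported on \<open>U\<close> are blind to the values of coefficient functions elsewhere, so the
  bivector may be replaced by its cut-off to \<open>U\<close>.
\<close>

definition supported_on :: "('k::zero ^ 'n) set \<Rightarrow> ('k, 'n) vec_fun \<Rightarrow> bool"
  where "supported_on U v \<longleftrightarrow> (\<forall>mn x. x \<notin> U \<longrightarrow> v mn x = 0)"

lemma supported_on_gen_mode: "supported_on U v \<Longrightarrow> supported_on U (gen_mode U hbar a m v)"
  by (cases a) (auto simp: supported_on_def gamma_mult_def gamma_deriv_def fun_mult_def scale_def
      even_mult_def even_deriv_def odd_mult_def odd_deriv_def partial_deriv_def)

lemma supported_on_nop: "supported_on U v \<Longrightarrow> supported_on U (nop U hbar w v)"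
proof (induction w arbitrary: v)
  case (Cons p w)
  then show ?case
    using supported_on_gen_mode[of U]
    by (cases p) (auto simp: supported_on_def scale_def)
qed simp

lemma field_term_cong:
  assumes U: "open U" and eq: "\<And>x. x \<in> U \<Longrightarrow> f x = g x" and v: "v \<in> fock U"
  shows "field_term U hbar f as v w = field_term U hbar g as v w"
proof -
  obtain u ms where w: "w = (u, ms)" by (cases w)
  let ?X = "nop U hbar (map (\<lambda>(i, m). (Gamma i, m)) u @ zip as ms) v"
  have "supported_on U v"
    unfolding supported_on_def using smooth_ring_outside[OF fock_coeff[OF v]] by blast
  then have X: "supported_on U ?X" by (rule supported_on_nop)
  then have Xz: "?X mn x = 0" if "x \<notin> U" for mn x using that unfolding supported_on_def by blast
  have "fun_mult (foldr (partial_deriv U) (map fst u) f) ?X = fun_mult (foldr (partial_deriv U) (map fst u) g) ?X"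
  proof (cases u rule: rev_cases)
    case Nil
    show ?thesis
    proof (intro ext)
      fix mn x
      show "fun_mult (foldr (partial_deriv U) (map fst u) f) ?X mn x = fun_mult (foldr (partial_deriv U) (map fst u) g) ?X mn x"
        using Xz[of x mn] eq[of x] unfolding Nil by (cases "x \<in> U") (simp_all add: fun_mult_def)
    qed
  next
    case (snoc us p)
    then show ?thesis by (simp add: partial_deriv_cong_open[OF U eq])
  qed
  then show ?thesis by (simp only: w field_term_def case_prod_conv)
qed

theorem proposition1:
  fixes U :: "('k::{real_normed_field,banach} ^ 'n::{finite,linorder}) set"
    and P :: "'n \<Rightarrow> 'n \<Rightarrow> ('k, 'n) vec \<Rightarrow> 'k"
    and hbar :: 'k
  assumes "open U"
    and "\<And>i j. analytic_fun_on U (P i j)"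
    and "\<And>i j x. x \<in> U \<Longrightarrow> P i j x = - P j i x"
    and "\<And>i j k x. x \<in> U \<Longrightarrow>
      (\<Sum>l\<in>UNIV. P l j x * partial_deriv U l (P i k) x
             + P l i x * partial_deriv U l (P k j) x
             + P l k x * partial_deriv U l (P j i) x) = 0"
  shows "\<forall>v \<in> bcbg_space U. d_qL U hbar P (d_qL U hbar P v) = 0"
proof
  fix v assume "v \<in> bcbg_space U"
  then have v: "v \<in> fock U" by (rule bcbg_space_fock)
  (* P is arbitrary outside U, whereas coefficient functions vanish there *)
  define P' where "P' i j x = (if x \<in> U then P i j x else 0)" for i j x
  have P'P: "P' i j x = P i j x" if "x \<in> U" for i j x using that by (simp add: P'_def)
  have dP': "partial_deriv U l (P' i j) = partial_deriv U l (P i j)" for l i j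
    by (rule partial_deriv_cong_open[OF assms(1) P'P])
  interpret poisson_bcbg U hbar P'
  proof
    show "open U" by fact
    show "P' i j \<in> smooth_ring U" for i j
    proof (rule smooth_ring.analytic)
      have "analytic_fun_on U (P' i j)"
        by (rule analytic_fun_on_cong[OF assms(1,2) P'P])
      then show "P' i j \<in> analytic_functions U" by (simp add: analytic_functions_def P'_def)
    qed
    show "P' i j x = - P' j i x" for i j x
      using assms(3)[of x i j] by (cases "x \<in> U") (simp_all only: P'_def if_True if_False minus_zero)
    show "(\<Sum>l\<in>UNIV. P' l j x * partial_deriv U l (P' i k) x
             + P' l i x * partial_deriv U l (P' k j) x
             + P' l k x * partial_deriv U l (P' j i) x) = 0" for i j k x
      using assms(4)[of x j i k] by (cases "x \<in> U") (simp_all add: dP' P'P partial_deriv_outside)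
  qed
  have same: "field_term U hbar (P i j) as w = field_term U hbar (P' i j) as w" if w: "w \<in> fock U" for i j as w
    by (rule ext, rule field_term_cong[OF assms(1) P'P[symmetric] w])
  have Q: "d_qL U hbar P w = Q w" if w: "w \<in> fock U" for w
    by (simp add: d_qL_def residue_op_def qL_field_def normal_field_def same[OF w] dP')
  show "d_qL U hbar P (d_qL U hbar P v) = 0"
    using Q_squared_zero[OF v] by (simp add: Q v)
qed

end
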